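(* Let $\Delta=(\Sigma,C,w^\pm)$ be a (not necessarily simplicial) multi-fan in a lattice $L$ of rank $n$ such that every $J\in\Sigma$ satisfies $J\preceq I$ for some $I\in\Sigma^{(n)}$. Let $\mathcal V=\{v_i\}_{i\in\Sigma^{(1)}}$ be a set of non-zero vectors $v_i\in L\cap C(i)$, and let $\xi=\{d_i\}_{i\in\Sigma^{(1)}}$ be a set of rational numbers. If $\xi$ is $\mathbb Q$-Cartier, then for a triangulation $\Delta'$ of $\Delta$ the orbifold elliptic genus $\hat\varphi_{st}(\Delta',\mathcal V,\xi')$, where $\xi'=\sum_id_ix_i\in H_T^2(\Delta',\mathcal V)\otimes\mathbb Q$ is the $\mathbb Q$-divisor on $\Delta'$ determined by $\xi$, does not depend on the triangulation $\Delta'$; it depends only on $(\Delta,\mathcal V,\xi)$.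
   Context: **Multi-fans.** Let $L$ be a lattice of rank $n$, $L_{\mathbb R}=L\otimes\mathbb R$, $L_{\mathbb C}=L\otimes\mathbb C$, $L_{\mathbb Q}^*=L^*\otimes\mathbb Q$. A (not necessarily simplicial) multi-fan in $L$ is a triple $\Delta=(\Sigma,C,w^\pm)$, where $\Sigma$ is a (finite) partially ordered set with order $\preceq$ and unique minimum $*$, $C$ is a map from $\Sigma$ to the set of strongly convex rational cones in $L_{\mathbb R}$ such that (i) $C( * )=\{0\}$; (ii) if $K\preceq J$ then $C(K)$ is a face of $C(J)$; (iii) for any $J\in\Sigma$, $C$ restricted to $\{K\in\Sigma: K\preceq J\}$ is an isomorphism of ordered sets onto the set of faces of $C(J)$. Put $\Sigma^{(k)}=\{K\in\Sigma:\dim C(K)=k\}$; $w^\pm:\Sigma^{(n)}\to\mathbb Z_{\ge0}$ are maps, $w=w^+-w^-$. The multi-fan is simplicial if moreover $\Sigma$ is a finite abstract simplicial complex including the empty simplex, with $\Sigma^{(k)}$ the simplices with $k$ vertices, $\Sigma=\coprod_{k=0}^n\Sigma^{(k)}$, $\Sigma^{(n)}\neq\emptyset$, every simplex lying in some $I\in\Sigma^{(n)}$, and all cones simplicial with $\dim C(J)=|J|$. **Triangulations.** A triangulation of $\Delta$ is a simplicial multi-fan $\Delta'=(\Sigma',C',w'^\pm)$ in $L$ together with an order-preserving map $\rho:\Sigma'\to\Sigma$ such that: a) there is a bijection $\kappa:\Sigma^{(1)}\to\Sigma'^{(1)}$ with $C(i)=C'(\kappa(i))$ and $\rho(\kappa(i))=i$;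 b) for each $J'\in\Sigma'$, $C'(J')\subset C(\rho(J'))$ with $\rho(J')$ the minimal such element, and for each $J\in\Sigma$ the cones $C'(J')$ with $\rho(J')\preceq J$ (pairwise distinct) form a subdivision of $C(J)$; c) $w'^\pm(I')=w^\pm(\rho(I'))$ for $I'\in\Sigma'^{(n)}$. $\Sigma'^{(1)}$ is identified with $\Sigma^{(1)}$ via $\kappa$, so $\mathcal V$ is also a set of edge vectors for $\Delta'$. **$\mathbb Q$-Cartier.** $\xi=\{d_i\}_{i\in\Sigma^{(1)}}$ is $\mathbb Q$-Cartier if for each $I\in\Sigma^{(n)}$ there is $u(I)\in L_{\mathbb Q}^*$ with $\langle u(I),v_i\rangle=d_i$ for all $i\in\Sigma^{(1)}$ with $i\preceq I$. **Orbifold elliptic genus of a simplicial multi-fan $\Delta'$.** $H_T^*(\Delta',\mathcal V)$ is the Stanley–Reisner ring of $\Sigma'$ generated by $x_i$, $i\in\Sigma'^{(1)}$, in degree 2. For $I\in\Sigma'^{(n)}$ let $L_{I,\mathcal V}\subset L$ be the sublattice generated by $\{v_i\}_{i\in I}$, $\{u_i^I\}_{i\in I}$ the basis of $L_{I,\mathcal V}^*$ dual to $\{v_i\}_{i\in I}$, $H_I=L/L_{I,\mathcal V}$. Put $q=e^{2\pi\sqrt{-1}\tau}$ ($\Im\tau>0$), $\zeta=e^{2\pi\sqrt{-1}\sigma}$, $\zeta^a:=e^{2\pi\sqrt{-1}a\sigma}$, and with $t=e^{2\pi\sqrt{-1}z}$, $$\phi_{st}(z,\tau,\sigma)=\frac{1-\zeta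 t}{(1-\zeta)(1-t)}\prod_{k\ge1}\frac{(1-q^k)^2(1-\zeta tq^k)(1-\zeta^{-1}t^{-1}q^k)}{(1-\zeta q^k)(1-\zeta^{-1}q^k)(1-tq^k)(1-t^{-1}q^k)}.$$ Then $\hat\varphi_{st}(\Delta',\mathcal V,\xi')$ is the function of $w\in L_{\mathbb C}$ (meromorphic in $w$) $$\hat\varphi_{st}(\Delta',\mathcal V,\xi')(w)=\sum_{I\in\Sigma'^{(n)}}\frac{w'(I)}{|H_I|}\sum_{(h_1,h_2)\in H_I\times H_I}\prod_{i\in I}\zeta^{d_i\langle u_i^I,v(h_1)\rangle}\phi_{st}\bigl(\langle u_i^I,-w+\tau v(h_1)-v(h_2)\rangle,\tau,d_i\sigma\bigr),$$ with $v(h)\in L$ any representative of $h$ and $w'=w'^+-w'^-$. It is understood that $d_i\sigma\notin\mathbb Z+\mathbb Z\tau$ for all $i$, so that the expression is defined. *)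

theory Defs
  imports "HOL-Analysis.Analysis"
begin

section \<open>Lattices\<close>

text \<open>Meaningful for finite \<open>S\<close> only, since infinite sums are 0 by convention.\<close>

definition int_span :: "'a::real_vector set \<Rightarrow> 'a set" where
  "int_span S = {\<Sum>b\<in>S. of_int (c b) *\<^sub>R b | c :: 'a \<Rightarrow> int. True}"

text \<open>
  A lattice \<open>L\<close> of rank \<open>n\<close> is realised inside some Euclidean space, not necessarily
  as a full lattice (so that \<open>n = 0\<close> is allowed). Thus \<open>L \<otimes> \<real>\<close> is \<open>span L\<close>,
  and an element \<open>x + \<i>y\<close> of \<open>L \<otimes> \<complex>\<close> is the pair \<open>(x, y)\<close> with
  \<open>x, y \<in> span L\<close>.
\<close>

definition is_lattice :: "nat \<Rightarrow> 'a::euclidean_space set \<Rightarrow> bool" where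
  "is_lattice n L \<longleftrightarrow> (\<exists>B. independent B \<and> card B = n \<and> L = int_span B)"

text \<open>
  Elements of the dual spaces of \<open>L \<otimes> \<real>\<close> are represented by linear functionals on
  the ambient space; only their restrictions to \<open>span L\<close> matter.
\<close>

definition rational_dual :: "'a::euclidean_space set \<Rightarrow> ('a \<Rightarrow> real) set" where
  "rational_dual L = {u. linear u \<and> u ` L \<subseteq> \<rat>}"

definition complexification :: "'a::euclidean_space set \<Rightarrow> ('a \<times> 'a) set" where
  "complexification L = span L \<times> span L"

definition tensor_complex :: "complex \<Rightarrow> 'a::real_vector \<Rightarrow> 'a \<times> 'a" where
  "tensor_complex c x = (Re c *\<^sub>R x, Im c *\<^sub>R x)"

definition pairing_complex :: "('a \<Rightarrow> real) \<Rightarrow> 'a \<times> 'a \<Rightarrow> complex" where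
  "pairing_complex u w = Complex (u (fst w)) (u (snd w))"


section \<open>Cones and multi-fans\<close>

definition strongly_convex_rational_cone :: "'a::euclidean_space set \<Rightarrow> 'a set \<Rightarrow> bool" where
  "strongly_convex_rational_cone L \<sigma> \<longleftrightarrow>
     (\<exists>S. finite S \<and> S \<subseteq> L \<and> \<sigma> = convex_cone hull S) \<and> \<sigma> \<inter> uminus ` \<sigma> = {0}"

definition simplicial_cone :: "'a::euclidean_space set \<Rightarrow> bool" where
  "simplicial_cone \<sigma> \<longleftrightarrow> (\<exists>S. independent S \<and> \<sigma> = convex_cone hull S)"

text \<open>
  The library counts the empty set as a face of every convex set; it is not a face of a cone.
\<close>

definition cone_faces :: "'a::euclidean_space set \<Rightarrow> 'a set set" where
  "cone_faces \<sigma> = {F. F face_of \<sigma> \<and> F \<noteq> {}}"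

text \<open>Only the values of \<open>wplus\<close> and \<open>wminus\<close> on top-dimensional elements are relevant.\<close>

record ('s, 'a) multi_fan =
  elts :: "'s set"
  leq :: "'s \<Rightarrow> 's \<Rightarrow> bool"
  cone_of :: "'s \<Rightarrow> 'a set"
  wplus :: "'s \<Rightarrow> nat"
  wminus :: "'s \<Rightarrow> nat"

definition stratum :: "('s, 'a::euclidean_space) multi_fan \<Rightarrow> nat \<Rightarrow> 's set" where
  "stratum \<Delta> k = {K \<in> elts \<Delta>. dim (cone_of \<Delta> K) = k}"

definition weight :: "('s, 'a) multi_fan \<Rightarrow> 's \<Rightarrow> int" where
  "weight \<Delta> I = int (wplus \<Delta> I) - int (wminus \<Delta> I)"

definition is_multi_fan :: "'a::euclidean_space set \<Rightarrow> ('s, 'a) multi_fan \<Rightarrow> bool" where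
  "is_multi_fan L \<Delta> \<longleftrightarrow>
     finite (elts \<Delta>) \<and>
     reflp_on (elts \<Delta>) (leq \<Delta>) \<and> antisymp_on (elts \<Delta>) (leq \<Delta>) \<and>
     transp_on (elts \<Delta>) (leq \<Delta>) \<and>
     (\<forall>J\<in>elts \<Delta>. strongly_convex_rational_cone L (cone_of \<Delta> J)) \<and>
     (\<exists>m\<in>elts \<Delta>. (\<forall>J\<in>elts \<Delta>. leq \<Delta> m J) \<and> cone_of \<Delta> m = {0}) \<and>
     (\<forall>J\<in>elts \<Delta>. \<forall>K\<in>elts \<Delta>. leq \<Delta> K J \<longrightarrow> cone_of \<Delta> K \<in> cone_faces (cone_of \<Delta> J)) \<and>
     (\<forall>J\<in>elts \<Delta>.
        bij_betw (cone_of \<Delta>) {K \<in> elts \<Delta>. leq \<Delta> K J} (cone_faces (cone_of \<Delta> J)) \<and>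
        (\<forall>K\<in>{K \<in> elts \<Delta>. leq \<Delta> K J}. \<forall>K'\<in>{K \<in> elts \<Delta>. leq \<Delta> K J}.
           leq \<Delta> K K' \<longleftrightarrow> cone_of \<Delta> K \<subseteq> cone_of \<Delta> K'))"

text \<open>
  For simplicial multi-fans the poset is a set of finite sets of vertices ordered by inclusion;
  the elements of \<open>stratum \<Delta> 1\<close> are then the singletons \<open>{x}\<close>.
\<close>

definition is_simplicial_multi_fan ::
    "nat \<Rightarrow> 'a::euclidean_space set \<Rightarrow> ('v set, 'a) multi_fan \<Rightarrow> bool" where
  "is_simplicial_multi_fan n L \<Delta> \<longleftrightarrow>
     is_multi_fan L \<Delta> \<and>
     {} \<in> elts \<Delta> \<and>
     (\<forall>J\<in>elts \<Delta>. finite J \<and> (\<forall>K. K \<subseteq> J \<longrightarrow> K \<in> elts \<Delta>)) \<and>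
     (\<forall>J\<in>elts \<Delta>. \<forall>K\<in>elts \<Delta>. leq \<Delta> K J \<longleftrightarrow> K \<subseteq> J) \<and>
     (\<forall>J\<in>elts \<Delta>. simplicial_cone (cone_of \<Delta> J) \<and> dim (cone_of \<Delta> J) = card J) \<and>
     elts \<Delta> = (\<Union>k\<le>n. stratum \<Delta> k) \<and>
     stratum \<Delta> n \<noteq> {} \<and>
     (\<forall>J\<in>elts \<Delta>. \<exists>I\<in>stratum \<Delta> n. J \<subseteq> I)"


section \<open>Triangulations\<close>

definition is_subdivision :: "'a::euclidean_space set \<Rightarrow> 'a set set \<Rightarrow> 'a set \<Rightarrow> bool" where
  "is_subdivision L \<F> \<sigma> \<longleftrightarrow>
     finite \<F> \<and>
     (\<forall>\<tau>\<in>\<F>. strongly_convex_rational_cone L \<tau>) \<and>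
     (\<forall>\<tau>\<in>\<F>. cone_faces \<tau> \<subseteq> \<F>) \<and>
     (\<forall>\<tau>\<in>\<F>. \<forall>\<tau>'\<in>\<F>. \<tau> \<inter> \<tau>' \<in> cone_faces \<tau> \<and> \<tau> \<inter> \<tau>' \<in> cone_faces \<tau>') \<and>
     \<Union>\<F> = \<sigma>"

definition is_triangulation ::
    "nat \<Rightarrow> 'a::euclidean_space set \<Rightarrow> ('s, 'a) multi_fan \<Rightarrow> ('v set, 'a) multi_fan \<Rightarrow>
     ('v set \<Rightarrow> 's) \<Rightarrow> ('s \<Rightarrow> 'v set) \<Rightarrow> bool" where
  "is_triangulation n L \<Delta> \<Delta>' \<rho> \<kappa> \<longleftrightarrow>
     is_simplicial_multi_fan n L \<Delta>' \<and>
     \<rho> \<in> elts \<Delta>' \<rightarrow> elts \<Delta> \<and>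
     (\<forall>J\<in>elts \<Delta>'. \<forall>K\<in>elts \<Delta>'. leq \<Delta>' J K \<longrightarrow> leq \<Delta> (\<rho> J) (\<rho> K)) \<and>
     bij_betw \<kappa> (stratum \<Delta> 1) (stratum \<Delta>' 1) \<and>
     (\<forall>i\<in>stratum \<Delta> 1. cone_of \<Delta> i = cone_of \<Delta>' (\<kappa> i) \<and> \<rho> (\<kappa> i) = i) \<and>
     (\<forall>J'\<in>elts \<Delta>'.
        cone_of \<Delta>' J' \<subseteq> cone_of \<Delta> (\<rho> J') \<and>
        (\<forall>K\<in>elts \<Delta>. cone_of \<Delta>' J' \<subseteq> cone_of \<Delta> K \<and> leq \<Delta> K (\<rho> J') \<longrightarrow> K = \<rho> J')) \<and>
     (\<forall>J\<in>elts \<Delta>.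
        inj_on (cone_of \<Delta>') {J' \<in> elts \<Delta>'. leq \<Delta> (\<rho> J') J} \<and>
        is_subdivision L (cone_of \<Delta>' ` {J' \<in> elts \<Delta>'. leq \<Delta> (\<rho> J') J}) (cone_of \<Delta> J)) \<and>
     (\<forall>I'\<in>stratum \<Delta>' n. wplus \<Delta>' I' = wplus \<Delta> (\<rho> I') \<and> wminus \<Delta>' I' = wminus \<Delta> (\<rho> I'))"

text \<open>
  A family indexed by \<open>stratum \<Delta> 1\<close>, regarded as a family indexed by the vertices of the
  triangulation through the identification \<open>\<kappa>\<close>.
\<close>

definition transport ::
    "('s, 'a::euclidean_space) multi_fan \<Rightarrow> ('s \<Rightarrow> 'v set) \<Rightarrow> ('s \<Rightarrow> 'b) \<Rightarrow> 'v \<Rightarrow> 'b" where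
  "transport \<Delta> \<kappa> f x = f (the_inv_into (stratum \<Delta> 1) \<kappa> {x})"

definition is_edge_vectors ::
    "'a::euclidean_space set \<Rightarrow> ('s, 'a) multi_fan \<Rightarrow> ('s \<Rightarrow> 'a) \<Rightarrow> bool" where
  "is_edge_vectors L \<Delta> v \<longleftrightarrow> (\<forall>i\<in>stratum \<Delta> 1. v i \<in> L \<inter> cone_of \<Delta> i \<and> v i \<noteq> 0)"

definition is_Q_Cartier ::
    "nat \<Rightarrow> 'a::euclidean_space set \<Rightarrow> ('s, 'a) multi_fan \<Rightarrow> ('s \<Rightarrow> 'a) \<Rightarrow> ('s \<Rightarrow> rat) \<Rightarrow> bool" where
  "is_Q_Cartier n L \<Delta> v d \<longleftrightarrow>
     (\<forall>I\<in>stratum \<Delta> n. \<exists>u\<in>rational_dual L. \<forall>i\<in>stratum \<Delta> 1. leq \<Delta> i I \<longrightarrow> u (v i) = of_rat (d i))"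


section \<open>The orbifold elliptic genus\<close>

definition e2pi :: "complex \<Rightarrow> complex" where
  "e2pi z = exp (2 * of_real pi * \<i> * z)"

definition phi_st :: "complex \<Rightarrow> complex \<Rightarrow> complex \<Rightarrow> complex" where
  "phi_st z \<tau> \<sigma> =
     (let q = e2pi \<tau>; \<zeta> = e2pi \<sigma>; t = e2pi z in
      (1 - \<zeta> * t) / ((1 - \<zeta>) * (1 - t)) *
      prodinf (\<lambda>j. let k = Suc j in
        ((1 - q ^ k)\<^sup>2 * (1 - \<zeta> * t * q ^ k) * (1 - inverse \<zeta> * inverse t * q ^ k)) /
        ((1 - \<zeta> * q ^ k) * (1 - inverse \<zeta> * q ^ k) * (1 - t * q ^ k) * (1 - inverse t * q ^ k))))"

definition period_lattice :: "complex \<Rightarrow> complex set" where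
  "period_lattice \<tau> = {of_int a + of_int b * \<tau> | a b. True}"

text \<open>
  The sets \<open>I\<close> are simplices with \<open>n\<close> vertices and the vectors \<open>v x\<close>, \<open>x \<in> I\<close>, form
  a basis of \<open>span L\<close>; on \<open>span L\<close> the functional below is therefore uniquely determined.
\<close>

definition dual_basis :: "('v \<Rightarrow> 'a::euclidean_space) \<Rightarrow> 'v set \<Rightarrow> 'v \<Rightarrow> 'a \<Rightarrow> real" where
  "dual_basis v I x = (SOME u. linear u \<and> (\<forall>y\<in>I. u (v y) = (if y = x then 1 else 0)))"

definition quotient_group ::
    "'a::euclidean_space set \<Rightarrow> ('v \<Rightarrow> 'a) \<Rightarrow> 'v set \<Rightarrow> 'a set set" where
  "quotient_group L v I = L // {(a, b). a \<in> L \<and> b \<in> L \<and> a - b \<in> int_span (v ` I)}"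

definition representative :: "'a set \<Rightarrow> 'a" where
  "representative h = (SOME a. a \<in> h)"

definition phi_argument ::
    "('v \<Rightarrow> 'a::euclidean_space) \<Rightarrow> complex \<Rightarrow> 'a \<times> 'a \<Rightarrow> 'v set \<Rightarrow> 'a set \<Rightarrow> 'a set \<Rightarrow> 'v \<Rightarrow> complex" where
  "phi_argument v \<tau> w I h1 h2 x =
     pairing_complex (dual_basis v I x)
       (- w + tensor_complex \<tau> (representative h1) - tensor_complex 1 (representative h2))"

text \<open>
  The divisor, an element of degree 2 of the rational Stanley--Reisner ring of \<open>\<Delta>\<close>, is given
  by its coefficients \<open>d x\<close> with respect to the generators of that ring; these generators form
  a basis of the degree 2 part.
\<close>

definition orbifold_elliptic_genus ::
    "nat \<Rightarrow> 'a::euclidean_space set \<Rightarrow> ('v set, 'a) multi_fan \<Rightarrow> ('v \<Rightarrow> 'a) \<Rightarrow> ('v \<Rightarrow> rat) \<Rightarrow>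
     complex \<Rightarrow> complex \<Rightarrow> 'a \<times> 'a \<Rightarrow> complex" where
  "orbifold_elliptic_genus n L \<Delta> v d \<tau> \<sigma> w =
     (\<Sum>I\<in>stratum \<Delta> n. of_int (weight \<Delta> I) / of_nat (card (quotient_group L v I)) *
        (\<Sum>(h1, h2)\<in>quotient_group L v I \<times> quotient_group L v I.
           \<Prod>x\<in>I. e2pi (of_rat (d x) * of_real (dual_basis v I x (representative h1)) * \<sigma>) *
                 phi_st (phi_argument v \<tau> w I h1 h2 x) \<tau> (of_rat (d x) * \<sigma>)))"

text \<open>
  For \<open>\<sigma> \<notin> period_lattice \<tau>\<close> the poles of \<open>\<lambda>z. phi_st z \<tau> \<sigma>\<close> are exactly the points of
  \<open>period_lattice \<tau>\<close>. The following set is where every term of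
  the genus is defined. Its complement in \<open>L \<otimes> \<complex>\<close> is a locally finite union of complex affine
  hyperplanes, so two such genera are equal as meromorphic functions iff their values
  agree wherever both are defined in this sense.
\<close>

definition genus_domain ::
    "nat \<Rightarrow> 'a::euclidean_space set \<Rightarrow> ('v set, 'a) multi_fan \<Rightarrow> ('v \<Rightarrow> 'a) \<Rightarrow> complex \<Rightarrow> ('a \<times> 'a) set" where
  "genus_domain n L \<Delta> v \<tau> =
     {w \<in> complexification L. \<forall>I\<in>stratum \<Delta> n. \<forall>h1\<in>quotient_group L v I. \<forall>h2\<in>quotient_group L v I.
        \<forall>x\<in>I. phi_argument v \<tau> w I h1 h2 x \<notin> period_lattice \<tau>}"

end

theory Submission
  imports Defs "HOL-Complex_Analysis.Complex_Analysis"
begin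

text \<open>
  For \<open>0 < Im z < Im \<tau>\<close> the function \<open>\<phi>\<^sub>s\<^sub>t\<close> is the Kronecker series
  \<open>\<Sum>\<^sub>k t\<^sup>k / (1 - \<zeta> q\<^sup>k)\<close>. Expanding every factor in this way, the sum over \<open>h\<^sub>2\<close> is a
  character sum that selects the exponents lying in the dual lattice \<open>L\<^sup>*\<close>. After choosing
  representatives \<open>h\<^sub>1\<close> in a translated fundamental cell, the coefficient belonging to
  \<open>m \<in> L\<^sup>*\<close> becomes the generating function \<open>\<Sum> e(Y(x))\<close>, summed over the lattice points \<open>x\<close> of the
  shifted cone \<open>y\<^sub>0 + C'(I')\<close>, where \<open>y\<^sub>0 = Im w / Im \<tau>\<close> and \<open>Y = \<sigma> u(I) + \<tau> m\<close>; here the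
  \<open>\<rat>\<close>-Cartier condition makes \<open>Y\<close> depend on \<open>I = \<rho>(I')\<close> only. For generic \<open>w\<close> no lattice point lies
  on a wall, so these generating functions add up to the one of \<open>y\<^sub>0 + C(I)\<close>: directly when
  \<open>Im Y\<close> is positive on \<open>C(I)\<close>, and by analytic continuation in \<open>Y\<close> otherwise. Arbitrary \<open>w\<close> are reached
  by continuity.
\<close>

section \<open>The Kronecker series\<close>

text \<open>The groups L / L_{I,V} and the dual bases belong to single simplices, so the terms of
  two triangulations cannot be matched. The expansion moves everything to the index set L^*, which
  no triangulation enters. Linearity of u(I) turns the product of the \<zeta>^{d_i <u_i, v(h)>} into
  one exponential of \<sigma> u(I), and each denominator 1 - \<zeta>^{d_i} q^{<m, v_i>} into 1 -
  e(Y(v_i)). Convergence is the obstacle. Kronecker's series needs arguments strictly inside a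
  strip, which ties the representatives of h_1 to \<open>w\<close> and excludes walls; the same
  exclusion makes the shifted cones of a subdivision disjoint on lattice points, so no half-open
  cones are needed. For many m the imaginary part of Y is not positive on the cone and the sum over
  lattice points diverges. The coefficient is then only a rational expression in exponentials; it is
  compared along a line Y + l \<psi>, with \<psi> positive on the rays, after multiplication by a
  common denominator that makes both sides entire in l.\<close>

definition qpoch :: "complex \<Rightarrow> complex \<Rightarrow> complex" where
  "qpoch q x = (\<Prod>j. 1 - x * q ^ j)"

lemma qpoch_convergent:
  fixes q x :: complex
  assumes "norm q < 1"
  shows "convergent_prod (\<lambda>j. 1 - x * q ^ j)"
proof -
  have "summable (\<lambda>j. norm x * norm q ^ j)"
    using assms by (intro summable_mult summable_geometric) simp
  moreover have "norm (1 - x * q ^ j - 1) = norm x * norm q ^ j" for j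
    by (simp add: norm_mult norm_power)
  ultimately have "summable (\<lambda>j. norm (1 - x * q ^ j - 1))"
    by simp
  then have "abs_convergent_prod (\<lambda>j. 1 - x * q ^ j)"
    by (simp only: abs_convergent_prod_conv_summable)
  then show ?thesis
    by (rule abs_convergent_prod_imp_convergent_prod)
qed

lemma qpoch_eq_0_iff:
  assumes "norm q < 1"
  shows "qpoch q x = 0 \<longleftrightarrow> (\<exists>j. x * q ^ j = 1)"
  using has_prod_eq_0_iff[OF convergent_prod_has_prod[OF qpoch_convergent[OF assms, of x]]]
  unfolding qpoch_def by (auto simp: image_iff eq_commute[of 1])

lemma qpoch_nonzero:
  assumes "norm q < 1" "norm x < 1"
  shows "qpoch q x \<noteq> 0"
proof -
  have "x * q ^ j \<noteq> 1" for j
  proof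
    assume "x * q ^ j = 1"
    then have "1 = norm x * norm q ^ j"
      by (metis norm_mult norm_one norm_power)
    also have "\<dots> \<le> norm x * 1"
      using assms by (intro mult_left_mono power_le_one) auto
    finally show False
      using assms by simp
  qed
  then show ?thesis
    using qpoch_eq_0_iff[OF assms(1)] by blast
qed

lemma qpoch_shift:
  assumes "norm q < 1"
  shows "qpoch q x = (1 - x) * qpoch q (q * x)"
\<comment> \<open>Splitting off the head divides by \<open>1 - x\<close>, so \<open>x = 1\<close>,
  where both sides vanish, is separate.\<close>
proof (cases "x = 1")
  case True
  then show ?thesis
    using qpoch_eq_0_iff[OF assms, of x] by (auto intro: exI[of _ 0])
next
  case False
  then show ?thesis
    using prodinf_split_head[OF qpoch_convergent[OF assms, of x]]
    by (simp add: qpoch_def mult_ac)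
qed

text \<open>Locally uniform limits of polynomials: on \<open>cball x 1\<close> the
  \<open>j\<close>-th factor differs from 1 by at most \<open>(norm x + 1) * norm q ^ j\<close>,
  which is summable.\<close>

lemma qpoch_holomorphic:
  assumes "norm q < 1"
  shows "qpoch q holomorphic_on UNIV"
proof (rule holomorphic_uniform_sequence)
  fix x :: complex
  let ?P = "\<lambda>N x. \<Prod>j<N. 1 - x * q ^ j"
  have "uniformly_convergent_on (cball x 1) ?P"
  proof (rule uniformly_convergent_on_prod')
    show "uniformly_convergent_on (cball x 1) (\<lambda>N x. \<Sum>j<N. norm (1 - x * q ^ j - 1))"
    proof (rule Weierstrass_m_test'_ev)
      show "\<forall>\<^sub>F j in sequentially. \<forall>y\<in>cball x 1.
          norm (norm (1 - y * q ^ j - 1)) \<le> (norm x + 1) * norm q ^ j"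
      proof (intro always_eventually allI ballI)
        fix j y assume "y \<in> cball x 1"
        then have "norm y \<le> norm x + 1"
          using norm_triangle_ineq2[of y x] by (simp add: dist_norm norm_minus_commute)
        then show "norm (norm (1 - y * q ^ j - 1)) \<le> (norm x + 1) * norm q ^ j"
          by (simp add: norm_mult norm_power mult_right_mono)
      qed
      show "summable (\<lambda>j. (norm x + 1) * norm q ^ j)"
        using assms by (intro summable_mult summable_geometric) simp
    qed
  next
    show "continuous_on (cball x 1) (\<lambda>y. 1 - y * q ^ j)" for j
      by (intro continuous_intros)
  qed simp
  then obtain g where g: "uniform_limit (cball x 1) ?P g sequentially"
    by (auto simp: uniformly_convergent_on_def)
  have "uniform_limit (cball x 1) ?P (qpoch q) sequentially"
  proof (rule uniform_limit_cong'[THEN iffD1, OF _ _ g])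
    fix y :: complex assume y: "y \<in> cball x 1"
    have "(\<lambda>N. ?P (Suc N) y) \<longlonglongrightarrow> qpoch q y"
      using convergent_prod_LIMSEQ[OF qpoch_convergent[OF assms, of y]]
      by (simp add: qpoch_def lessThan_Suc_atMost)
    moreover have "(\<lambda>N. ?P N y) \<longlonglongrightarrow> g y"
      using g y by (rule tendsto_uniform_limitI)
    ultimately show "g y = qpoch q y"
      using LIMSEQ_Suc LIMSEQ_unique by blast
  qed simp
  then show "\<exists>d>0. cball x d \<subseteq> UNIV \<and> uniform_limit (cball x d) ?P (qpoch q) sequentially"
    by (intro exI[of _ 1]) auto
next
  show "(\<lambda>x. \<Prod>j<N. 1 - x * q ^ j) holomorphic_on UNIV" for N
    by (intro holomorphic_intros)
qed simp

lemma holomorphic_on_qpoch [holomorphic_intros]: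
  assumes "norm q < 1" "f holomorphic_on S"
  shows "(\<lambda>z. qpoch q (f z)) holomorphic_on S"
  using holomorphic_on_compose_gen[OF assms(2) qpoch_holomorphic[OF assms(1)]]
  by (simp add: o_def)

text \<open>As \<open>qpoch q x\<close> is (x; q)_\<infinity>, this is the multiplicative theta
  function: times \<open>qpoch q q\<close> it equals \<Sum> (-1)^k q^(k(k-1)/2) x^k by the Jacobi
  triple product.\<close>

definition qtheta :: "complex \<Rightarrow> complex \<Rightarrow> complex" where
  "qtheta q x = qpoch q x * qpoch q (q / x)"

lemma qtheta_shift:
  assumes "norm q < 1" "q \<noteq> 0" "x \<noteq> 0"
  shows "x * qtheta q (q * x) = - qtheta q x"
proof -
  have "q / (q * x) = 1 / x" "q * (1 / x) = q / x"
    using assms by simp_all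
  then have "x * qtheta q (q * x) = qpoch q (q * x) * (x * (1 - 1 / x)) * qpoch q (q / x)"
    using qpoch_shift[OF assms(1), of "1 / x"] by (simp only: qtheta_def mult_ac)
  also have "x * (1 - 1 / x) = - (1 - x)"
    using assms(3) by (simp add: right_diff_distrib)
  finally show ?thesis
    unfolding qtheta_def qpoch_shift[OF assms(1), of x] by (simp only: mult_ac mult_minus_left mult_minus_right)
qed

lemma qtheta_eq_0_iff:
  assumes "norm q < 1" "q \<noteq> 0" "x \<noteq> 0"
  shows "qtheta q x = 0 \<longleftrightarrow> (\<exists>k::int. x = q powi k)"
proof
  assume "qtheta q x = 0"
  then consider j where "x * q ^ j = 1" | j where "q / x * q ^ j = 1"
    using qpoch_eq_0_iff[OF assms(1)] unfolding qtheta_def by auto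
  then show "\<exists>k::int. x = q powi k"
  proof cases
    case 1
    then have "x = q powi (- int j)"
      using assms by (auto simp: power_int_minus field_simps)
    then show ?thesis ..
  next
    case 2
    then have "x = q powi (int (Suc j))"
      using assms by (simp add: power_int_def field_simps nat_add_distrib)
    then show ?thesis ..
  qed
next
  assume "\<exists>k::int. x = q powi k"
  then obtain k :: int where k: "x = q powi k" ..
  show "qtheta q x = 0"
  proof (cases "k \<le> 0")
    case True
    then have "x * q ^ nat (- k) = 1"
      using assms k by (simp add: power_int_def field_simps)
    then show ?thesis
      using qpoch_eq_0_iff[OF assms(1)] by (auto simp: qtheta_def)
  next
    case False
    then have "q / x * q ^ (nat k - 1) = 1"
      using assms k by (simp add: power_int_def field_simps flip: power_Suc)
    then show ?thesis
      using qpoch_eq_0_iff[OF assms(1)] by (auto simp: qtheta_def)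
  qed
qed

text \<open>The theta quotient of Kronecker and Eisenstein, symmetric in \<open>\<zeta>\<close> and
  \<open>t\<close>.\<close>

definition kron :: "complex \<Rightarrow> complex \<Rightarrow> complex \<Rightarrow> complex" where
  "kron q \<zeta> t = (qpoch q q)\<^sup>2 * qtheta q (\<zeta> * t) / (qtheta q \<zeta> * qtheta q t)"

lemma kron_shift:
  assumes "norm q < 1" "q \<noteq> 0" "t \<noteq> 0" "\<zeta> \<noteq> 0"
  shows "\<zeta> * kron q \<zeta> (q * t) = kron q \<zeta> t"
proof -
  have "\<zeta> * t * qtheta q (\<zeta> * (q * t)) = - qtheta q (\<zeta> * t)"
    using qtheta_shift[OF assms(1,2), of "\<zeta> * t"] assms by (simp add: mult_ac)
  moreover have "t * qtheta q (q * t) = - qtheta q t"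
    using qtheta_shift[OF assms(1-3)] .
  moreover have "\<zeta> * kron q \<zeta> (q * t) =
      (qpoch q q)\<^sup>2 * (\<zeta> * t * qtheta q (\<zeta> * (q * t))) / (qtheta q \<zeta> * (t * qtheta q (q * t)))"
    using assms by (simp add: kron_def)
  ultimately show ?thesis
    by (simp add: kron_def)
qed

section \<open>Power series converging beyond the unit circle, and two-sided sums\<close>

lemma Bseq_summable_geometric:
  fixes c :: "nat \<Rightarrow> complex"
  assumes "Bseq c" "norm (q * t) < 1"
  shows "summable (\<lambda>n. norm (q ^ n * c n * t ^ n))"
proof -
  obtain K where K: "\<And>n. norm (c n) \<le> K"
    using assms(1) by (auto simp: Bseq_def)
  show ?thesis
  proof (rule summable_comparison_test)
    show "\<exists>N. \<forall>n\<ge>N. norm (norm (q ^ n * c n * t ^ n)) \<le> K * norm (q * t) ^ n"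
    proof (intro exI[of _ 0] allI impI)
      fix n
      have "norm (norm (q ^ n * c n * t ^ n)) = norm (c n) * norm (q * t) ^ n"
        by (simp add: norm_mult norm_power power_mult_distrib)
      also have "\<dots> \<le> K * norm (q * t) ^ n"
        by (intro mult_right_mono K) auto
      finally show "norm (norm (q ^ n * c n * t ^ n)) \<le> K * norm (q * t) ^ n" .
    qed
    show "summable (\<lambda>n. K * norm (q * t) ^ n)"
      using assms(2) by (intro summable_mult summable_geometric) simp
  qed
qed

lemma geometric_power_series_holomorphic:
  fixes c :: "nat \<Rightarrow> complex"
  assumes "Bseq c" "q \<noteq> 0"
  shows "(\<lambda>t. \<Sum>n. q ^ n * c n * t ^ n) holomorphic_on {t. norm (q * t) < 1}"
proof -
  have "{t. norm (q * t) < 1} = ball 0 (1 / norm q)"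
    using assms(2) by (auto simp: norm_mult field_simps)
  moreover have "(\<lambda>t. \<Sum>n. q ^ n * c n * t ^ n) holomorphic_on ball 0 (1 / norm q)"
  proof (rule power_series_holomorphic)
    fix t :: complex assume "t \<in> ball 0 (1 / norm q)"
    then have "norm (q * t) < 1"
      using assms(2) by (simp add: norm_mult field_simps)
    from summable_norm_cancel[OF Bseq_summable_geometric[OF assms(1) this]]
    show "(\<lambda>n. q ^ n * c n * (t - 0) ^ n) sums (\<Sum>n. q ^ n * c n * t ^ n)"
      by (simp add: summable_sums)
  qed
  ultimately show ?thesis
    by simp
qed

text \<open>Both one-sided series contain the index 0, hence the correction by
  \<open>f 0\<close>.\<close>

lemma has_sum_int_split:
  fixes f :: "int \<Rightarrow> 'a :: banach"
  assumes "(\<lambda>n. f (int n)) sums A" "summable (\<lambda>n. norm (f (int n)))"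
    and "(\<lambda>n. f (- int n)) sums B" "summable (\<lambda>n. norm (f (- int n)))"
  shows "(f has_sum (A + (B - f 0))) UNIV"
proof -
  have "((\<lambda>n. f (int n)) has_sum A) UNIV"
    by (rule norm_summable_imp_has_sum[OF assms(2,1)])
  moreover have "bij_betw int UNIV {0..}"
    by (rule bij_betwI[where g = nat]) auto
  ultimately have 1: "(f has_sum A) {0..}"
    by (simp add: has_sum_reindex_bij_betw)
  have "(\<lambda>n. f (- int (Suc n))) sums (B - f 0)"
    using assms(3) by (subst sums_Suc_iff) auto
  moreover have "summable (\<lambda>n. norm (f (- int (Suc n))))"
    using assms(4) by (subst summable_Suc_iff)
  ultimately have "((\<lambda>n. f (- int (Suc n))) has_sum (B - f 0)) UNIV"
    by (intro norm_summable_imp_has_sum)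
  moreover have "bij_betw (\<lambda>n. - int (Suc n)) UNIV {..<0}"
    by (rule bij_betwI[where g = "\<lambda>k. nat (- k) - 1"]) auto
  ultimately have 2: "(f has_sum (B - f 0)) {..<0}"
    using has_sum_reindex_bij_betw[of "\<lambda>n. - int (Suc n)" UNIV "{..<0}" f "B - f 0"] by blast
  have "(f has_sum (A + (B - f 0))) ({0..} \<union> {..<0})"
    by (rule has_sum_Un_disjoint[OF 1 2]) auto
  moreover have "{0..} \<union> {..<0} = (UNIV :: int set)"
    by auto
  ultimately show ?thesis
    by simp
qed

section \<open>The exponential \<open>e2pi\<close> and the periods of \<open>phi_st\<close>\<close>

lemma e2pi_add: "e2pi (x + y) = e2pi x * e2pi y"
  by (simp add: e2pi_def ring_distribs exp_add)

lemma e2pi_0 [simp]: "e2pi 0 = 1"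
  by (simp add: e2pi_def)

lemma e2pi_nonzero [simp]: "e2pi x \<noteq> 0"
  by (simp add: e2pi_def)

lemma e2pi_minus: "e2pi (- x) = inverse (e2pi x)"
  by (simp add: e2pi_def exp_minus)

lemma e2pi_diff: "e2pi (x - y) = e2pi x / e2pi y"
  by (simp add: e2pi_def ring_distribs exp_diff)

lemma e2pi_sum: "e2pi (sum f A) = (\<Prod>x\<in>A. e2pi (f x))"
  by (induction A rule: infinite_finite_induct) (auto simp: e2pi_add)

lemma e2pi_of_nat_mult: "e2pi (of_nat n * x) = e2pi x ^ n"
  by (induction n) (auto simp: ring_distribs e2pi_add)

lemma e2pi_of_int_mult: "e2pi (of_int k * x) = e2pi x powi k"
proof (cases "k \<ge> 0")
  case True
  then show ?thesis
    using e2pi_of_nat_mult[of "nat k" x] by (simp add: power_int_def)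
next
  case False
  then show ?thesis
    using e2pi_of_nat_mult[of "nat (- k)" x] e2pi_minus[of "of_int k * x"]
    by (simp add: power_int_def field_simps)
qed

lemma norm_e2pi: "norm (e2pi z) = exp (- 2 * pi * Im z)"
  by (simp add: e2pi_def norm_exp_eq_Re)

lemma e2pi_eq_1_iff: "e2pi z = 1 \<longleftrightarrow> (\<exists>k::int. z = of_int k)"
proof
  assume "e2pi z = 1"
  then obtain n :: int where "Re (2 * of_real pi * \<i> * z) = 0" "Im (2 * of_real pi * \<i> * z) = of_int (2 * n) * pi"
    unfolding e2pi_def exp_eq_1 by blast
  then have "z = of_int n"
    by (simp add: complex_eq_iff)
  then show "\<exists>k::int. z = of_int k" ..
next
  assume "\<exists>k::int. z = of_int k"
  then show "e2pi z = 1"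
    by (auto simp: e2pi_def exp_eq_1 intro: exI)
qed

lemma e2pi_of_int [simp]: "e2pi (of_int k) = 1"
  by (auto simp: e2pi_eq_1_iff)

lemma e2pi_Ints [simp]: "x \<in> \<int> \<Longrightarrow> e2pi x = 1"
  by (auto elim: Ints_cases)

lemma e2pi_holomorphic [holomorphic_intros]:
  "f holomorphic_on S \<Longrightarrow> (\<lambda>z. e2pi (f z)) holomorphic_on S"
  unfolding e2pi_def by (intro holomorphic_intros)

text \<open>The factor in front of the infinite product supplies the missing index-0 factors of the
  q-Pochhammer symbols at \<open>\<zeta> * t\<close>, \<open>\<zeta>\<close> and \<open>t\<close>.
  No pole has to be excluded, since division by 0 makes both sides 0 there; the quasi-periodicity
  lemmas inherit this.\<close>

lemma phi_st_eq_kron: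
  assumes "Im \<tau> > 0"
  shows "phi_st z \<tau> \<sigma> = kron (e2pi \<tau>) (e2pi \<sigma>) (e2pi z)"
proof -
  define q \<zeta> t where "q = e2pi \<tau>" and "\<zeta> = e2pi \<sigma>" and "t = e2pi z"
  have q: "norm q < 1" "q \<noteq> 0" and nz: "\<zeta> \<noteq> 0" "t \<noteq> 0"
    using assms by (auto simp: q_def \<zeta>_def t_def norm_e2pi)
  have hp: "(\<lambda>j. 1 - x * q ^ j) has_prod qpoch q x" for x
    unfolding qpoch_def using qpoch_convergent[OF q(1)] by (rule convergent_prod_has_prod)
  let ?N = "\<lambda>j. (1 - q * q ^ j)\<^sup>2 * (1 - q * (\<zeta> * t) * q ^ j) * (1 - q / (\<zeta> * t) * q ^ j)"
  let ?D = "\<lambda>j. (1 - q * \<zeta> * q ^ j) * (1 - q / \<zeta> * q ^ j) * (1 - q * t * q ^ j) * (1 - q / t * q ^ j)"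
  have "(\<lambda>j. ?N j / ?D j) has_prod
      ((qpoch q q)\<^sup>2 * qpoch q (q * (\<zeta> * t)) * qpoch q (q / (\<zeta> * t)) /
       (qpoch q (q * \<zeta>) * qpoch q (q / \<zeta>) * qpoch q (q * t) * qpoch q (q / t)))"
    by (intro has_prod_divide has_prod_mult has_prod_power hp)
  moreover have "(\<lambda>j. ((1 - q ^ Suc j)\<^sup>2 * (1 - \<zeta> * t * q ^ Suc j) * (1 - inverse \<zeta> * inverse t * q ^ Suc j)) /
      ((1 - \<zeta> * q ^ Suc j) * (1 - inverse \<zeta> * q ^ Suc j) * (1 - t * q ^ Suc j) * (1 - inverse t * q ^ Suc j)))
      = (\<lambda>j. ?N j / ?D j)"
    by (intro ext) (simp add: divide_inverse mult_ac)
  ultimately have "phi_st z \<tau> \<sigma> = (1 - \<zeta> * t) / ((1 - \<zeta>) * (1 - t)) *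
      ((qpoch q q)\<^sup>2 * qpoch q (q * (\<zeta> * t)) * qpoch q (q / (\<zeta> * t)) /
       (qpoch q (q * \<zeta>) * qpoch q (q / \<zeta>) * qpoch q (q * t) * qpoch q (q / t)))"
    unfolding phi_st_def Let_def q_def[symmetric] \<zeta>_def[symmetric] t_def[symmetric]
    by (simp only: has_prod_iff)
  also have "\<dots> = kron q \<zeta> t"
    unfolding kron_def qtheta_def qpoch_shift[OF q(1), of "\<zeta> * t"]
      qpoch_shift[OF q(1), of \<zeta>] qpoch_shift[OF q(1), of t]
    by (simp only: times_divide_times_eq mult_ac)
  finally show ?thesis
    by (simp add: q_def \<zeta>_def t_def)
qed

lemma phi_st_plus_int:
  "Im \<tau> > 0 \<Longrightarrow> phi_st (z + of_int k) \<tau> \<sigma> = phi_st z \<tau> \<sigma>"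
  by (simp add: phi_st_eq_kron e2pi_add)

lemma phi_st_plus_tau:
  assumes "Im \<tau> > 0"
  shows "e2pi \<sigma> * phi_st (z + \<tau>) \<tau> \<sigma> = phi_st z \<tau> \<sigma>"
  using kron_shift[of "e2pi \<tau>" "e2pi z" "e2pi \<sigma>"] assms
  by (simp add: phi_st_eq_kron e2pi_add norm_e2pi mult.commute)

text \<open>The factor lost under translation by multiples of \<open>\<tau>\<close> is the one
  gained by the exponential in front of \<open>phi_st\<close> in the genus. The summands therefore
  depend on the class of the first representative only.\<close>

lemma phi_st_plus_tau_int:
  assumes "Im \<tau> > 0"
  shows "e2pi (of_int k * \<sigma>) * phi_st (z + of_int k * \<tau>) \<tau> \<sigma> = phi_st z \<tau> \<sigma>"
proof (induction k rule: int_induct[where k = 0])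
  case (step1 k)
  have "e2pi (of_int (k + 1) * \<sigma>) * phi_st (z + of_int (k + 1) * \<tau>) \<tau> \<sigma> =
      e2pi (of_int k * \<sigma>) * (e2pi \<sigma> * phi_st ((z + of_int k * \<tau>) + \<tau>) \<tau> \<sigma>)"
    by (simp add: ring_distribs e2pi_add add_ac)
  then show ?case
    unfolding phi_st_plus_tau[OF assms] using step1 by simp
next
  case (step2 k)
  have "e2pi (of_int k * \<sigma>) * phi_st (z + of_int k * \<tau>) \<tau> \<sigma> =
      e2pi (of_int (k - 1) * \<sigma>) * (e2pi \<sigma> * phi_st ((z + of_int (k - 1) * \<tau>) + \<tau>) \<tau> \<sigma>)"
    by (simp add: ring_distribs e2pi_diff add_ac)
  then show ?case
    unfolding phi_st_plus_tau[OF assms] using step2 by simp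
qed simp

lemma e2pi_eq_powi_iff:
  "(\<exists>k::int. e2pi z = e2pi \<tau> powi k) \<longleftrightarrow> z \<in> period_lattice \<tau>"
proof -
  have "e2pi z = e2pi \<tau> powi k \<longleftrightarrow> (\<exists>l::int. z = of_int l + of_int k * \<tau>)" for k
    using e2pi_eq_1_iff[of "z - of_int k * \<tau>"]
    by (simp add: e2pi_diff e2pi_of_int_mult diff_eq_eq)
  then show ?thesis
    by (auto simp: period_lattice_def)
qed

lemma isCont_phi_st:
  assumes "Im \<tau> > 0" "\<sigma> \<notin> period_lattice \<tau>" "z \<notin> period_lattice \<tau>"
  shows "isCont (\<lambda>z. phi_st z \<tau> \<sigma>) z"
proof -
  have q: "norm (e2pi \<tau>) < 1" "e2pi \<tau> \<noteq> 0"
    using assms by (auto simp: norm_e2pi)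
  have cont: "isCont (qpoch (e2pi \<tau>)) y" for y
    using qpoch_holomorphic[OF q(1)]
    by (metis UNIV_I continuous_on_eq_continuous_at holomorphic_on_imp_continuous_on open_UNIV)
  have e: "isCont e2pi y" for y
    unfolding e2pi_def by (intro continuous_intros)
  have "qtheta (e2pi \<tau>) (e2pi \<sigma>) \<noteq> 0" "qtheta (e2pi \<tau>) (e2pi z) \<noteq> 0"
    using assms(2,3) by (simp_all add: qtheta_eq_0_iff[OF q] e2pi_eq_powi_iff)
  then show ?thesis
    unfolding phi_st_eq_kron[OF assms(1)] kron_def qtheta_def
    by (intro continuous_intros isCont_o2[OF _ cont] e) auto
qed

section \<open>Kronecker's identity\<close>

locale kronecker =
  fixes \<tau> \<sigma> :: complex
  assumes tau: "Im \<tau> > 0" and sigma: "\<sigma> \<notin> period_lattice \<tau>"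
begin

definition q where "q = e2pi \<tau>"
definition \<zeta> where "\<zeta> = e2pi \<sigma>"

lemma q_less_1: "norm q < 1" and q_nz: "q \<noteq> 0" and zeta_nz: "\<zeta> \<noteq> 0"
  using tau by (auto simp: q_def \<zeta>_def norm_e2pi)

lemma zeta_neq: "\<zeta> \<noteq> q powi k"
  using sigma e2pi_eq_powi_iff[of \<sigma> \<tau>] by (auto simp: q_def \<zeta>_def)

lemma zeta_neq_power: "\<zeta> \<noteq> q ^ n"
  using zeta_neq[of "int n"] by simp

lemma zeta_power_neq: "\<zeta> * q ^ n \<noteq> 1"
  using zeta_neq[of "- int n"] q_nz by (auto simp: power_int_minus field_simps)

text \<open>The coefficients of the Kronecker series are 1 / (1 - \<zeta> q^n) = 1 + q^n a_n for n
  \<ge> 0 and 1 / (1 - \<zeta> q^(-n)) = - q^n b_n for n > 0. After removal of the geometric series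
  both halves carry a factor q^n, so \<open>F t\<close> and \<open>H (1 / t)\<close> converge for
  norm q < norm t < 1 / norm q. The value \<open>b 0 = 0\<close> leaves the index 0 to the first
  half.\<close>

definition a where "a n = \<zeta> / (1 - \<zeta> * q ^ n)"
definition b where "b n = (if n = 0 then 0 else 1 / (\<zeta> - q ^ n))"
definition F where "F t = (\<Sum>n. q ^ n * a n * t ^ n)"
definition H where "H s = (\<Sum>n. q ^ n * b n * s ^ n)"

lemma Bseq_a: "Bseq a"
proof -
  have "(\<lambda>n. \<zeta> / (1 - \<zeta> * q ^ n)) \<longlonglongrightarrow> \<zeta> / (1 - \<zeta> * 0)"
    using q_less_1 by (intro tendsto_intros LIMSEQ_power_zero) auto
  then show ?thesis
    unfolding a_def by (intro convergent_imp_Bseq convergentI)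
qed

lemma Bseq_b: "Bseq b"
proof -
  have "(\<lambda>n. 1 / (\<zeta> - q ^ Suc n)) \<longlonglongrightarrow> 1 / (\<zeta> - 0)"
    using q_less_1 zeta_nz by (intro tendsto_intros LIMSEQ_Suc LIMSEQ_power_zero) auto
  then have "(\<lambda>n. b (Suc n)) \<longlonglongrightarrow> 1 / \<zeta>"
    by (simp add: b_def)
  then show ?thesis
    by (metis LIMSEQ_imp_Suc convergentI convergent_imp_Bseq)
qed

lemma F_summable: "norm (q * t) < 1 \<Longrightarrow> summable (\<lambda>n. norm (q ^ n * a n * t ^ n))"
  by (rule Bseq_summable_geometric[OF Bseq_a])

lemma H_summable: "norm (q * t) < 1 \<Longrightarrow> summable (\<lambda>n. norm (q ^ n * b n * t ^ n))"
  by (rule Bseq_summable_geometric[OF Bseq_b])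

lemma F_sums: "norm (q * t) < 1 \<Longrightarrow> (\<lambda>n. q ^ n * a n * t ^ n) sums F t"
  unfolding F_def by (rule summable_sums[OF summable_norm_cancel[OF F_summable]])

lemma H_sums: "norm (q * t) < 1 \<Longrightarrow> (\<lambda>n. q ^ n * b n * t ^ n) sums H t"
  unfolding H_def by (rule summable_sums[OF summable_norm_cancel[OF H_summable]])

lemma norm_q_mult_less:
  assumes "norm t < 1"
  shows "norm (q * t) < 1"
proof -
  have "norm q * norm t \<le> 1 * norm t"
    using q_less_1 by (intro mult_right_mono) auto
  then show ?thesis
    using assms by (simp add: norm_mult)
qed

text \<open>The recurrence \<open>a n = \<zeta> + \<zeta> * q ^ n * a n\<close>, summed up; its
  constant term produces the geometric series.\<close>

lemma F_shift:
  assumes "norm (q * t) < 1"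
  shows "\<zeta> * F (q * t) = F t - \<zeta> / (1 - q * t)"
proof -
  have "(\<lambda>n. \<zeta> * (q * t) ^ n + \<zeta> * (q ^ n * a n * (q * t) ^ n)) sums
      (\<zeta> * (1 / (1 - q * t)) + \<zeta> * F (q * t))"
    by (intro sums_add sums_mult geometric_sums F_sums norm_q_mult_less[OF assms] assms)
  moreover have "\<zeta> * (q * t) ^ n + \<zeta> * (q ^ n * a n * (q * t) ^ n) = q ^ n * a n * t ^ n" for n
  proof -
    have "\<zeta> + \<zeta> * q ^ n * a n = a n"
      using zeta_power_neq[of n] by (simp add: a_def field_simps)
    then have "(\<zeta> + \<zeta> * q ^ n * a n) * (q * t) ^ n = a n * (q * t) ^ n"
      by simp
    then show ?thesis
      by (simp add: power_mult_distrib ring_distribs mult_ac)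
  qed
  ultimately have "(\<lambda>n. q ^ n * a n * t ^ n) sums (\<zeta> * (1 / (1 - q * t)) + \<zeta> * F (q * t))"
    by simp
  then show ?thesis
    using F_sums[OF assms] sums_unique2 by (fastforce simp: algebra_simps)
qed

lemma H_shift:
  assumes "norm (q * s) < 1"
  shows "\<zeta> * H s = q * s / (1 - q * s) + H (q * s)"
proof -
  have "(\<lambda>n. (q * s) ^ n + q ^ n * b n * (q * s) ^ n) sums (1 / (1 - q * s) + H (q * s))"
    by (intro sums_add geometric_sums H_sums norm_q_mult_less[OF assms] assms)
  then have "(\<lambda>n. (q * s) ^ n + q ^ n * b n * (q * s) ^ n - (if n = 0 then 1 else 0)) sums
      (1 / (1 - q * s) + H (q * s) - 1)"
    by (intro sums_diff) (use sums_single[of 0 "\<lambda>_. 1 :: complex"] in simp_all)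
  moreover have "(q * s) ^ n + q ^ n * b n * (q * s) ^ n - (if n = 0 then 1 else 0) =
      \<zeta> * (q ^ n * b n * s ^ n)" for n
  proof (cases "n = 0")
    case False
    then have "1 + q ^ n * b n = \<zeta> * b n"
      using zeta_neq_power[of n] by (simp add: b_def field_simps)
    then have "(1 + q ^ n * b n) * (q * s) ^ n = \<zeta> * b n * (q * s) ^ n"
      by simp
    then show ?thesis
      using False by (simp add: power_mult_distrib ring_distribs mult_ac)
  qed (simp add: b_def)
  ultimately have "(\<lambda>n. \<zeta> * (q ^ n * b n * s ^ n)) sums (1 / (1 - q * s) + H (q * s) - 1)"
    by simp
  then have "\<zeta> * H s = 1 / (1 - q * s) + H (q * s) - 1"
    using sums_mult[OF H_sums[OF assms], of \<zeta>] sums_unique2 by blast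
  moreover have "q * s \<noteq> 1"
    using assms by auto
  then have "1 / (1 - q * s) - 1 = q * s / (1 - q * s)"
    by (simp add: field_simps)
  ultimately show ?thesis
    by simp
qed

text \<open>The continuation of the Kronecker series from norm q < norm t < 1 to the annulus
  \<open>Ann\<close>, with the geometric series summed to its pole term at
  \<open>t = 1\<close>.\<close>

definition A where "A t = 1 / (1 - t) + F t - H (1 / t)"

text \<open>The hypotheses keep both \<open>t\<close> and \<open>q * t\<close> in
  \<open>Ann\<close>. The correction from \<open>F_shift\<close> cancels the pole term at
  \<open>q * t\<close>, and the one from \<open>H_shift\<close> recreates the pole term at
  \<open>t\<close>.\<close>

lemma A_shift:
  assumes "norm t > 1" "norm (q * t) < 1"
  shows "\<zeta> * A (q * t) = A t"
proof -
  have t: "t \<noteq> 0" "t \<noteq> 1"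
    using assms by auto
  then have "q * (1 / (q * t)) = 1 / t"
    using q_nz by simp
  moreover have "norm (1 / t) < 1"
    using assms by (simp add: norm_divide divide_less_eq)
  ultimately have "\<zeta> * H (1 / (q * t)) = 1 / t / (1 - 1 / t) + H (1 / t)"
    using H_shift[of "1 / (q * t)"] by simp
  moreover have "1 / t / (1 - 1 / t) = - (1 / (1 - t))"
    using t by (simp add: field_simps)
  ultimately show ?thesis
    using F_shift[OF assms(2)] by (simp add: A_def ring_distribs)
qed

text \<open>\<open>kron q \<zeta> t\<close> with its pole at \<open>t = 1\<close> cleared. The value
  \<open>R 1 = 1\<close> matches the coefficient of 1 / (1 - t) in \<open>A\<close>, so the pole
  drops out of the difference.\<close>

definition R where
  "R t = (qpoch q q)\<^sup>2 * qtheta q (\<zeta> * t) / (qtheta q \<zeta> * (qpoch q (q * t) * qpoch q (q / t)))"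

definition Ann where "Ann = {t. norm (q * t) < 1 \<and> norm (q / t) < 1 \<and> t \<noteq> 0}"

lemma open_Ann: "open Ann"
proof -
  have "Ann = ball 0 (1 / norm q) - cball 0 (norm q)"
    using q_nz by (auto simp: Ann_def norm_mult norm_divide divide_less_eq less_divide_eq mult.commute)
  then show ?thesis
    by auto
qed

lemma R_kron: "R t / (1 - t) = kron q \<zeta> t"
  unfolding R_def kron_def qtheta_def qpoch_shift[OF q_less_1, of t]
  by (simp only: divide_divide_eq_left mult_ac)

lemma qtheta_zeta_nz: "qtheta q \<zeta> \<noteq> 0"
  using qtheta_eq_0_iff[OF q_less_1 q_nz zeta_nz] zeta_neq by blast

lemma R_1: "R 1 = 1"
  using qtheta_zeta_nz qpoch_nonzero[OF q_less_1 q_less_1] by (simp add: R_def power2_eq_square)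

lemma R_holomorphic: "R holomorphic_on Ann"
  unfolding R_def qtheta_def
proof (intro holomorphic_intros q_less_1)
  fix t assume "t \<in> Ann"
  then show "t \<noteq> 0" "\<zeta> * t \<noteq> 0"
    "qpoch q \<zeta> * qpoch q (q / \<zeta>) * (qpoch q (q * t) * qpoch q (q / t)) \<noteq> 0"
    using zeta_nz qtheta_zeta_nz qpoch_nonzero[OF q_less_1]
    by (auto simp: Ann_def qtheta_def)
qed

definition D where
  "D t = (if t = 1 then deriv R 1 else (R t - R 1) / (t - 1)) + F t - H (1 / t)"

lemma D_eq:
  assumes "t \<noteq> 1"
  shows "D t = A t - kron q \<zeta> t"
proof -
  have "(R t - R 1) / (t - 1) = 1 / (1 - t) - R t / (1 - t)"
    using assms by (simp add: R_1 divide_simps) (simp add: algebra_simps)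
  then show ?thesis
    using assms by (simp add: D_def A_def R_kron)
qed

lemma D_holomorphic: "D holomorphic_on Ann"
proof -
  have 1: "(\<lambda>t. if t = 1 then deriv R 1 else (R t - R 1) / (t - 1)) holomorphic_on Ann"
    by (rule pole_lemma_open[OF R_holomorphic open_Ann])
  have 2: "F holomorphic_on Ann"
    unfolding F_def
    by (rule holomorphic_on_subset[OF geometric_power_series_holomorphic[OF Bseq_a q_nz]])
       (auto simp: Ann_def)
  have "(H \<circ> (\<lambda>t. 1 / t)) holomorphic_on Ann"
  proof (rule holomorphic_on_compose_gen)
    show "(\<lambda>t. 1 / t) holomorphic_on Ann"
      by (intro holomorphic_intros) (auto simp: Ann_def)
    show "H holomorphic_on {s. norm (q * s) < 1}"
      unfolding H_def by (rule geometric_power_series_holomorphic[OF Bseq_b q_nz])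
  qed (auto simp: Ann_def)
  then have 3: "(\<lambda>t. H (1 / t)) holomorphic_on Ann"
    by (simp add: o_def)
  show ?thesis
    unfolding D_def by (intro holomorphic_on_diff holomorphic_on_add 1 2 3)
qed

lemma D_shift:
  assumes "norm t > 1" "norm (q * t) < 1"
  shows "\<zeta> * D (q * t) = D t"
proof -
  have "t \<noteq> 0" "t \<noteq> 1" "q * t \<noteq> 1"
    using assms by auto
  then show ?thesis
    using A_shift[OF assms] kron_shift[OF q_less_1 q_nz _ zeta_nz, of t]
    by (simp add: D_eq ring_distribs)
qed

text \<open>
  \<open>D\<close> is the difference of the two sides of Kronecker's identity, with the singularity at \<open>t = 1\<close>
  removed. The exponent \<open>c\<close> is chosen so that \<open>|h|\<close> is invariant under translation by \<open>1\<close> and \<open>\<tau>\<close>; the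
  maximum modulus principle then makes \<open>h\<close> constant, and a non-zero constant would force
  \<open>\<zeta> = q\<^sup>k\<close> for an integer \<open>k\<close>.
\<close>

definition c where "c = Im \<sigma> / Im \<tau>"
definition h where "h z = D (e2pi z) * e2pi (of_real c * z)"
definition strip where "strip = {z. - Im \<tau> < Im z \<and> Im z < Im \<tau>}"

lemma e2pi_in_Ann: "z \<in> strip \<Longrightarrow> e2pi z \<in> Ann"
  by (auto simp: Ann_def strip_def q_def norm_e2pi simp flip: e2pi_add e2pi_diff)

lemma h_holomorphic: "h holomorphic_on strip"
proof -
  have "(D \<circ> e2pi) holomorphic_on strip"
    by (rule holomorphic_on_compose_gen[OF _ D_holomorphic])
       (use e2pi_in_Ann in \<open>auto intro!: holomorphic_intros\<close>)
  then show ?thesis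
    unfolding h_def o_def by (intro holomorphic_intros)
qed

lemma h_shift_int: "norm (h (z + of_int k)) = norm (h z)"
  by (simp add: h_def e2pi_add norm_mult norm_e2pi ring_distribs)

text \<open>The condition \<open>Im z < 0\<close> keeps \<open>z + \<tau>\<close> inside the
  strip.\<close>

lemma h_shift_tau:
  assumes "z \<in> strip" "Im z < 0"
  shows "\<zeta> * h (z + \<tau>) = e2pi (of_real c * \<tau>) * h z"
proof -
  have "norm (e2pi z) > 1" "norm (q * e2pi z) < 1"
    using assms by (auto simp: strip_def q_def norm_e2pi mult_less_0_iff simp flip: e2pi_add)
  from D_shift[OF this] show ?thesis
    by (simp add: h_def e2pi_add ring_distribs q_def mult_ac)
qed

lemma norm_h_shift_tau:
  assumes "z \<in> strip" "Im z < 0"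
  shows "norm (h (z + \<tau>)) = norm (h z)"
proof -
  have "norm \<zeta> = norm (e2pi (of_real c * \<tau>))"
    using tau by (simp add: \<zeta>_def norm_e2pi c_def)
  moreover have "norm \<zeta> * norm (h (z + \<tau>)) = norm (e2pi (of_real c * \<tau>)) * norm (h z)"
    using h_shift_tau[OF assms] by (metis norm_mult)
  ultimately show ?thesis
    using zeta_nz by simp
qed

text \<open>The strip is not compact, but translations carry each of its points into a closed period
  rectangle contained in it, without changing the norm of \<open>h\<close>. The maximum over the
  rectangle is thus a maximum over the open strip.\<close>

lemma h_bound:
  obtains \<xi> where "\<xi> \<in> strip" "\<And>z. z \<in> strip \<Longrightarrow> norm (h z) \<le> norm (h \<xi>)"
proof -
  define K where "K = cbox (Complex 0 (- Im \<tau> / 2)) (Complex 1 (Im \<tau> / 2))"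
  have K: "K \<subseteq> strip" "K \<noteq> {}"
    using tau by (auto simp: K_def strip_def in_cbox_complex_iff box_ne_empty Basis_complex_def)
  have "continuous_on K (\<lambda>z. norm (h z))"
    using holomorphic_on_imp_continuous_on[OF holomorphic_on_subset[OF h_holomorphic K(1)]]
    by (intro continuous_intros)
  moreover have "compact K"
    by (simp add: K_def)
  ultimately obtain \<xi> where \<xi>: "\<xi> \<in> K" "\<And>z. z \<in> K \<Longrightarrow> norm (h z) \<le> norm (h \<xi>)"
    using continuous_attains_sup[of K "\<lambda>z. norm (h z)"] K(2) by blast
  have "norm (h z) \<le> norm (h \<xi>)" if z: "z \<in> strip" for z
  proof -
    obtain z' where z': "norm (h z') = norm (h z)" "\<bar>Im z'\<bar> \<le> Im \<tau> / 2"
    proof -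
      consider "\<bar>Im z\<bar> \<le> Im \<tau> / 2" | "Im z < - (Im \<tau> / 2)" | "Im z > Im \<tau> / 2"
        by linarith
      then show ?thesis
      proof cases
        case 1
        then show ?thesis
          using that by blast
      next
        case 2
        then show ?thesis
          using that[of "z + \<tau>"] norm_h_shift_tau[OF z] z tau by (auto simp: strip_def abs_le_iff)
      next
        case 3
        have "norm (h (z - \<tau> + \<tau>)) = norm (h (z - \<tau>))"
          by (rule norm_h_shift_tau) (use 3 z tau in \<open>auto simp: strip_def\<close>)
        then show ?thesis
          using that[of "z - \<tau>"] 3 z tau by (auto simp: strip_def abs_le_iff)
      qed
    qed
    define z'' where "z'' = z' + of_int (- \<lfloor>Re z'\<rfloor>)"
    have "z'' \<in> K"
      using z'(2) by (simp add: z''_def K_def in_cbox_complex_iff abs_le_iff) linarith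
    then show ?thesis
      using \<xi>(2)[of z''] z'(1) h_shift_int[of z' "- \<lfloor>Re z'\<rfloor>"] by (simp add: z''_def)
  qed
  then show ?thesis
    using that \<xi>(1) K(1) by blast
qed

lemma D_eq_0:
  assumes "z \<in> strip"
  shows "D (e2pi z) = 0"
proof -
  have strip: "open strip" "connected strip"
  proof -
    have *: "strip = {z. Im z > - Im \<tau>} \<inter> {z. Im z < Im \<tau>}"
      by (auto simp: strip_def)
    show "open strip"
      unfolding * by (intro open_Int open_halfspace_Im_gt open_halfspace_Im_lt)
    show "connected strip"
      unfolding * by (intro convex_connected convex_Int convex_halfspace_Im_gt convex_halfspace_Im_lt)
  qed
  obtain \<xi> where "\<xi> \<in> strip" "\<And>z. z \<in> strip \<Longrightarrow> norm (h z) \<le> norm (h \<xi>)"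
    using h_bound by blast
  then have "h constant_on strip"
    using maximum_modulus_principle[OF h_holomorphic strip strip(1) order_refl] by blast
  then obtain C where C: "\<And>z. z \<in> strip \<Longrightarrow> h z = C"
    by (auto simp: constant_on_def)
  have "C = 0"
  proof (rule ccontr)
    assume "C \<noteq> 0"
    \<comment> \<open>\<open>e2pi\<close> agrees at 0 and 1, so a non-zero constant forces
      \<open>c\<close> to be an integer; comparison of \<open>z\<close> with
      \<open>z + \<tau>\<close> then gives \<zeta> = q^c.\<close>
    have "0 \<in> strip" "1 \<in> strip"
      using tau by (auto simp: strip_def)
    then have "h 0 = C" "h 1 = C"
      using C by auto
    then have "e2pi (of_real c) = 1"
      using \<open>C \<noteq> 0\<close> e2pi_of_int[of 1] by (auto simp: h_def simp del: e2pi_of_int)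
    then obtain k :: int where "complex_of_real c = of_int k"
      by (auto simp: e2pi_eq_1_iff)
    then have "e2pi (of_real c * \<tau>) = q powi k"
      by (simp add: e2pi_of_int_mult q_def)
    moreover define z where "z = Complex 0 (- Im \<tau> / 2)"
    have "z \<in> strip" "z + \<tau> \<in> strip" "Im z < 0"
      using tau by (auto simp: z_def strip_def)
    then have "\<zeta> * C = e2pi (of_real c * \<tau>) * C"
      using h_shift_tau[of z] C by simp
    ultimately show False
      using zeta_neq[of k] \<open>C \<noteq> 0\<close> by simp
  qed
  then show ?thesis
    using C[OF assms] by (simp add: h_def)
qed

end

text \<open>The strip means norm q < norm t < 1, the annulus on which both halves of the two-sided
  series converge without continuation.\<close>

theorem phi_st_kronecker:
  assumes "Im \<tau> > 0" "\<sigma> \<notin> period_lattice \<tau>" "0 < Im z" "Im z < Im \<tau>"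
  shows "((\<lambda>k::int. e2pi (of_int k * z) / (1 - e2pi (\<sigma> + of_int k * \<tau>))) has_sum phi_st z \<tau> \<sigma>) UNIV"
proof -
  interpret kronecker \<tau> \<sigma>
    using assms by unfold_locales
  define t where "t = e2pi z"
  have t: "t \<noteq> 0" "t \<noteq> 1" "norm t < 1" "norm (q * (1 / t)) < 1"
    using assms by (auto simp: t_def q_def norm_e2pi e2pi_eq_1_iff simp flip: e2pi_diff)
  have A: "A t = phi_st z \<tau> \<sigma>"
    using D_eq[OF t(2)] D_eq_0[of z] assms
    by (simp add: strip_def t_def phi_st_eq_kron q_def \<zeta>_def)
  define f where "f k = e2pi (of_int k * z) / (1 - e2pi (\<sigma> + of_int k * \<tau>))" for k :: int
  have f: "f k = t powi k / (1 - \<zeta> * q powi k)" for k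
    by (simp add: f_def e2pi_add e2pi_of_int_mult t_def q_def \<zeta>_def)
  have f1: "f (int n) = t ^ n + q ^ n * a n * t ^ n" for n
    using zeta_power_neq[of n] by (simp add: f a_def field_simps)
  have f2: "f (- int n) = (if n = 0 then f 0 else 0) - q ^ n * b n * (1 / t) ^ n" for n
  proof (cases "n = 0")
    case False
    have "1 - \<zeta> / q ^ n = - ((\<zeta> - q ^ n) / q ^ n)"
      using q_nz by (simp add: field_simps)
    then show ?thesis
      using False t(1) by (simp add: f b_def power_int_minus power_inverse divide_inverse mult_ac)
  qed (simp add: b_def)
  have qt: "norm (q * t) < 1"
    using norm_q_mult_less t(3) .
  have "(f has_sum (1 / (1 - t) + F t + (f 0 - H (1 / t) - f 0))) UNIV"
  proof (rule has_sum_int_split)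
    show "(\<lambda>n. f (int n)) sums (1 / (1 - t) + F t)"
      unfolding f1 using t(3) by (intro sums_add geometric_sums F_sums qt)
    show "summable (\<lambda>n. norm (f (int n)))"
      unfolding f1
    proof (rule summable_comparison_test'[of _ 0])
      show "summable (\<lambda>n. norm (t ^ n) + norm (q ^ n * a n * t ^ n))"
        using t(3) by (intro summable_add F_summable qt) (simp add: norm_power summable_geometric)
    qed (simp add: norm_triangle_ineq)
    show "(\<lambda>n. f (- int n)) sums (f 0 - H (1 / t))"
      unfolding f2 using t(4) sums_single[of 0 "\<lambda>_. f 0"] by (intro sums_diff H_sums) simp_all
    show "summable (\<lambda>n. norm (f (- int n)))"
    \<comment> \<open>The comparison starts at index 1: the term at 0 is \<open>f 0\<close>, whereas
      the majorant is 0 there.\<close>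
    proof (rule summable_comparison_test'[of _ 1])
      show "summable (\<lambda>n. norm (q ^ n * b n * (1 / t) ^ n))"
        by (rule H_summable[OF t(4)])
    qed (simp add: f2)
  qed
  then show ?thesis
    unfolding f_def[symmetric] A[symmetric] by (simp add: A_def)
qed

section \<open>Lattices and simplicial cones\<close>

lemma dual_basis:
  fixes v :: "'v \<Rightarrow> 'a::euclidean_space"
  assumes "inj_on v I" "independent (v ` I)" "x \<in> I"
  shows "linear (dual_basis v I x)"
    and "y \<in> I \<Longrightarrow> dual_basis v I x (v y) = (if y = x then 1 else 0)"
proof -
  obtain g :: "'a \<Rightarrow> real" where g: "linear g" "\<forall>z\<in>v ` I. g z = (if z = v x then 1 else 0)"
    using linear_independent_extend[OF assms(2), of "\<lambda>z. if z = v x then 1 else 0"] by blast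
  then have "linear g \<and> (\<forall>y\<in>I. g (v y) = (if y = x then 1 else 0))"
    using assms(1,3) by (auto simp: inj_on_eq_iff)
  then have "linear (dual_basis v I x) \<and> (\<forall>y\<in>I. dual_basis v I x (v y) = (if y = x then 1 else 0))"
    unfolding dual_basis_def by (rule someI[where P = "\<lambda>u. linear u \<and> (\<forall>y\<in>I. u (v y) = (if y = x then 1 else 0))"])
  then show "linear (dual_basis v I x)"
    and "y \<in> I \<Longrightarrow> dual_basis v I x (v y) = (if y = x then 1 else 0)"
    by auto
qed

lemma int_span_image:
  assumes "inj_on v I"
  shows "int_span (v ` I) = {\<Sum>i\<in>I. of_int (k i) *\<^sub>R v i | k. True}"
proof (intro equalityI subsetI)
  fix x assume "x \<in> int_span (v ` I)"
  then obtain c :: "'b \<Rightarrow> int" where "x = (\<Sum>b\<in>v ` I. of_int (c b) *\<^sub>R b)"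
    by (auto simp: int_span_def)
  then have "x = (\<Sum>i\<in>I. of_int (c (v i)) *\<^sub>R v i)"
    using assms by (simp add: sum.reindex)
  then show "x \<in> {\<Sum>i\<in>I. of_int (k i) *\<^sub>R v i | k. True}"
    by (auto intro!: exI[of _ "\<lambda>i. c (v i)"])
next
  fix x assume "x \<in> {\<Sum>i\<in>I. of_int (k i) *\<^sub>R v i | k. True}"
  then obtain k where "x = (\<Sum>i\<in>I. of_int (k i) *\<^sub>R v i)"
    by auto
  then have "x = (\<Sum>b\<in>v ` I. of_int (k (the_inv_into I v b)) *\<^sub>R b)"
    using assms by (simp add: sum.reindex the_inv_into_f_f)
  then show "x \<in> int_span (v ` I)"
    by (auto simp: int_span_def intro!: exI[of _ "\<lambda>b. k (the_inv_into I v b)"])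
qed

lemma int_span_0: "0 \<in> int_span S"
  by (auto simp: int_span_def intro!: exI[of _ "\<lambda>_. 0"])

lemma int_span_add:
  assumes "x \<in> int_span S" "y \<in> int_span S"
  shows "x + y \<in> int_span S"
proof -
  obtain c c' :: "'a \<Rightarrow> int"
    where "x = (\<Sum>b\<in>S. of_int (c b) *\<^sub>R b)" "y = (\<Sum>b\<in>S. of_int (c' b) *\<^sub>R b)"
    using assms by (auto simp: int_span_def)
  then have "x + y = (\<Sum>b\<in>S. of_int (c b + c' b) *\<^sub>R b)"
    by (simp add: scaleR_add_left sum.distrib)
  then show ?thesis
    by (auto simp: int_span_def intro!: exI[of _ "\<lambda>b. c b + c' b"])
qed

lemma int_span_scale:
  assumes "x \<in> int_span S"
  shows "of_int k *\<^sub>R x \<in> int_span S"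
proof -
  obtain c :: "'a \<Rightarrow> int" where "x = (\<Sum>b\<in>S. of_int (c b) *\<^sub>R b)"
    using assms by (auto simp: int_span_def)
  then have "of_int k *\<^sub>R x = (\<Sum>b\<in>S. of_int (k * c b) *\<^sub>R b)"
    by (simp add: scaleR_sum_right)
  then show ?thesis
    by (auto simp: int_span_def intro!: exI[of _ "\<lambda>b. k * c b"])
qed

lemma int_span_minus: "x \<in> int_span S \<Longrightarrow> - x \<in> int_span S"
  using int_span_scale[of x S "-1"] by simp

lemma int_span_diff: "x \<in> int_span S \<Longrightarrow> y \<in> int_span S \<Longrightarrow> x - y \<in> int_span S"
  using int_span_add[of x S "- y"] int_span_minus[of y S] by simp

lemma int_span_sum: "(\<And>i. i \<in> A \<Longrightarrow> f i \<in> int_span S) \<Longrightarrow> sum f A \<in> int_span S"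
  by (induction A rule: infinite_finite_induct) (auto intro: int_span_add int_span_0)

lemma int_span_base:
  assumes "finite S" "b \<in> S"
  shows "b \<in> int_span S"
proof -
  have "b = (\<Sum>b'\<in>S. of_int (if b' = b then 1 else 0) *\<^sub>R b')"
    using assms by (simp add: if_distrib[of "\<lambda>c. of_int c *\<^sub>R _"] sum.delta' cong: if_cong)
  then show ?thesis
    by (auto simp: int_span_def intro!: exI[of _ "\<lambda>b'. if b' = b then 1 else 0"])
qed

lemma span_int_span:
  assumes "finite S"
  shows "span (int_span S) = span S"
proof
  show "span (int_span S) \<subseteq> span S"
    by (rule span_minimal[OF _ subspace_span])
       (auto simp: int_span_def intro: span_sum span_scale span_base)
  show "span S \<subseteq> span (int_span S)"
    using int_span_base[OF assms] by (intro span_mono) auto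
qed

lemma is_latticeE:
  assumes "is_lattice n L"
  obtains B where "finite B" "independent B" "card B = n" "L = int_span B"
  using assms unfolding is_lattice_def by (metis independent_imp_finite)

lemma lattice_dim:
  assumes "is_lattice n L"
  shows "dim L = n"
  using assms by (metis is_latticeE dim_span span_int_span dim_eq_card_independent)

lemma lattice_0: "is_lattice n L \<Longrightarrow> 0 \<in> L"
  by (auto simp: is_lattice_def int_span_0)

lemma lattice_add: "is_lattice n L \<Longrightarrow> x \<in> L \<Longrightarrow> y \<in> L \<Longrightarrow> x + y \<in> L"
  by (auto simp: is_lattice_def int_span_add)

lemma lattice_diff: "is_lattice n L \<Longrightarrow> x \<in> L \<Longrightarrow> y \<in> L \<Longrightarrow> x - y \<in> L"
  by (auto simp: is_lattice_def int_span_diff)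

lemma lattice_scale: "is_lattice n L \<Longrightarrow> x \<in> L \<Longrightarrow> of_int k *\<^sub>R x \<in> L"
  by (auto simp: is_lattice_def int_span_scale)

lemma lattice_sum:
  "is_lattice n L \<Longrightarrow> (\<And>i. i \<in> A \<Longrightarrow> f i \<in> L) \<Longrightarrow> sum f A \<in> L"
  by (auto simp: is_lattice_def intro: int_span_sum)

text \<open>Coordinates in a lattice basis are integral on \<open>L\<close> and bounded on bounded
  sets.\<close>

lemma lattice_bounded_finite:
  fixes L :: "'a::euclidean_space set"
  assumes "is_lattice n L" "bounded S"
  shows "finite (L \<inter> S)"
proof -
  obtain B where B: "finite B" "independent B" "L = int_span B"
    using assms(1) by (auto elim: is_latticeE)
  define c where "c b = dual_basis id B b" for b :: 'a
  have c: "linear (c b)" "b' \<in> B \<Longrightarrow> c b b' = (if b' = b then 1 else 0)" if "b \<in> B" for b b'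
    using dual_basis(1)[of id B b] dual_basis(2)[of id B b b'] B that by (auto simp: c_def)
  have "\<exists>N::int. \<forall>x\<in>S. \<bar>c b x\<bar> \<le> of_int N" if "b \<in> B" for b
  proof -
    have "bounded (c b ` S)"
      using bounded_linear_image[OF assms(2)] c(1)[OF that] linear_conv_bounded_linear by blast
    then obtain K where "\<forall>x\<in>S. \<bar>c b x\<bar> \<le> K"
      by (auto simp: bounded_iff)
    then show ?thesis
      by (intro exI[of _ "\<lceil>K\<rceil>"]) (meson le_of_int_ceiling order_trans)
  qed
  then obtain N :: "'a \<Rightarrow> int" where N: "\<And>b x. b \<in> B \<Longrightarrow> x \<in> S \<Longrightarrow> \<bar>c b x\<bar> \<le> of_int (N b)"
    by metis
  have "L \<inter> S \<subseteq> (\<lambda>k. \<Sum>b\<in>B. of_int (k b) *\<^sub>R b) ` (PiE B (\<lambda>b. {- N b..N b}))"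
  proof
    fix x assume x: "x \<in> L \<inter> S"
    then obtain k :: "'a \<Rightarrow> int" where k: "x = (\<Sum>b\<in>B. of_int (k b) *\<^sub>R b)"
      using B by (auto simp: int_span_def)
    have "k b \<in> {- N b..N b}" if b: "b \<in> B" for b
    proof -
      have "c b x = (\<Sum>b'\<in>B. of_int (k b') * c b b')"
        unfolding k by (simp add: linear_sum[OF c(1)[OF b]] linear_scale[OF c(1)[OF b]])
      also have "\<dots> = (\<Sum>b'\<in>B. if b' = b then of_int (k b') else 0)"
        using c(2)[OF b] by (intro sum.cong) auto
      also have "\<dots> = of_int (k b)"
        using B(1) b by simp
      finally have "c b x = of_int (k b)" .
      then have "\<bar>of_int (k b)\<bar> \<le> (of_int (N b) :: real)"
        using N[OF b, of x] x by simp
      then have "\<bar>k b\<bar> \<le> N b"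
        by (metis of_int_abs of_int_le_iff)
      then show ?thesis
        by auto
    qed
    then have "restrict k B \<in> PiE B (\<lambda>b. {- N b..N b})"
      by auto
    moreover have "x = (\<Sum>b\<in>B. of_int (restrict k B b) *\<^sub>R b)"
      using k by simp
    ultimately show "x \<in> (\<lambda>k. \<Sum>b\<in>B. of_int (k b) *\<^sub>R b) ` (PiE B (\<lambda>b. {- N b..N b}))"
      by blast
  qed
  moreover have "finite (PiE B (\<lambda>b. {- N b..N b}))"
    using B(1) by (intro finite_PiE) auto
  ultimately show ?thesis
    using finite_surj by blast
qed

section \<open>Products and finite sums of summable families\<close>

lemma has_sum_prod_PiE:
  fixes f :: "'i \<Rightarrow> 'k \<Rightarrow> complex"
  assumes "finite I" "\<And>i. i \<in> I \<Longrightarrow> (f i has_sum s i) (B i)"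
  shows "((\<lambda>g. \<Prod>i\<in>I. f i (g i)) has_sum (\<Prod>i\<in>I. s i)) (PiE I B)"
proof -
  have abs: "(\<lambda>k. norm (f i k)) summable_on B i" if "i \<in> I" for i
    using assms(2)[OF that] summable_on_iff_abs_summable_on_complex has_sum_imp_summable by blast
  have "(\<lambda>g. norm (\<Prod>i\<in>I. f i (g i))) summable_on PiE I B"
    \<comment> \<open>A finite set of index families lies in the box spanned by its coordinate
      projections, and the sum of norms over a box factors.\<close>
    unfolding abs_summable_iff_bdd_above
  proof (rule bdd_aboveI2)
    fix G assume "G \<in> {F. F \<subseteq> PiE I B \<and> finite F}"
    then have G: "G \<subseteq> PiE I B" "finite G"
      by auto
    define P where "P i = (\<lambda>g. g i) ` G" for i
    have P: "finite (P i)" "i \<in> I \<Longrightarrow> P i \<subseteq> B i" for i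
      using G by (auto simp: P_def)
    have "G \<subseteq> PiE I P"
    proof
      fix g assume "g \<in> G"
      moreover from this have "g i = undefined" if "i \<notin> I" for i
        using G(1) that by (meson PiE_arb subsetD)
      ultimately show "g \<in> PiE I P"
        by (intro PiE_I) (auto simp: P_def)
    qed
    then have "(\<Sum>g\<in>G. norm (\<Prod>i\<in>I. f i (g i))) \<le> (\<Sum>g\<in>PiE I P. norm (\<Prod>i\<in>I. f i (g i)))"
      using assms(1) P by (intro sum_mono2 finite_PiE) auto
    also have "\<dots> = (\<Prod>i\<in>I. \<Sum>k\<in>P i. norm (f i k))"
      using assms(1) P by (simp add: prod_sum_PiE prod_norm)
    also have "\<dots> \<le> (\<Prod>i\<in>I. infsum (\<lambda>k. norm (f i k)) (B i))"
      using abs P by (intro prod_mono conjI sum_nonneg finite_sum_le_infsum) auto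
    finally show "(\<Sum>g\<in>G. norm (\<Prod>i\<in>I. f i (g i))) \<le> (\<Prod>i\<in>I. infsum (\<lambda>k. norm (f i k)) (B i))" .
  qed
  then have "(\<lambda>g. \<Prod>i\<in>I. f i (g i)) summable_on PiE I B"
    by (rule abs_summable_summable)
  moreover have "infsum (\<lambda>g. \<Prod>i\<in>I. f i (g i)) (PiE I B) = (\<Prod>i\<in>I. s i)"
    using infsum_prod_PiE_abs[OF assms(1) abs, of "\<lambda>i. i"] infsumI[OF assms(2)]
    by (simp cong: prod.cong)
  ultimately show ?thesis
    by (simp add: has_sum_iff)
qed

lemma has_sum_sum:
  fixes f :: "'i \<Rightarrow> 'b \<Rightarrow> 'c::topological_comm_monoid_add"
  assumes "finite I" "\<And>i. i \<in> I \<Longrightarrow> (f i has_sum s i) A"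
  shows "((\<lambda>x. \<Sum>i\<in>I. f i x) has_sum (\<Sum>i\<in>I. s i)) A"
  using assms by (induction I) (auto intro!: has_sum_add)

text \<open>Functionals are represented by inner products. Restricting to vectors of
  \<open>span L\<close> makes the representation unique even when \<open>L\<close> does not span the
  ambient space.\<close>

definition dual_lattice :: "'a::euclidean_space set \<Rightarrow> 'a set" where
  "dual_lattice L = {m \<in> span L. \<forall>x\<in>L. m \<bullet> x \<in> \<int>}"

section \<open>The finite-index sublattice generated by the edge vectors of a simplex\<close>

locale lattice_frame =
  fixes n :: nat and L :: "'a::euclidean_space set" and I :: "'v set" and v :: "'v \<Rightarrow> 'a"
  assumes lattice: "is_lattice n L"
    and finite_I: "finite I"
    and inj_v: "inj_on v I"
    and indep: "independent (v ` I)"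
    and v_in_L: "i \<in> I \<Longrightarrow> v i \<in> L"
    and span_v: "span (v ` I) = span L"
begin

definition u where "u = dual_basis v I"

lemma linear_u: "i \<in> I \<Longrightarrow> linear (u i)"
  using dual_basis(1)[OF inj_v indep] by (simp add: u_def)

lemma u_v: "i \<in> I \<Longrightarrow> j \<in> I \<Longrightarrow> u i (v j) = (if j = i then 1 else 0)"
  using dual_basis(2)[OF inj_v indep] by (simp add: u_def)

lemma L_span: "x \<in> L \<Longrightarrow> x \<in> span L"
  by (rule span_base)

lemma expand:
  assumes "y \<in> span L"
  shows "(\<Sum>i\<in>I. u i y *\<^sub>R v i) = y"
proof -
  have "linear (\<lambda>y. \<Sum>i\<in>I. u i y *\<^sub>R v i)"
    by (rule linearI) (simp_all add: linear_add[OF linear_u] linear_scale[OF linear_u]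
        scaleR_add_left sum.distrib scaleR_sum_right)
  moreover have "linear (\<lambda>y::'a. y)"
    by (rule linear_ident)
  moreover have "(\<Sum>i\<in>I. u i y *\<^sub>R v i) = y" if "y \<in> v ` I" for y
  proof -
    obtain j where j: "j \<in> I" "y = v j"
      using \<open>y \<in> v ` I\<close> by auto
    have "(\<Sum>i\<in>I. u i y *\<^sub>R v i) = (\<Sum>i\<in>I. if i = j then v i else 0)"
      using j by (intro sum.cong) (auto simp: u_v)
    then show ?thesis
      using j finite_I by simp
  qed
  ultimately show ?thesis
    using assms unfolding span_v[symmetric] by (rule linear_eq_on_span)
qed

lemma linear_expand:
  fixes f :: "'a \<Rightarrow> 'b::real_vector"
  assumes "linear f" "y \<in> span L"
  shows "f y = (\<Sum>i\<in>I. u i y *\<^sub>R f (v i))"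
proof -
  have "f y = f (\<Sum>i\<in>I. u i y *\<^sub>R v i)"
    using expand[OF assms(2)] by simp
  then show ?thesis
    by (simp add: linear_sum[OF assms(1)] linear_scale[OF assms(1)])
qed

lemma u_comb:
  assumes "j \<in> I"
  shows "u j (\<Sum>i\<in>I. c i *\<^sub>R v i) = c j"
proof -
  have "u j (\<Sum>i\<in>I. c i *\<^sub>R v i) = (\<Sum>i\<in>I. c i * u j (v i))"
    by (simp add: linear_sum[OF linear_u[OF assms]] linear_scale[OF linear_u[OF assms]])
  also have "\<dots> = (\<Sum>i\<in>I. if i = j then c i else 0)"
    using assms by (intro sum.cong) (auto simp: u_v)
  finally show ?thesis
    using assms finite_I by simp
qed

lemma u_add: "i \<in> I \<Longrightarrow> u i (x + y) = u i x + u i y"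
  and u_diff: "i \<in> I \<Longrightarrow> u i (x - y) = u i x - u i y"
  using linear_u linear_add linear_diff by blast+

lemma comb_in_L: "(\<Sum>i\<in>I. of_int (k i) *\<^sub>R v i) \<in> L"
  using lattice v_in_L by (intro lattice_sum lattice_scale)

lemma sublattice_iff:
  assumes "y \<in> span L"
  shows "y \<in> int_span (v ` I) \<longleftrightarrow> (\<forall>i\<in>I. u i y \<in> \<int>)"
proof
  assume "y \<in> int_span (v ` I)"
  then show "\<forall>i\<in>I. u i y \<in> \<int>"
    by (auto simp: int_span_image[OF inj_v] u_comb)
next
  assume *: "\<forall>i\<in>I. u i y \<in> \<int>"
  have "y = (\<Sum>i\<in>I. of_int \<lfloor>u i y\<rfloor> *\<^sub>R v i)"
    using * expand[OF assms] by simp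
  then show "y \<in> int_span (v ` I)"
    by (auto simp: int_span_image[OF inj_v])
qed

text \<open>The lattice points of the half-open fundamental parallelepiped of the sublattice, moved
  to \<open>y0\<close>. They represent \<open>L\<close> modulo the sublattice, and \<open>y0\<close>
  can be chosen to suit convergence.\<close>

definition cell where
  "cell y0 = {x \<in> L. \<forall>i\<in>I. 0 \<le> u i (x - y0) \<and> u i (x - y0) < 1}"

lemma cell_in_L: "x \<in> cell y0 \<Longrightarrow> x \<in> L"
  by (simp add: cell_def)

lemma finite_cell:
  assumes "y0 \<in> span L"
  shows "finite (cell y0)"
proof -
  have "cell y0 \<subseteq> L \<inter> cball 0 (norm y0 + (\<Sum>i\<in>I. norm (v i)))"
  proof
    fix x assume x: "x \<in> cell y0"
    then have "x - y0 \<in> span L"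
      using assms by (auto simp: cell_def intro: span_diff L_span)
    then have "norm (x - y0) = norm (\<Sum>i\<in>I. u i (x - y0) *\<^sub>R v i)"
      using expand by simp
    also have "\<dots> \<le> (\<Sum>i\<in>I. norm (u i (x - y0) *\<^sub>R v i))"
      by (rule norm_sum)
    also have "\<dots> \<le> (\<Sum>i\<in>I. norm (v i))"
      using x by (intro sum_mono) (auto simp: cell_def abs_le_iff intro!: mult_left_le_one_le)
    finally have "norm x \<le> norm y0 + (\<Sum>i\<in>I. norm (v i))"
      using norm_triangle_sub[of x y0] by linarith
    then show "x \<in> L \<inter> cball 0 (norm y0 + (\<Sum>i\<in>I. norm (v i)))"
      using x by (simp add: cell_def)
  qed
  then show ?thesis
    using lattice_bounded_finite[OF lattice bounded_cball] finite_subset by blast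
qed

abbreviation same_class where
  "same_class \<equiv> {(a, b). a \<in> L \<and> b \<in> L \<and> a - b \<in> int_span (v ` I)}"

lemma equiv_same_class: "equiv L same_class"
proof (rule equivI)
  show "sym same_class"
    by (auto simp: sym_def dest: int_span_minus)
  show "trans same_class"
    by (auto simp: trans_def dest: int_span_add)
qed (auto simp: refl_on_def int_span_0)

lemma cell_reduce:
  assumes "y \<in> L"
  shows "y - (\<Sum>i\<in>I. of_int \<lfloor>u i (y - y0)\<rfloor> *\<^sub>R v i) \<in> cell y0"
proof -
  have "u j (y - (\<Sum>i\<in>I. of_int \<lfloor>u i (y - y0)\<rfloor> *\<^sub>R v i) - y0) = frac (u j (y - y0))" if "j \<in> I" for j
    using that by (simp add: u_diff u_comb frac_def)
  then show ?thesis
    using assms lattice_diff[OF lattice assms comb_in_L] by (simp add: cell_def frac_lt_1)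
qed

lemma cell_unique:
  assumes "x \<in> cell y0" "x' \<in> cell y0" "x - x' \<in> int_span (v ` I)"
  shows "x = x'"
proof -
  have sp: "x - x' \<in> span L"
    using assms by (auto simp: cell_def intro: span_diff L_span)
  have "u i (x - x') = 0" if i: "i \<in> I" for i
  proof -
    obtain k :: int where k: "u i (x - x') = of_int k"
      using assms(3) sublattice_iff[OF sp] i by (auto elim: Ints_cases)
    have "\<bar>u i (x - x')\<bar> < 1"
      using assms(1,2) i by (fastforce simp: cell_def u_diff abs_less_iff)
    then show ?thesis
      using k by (simp flip: of_int_abs)
  qed
  then have "x - x' = 0"
    using expand[OF sp] by simp
  then show ?thesis
    by simp
qed

lemma bij_cell: "bij_betw (\<lambda>x. same_class `` {x}) (cell y0) (quotient_group L v I)"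
proof (rule bij_betw_imageI)
  show "inj_on (\<lambda>x. same_class `` {x}) (cell y0)"
  proof (rule inj_onI)
    fix x x' assume x: "x \<in> cell y0" "x' \<in> cell y0" "same_class `` {x} = same_class `` {x'}"
    then have "x - x' \<in> int_span (v ` I)"
      using eq_equiv_class[OF x(3) equiv_same_class] by (auto simp: cell_def)
    then show "x = x'"
      using cell_unique x by blast
  qed
  show "(\<lambda>x. same_class `` {x}) ` cell y0 = quotient_group L v I"
  proof (intro equalityI subsetI)
    fix h assume "h \<in> (\<lambda>x. same_class `` {x}) ` cell y0"
    then show "h \<in> quotient_group L v I"
      unfolding quotient_group_def by (blast intro: quotientI dest: cell_in_L)
  next
    fix h assume "h \<in> quotient_group L v I"
    then obtain y where y: "y \<in> L" "h = same_class `` {y}"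
      unfolding quotient_group_def by (auto elim: quotientE)
    define s where "s = (\<Sum>i\<in>I. of_int \<lfloor>u i (y - y0)\<rfloor> *\<^sub>R v i)"
    have s: "s \<in> int_span (v ` I)"
      by (auto simp: s_def int_span_image[OF inj_v] intro!: exI[of _ "\<lambda>i. \<lfloor>u i (y - y0)\<rfloor>"])
    have "y - s \<in> cell y0"
      unfolding s_def by (rule cell_reduce[OF y(1)])
    moreover have "(y, y - s) \<in> same_class"
      using y s \<open>y - s \<in> cell y0\<close> by (auto simp: cell_def)
    then have "h = same_class `` {y - s}"
      using equiv_class_eq[OF equiv_same_class] y by blast
    ultimately show "h \<in> (\<lambda>x. same_class `` {x}) ` cell y0"
      by blast
  qed
qed

lemma card_cell: "card (quotient_group L v I) = card (cell y0)"
  using bij_betw_same_card[OF bij_cell] by metis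

lemma cell_nonempty: "cell y0 \<noteq> {}"
  using cell_reduce[OF lattice_0[OF lattice]] by blast

text \<open>A periodic summand does not see which representative was chosen, so the arbitrary ones
  in the genus may be replaced by the points of any translated cell.\<close>

lemma sum_quotient_group:
  assumes "\<And>x k. x \<in> L \<Longrightarrow> f (x + (\<Sum>i\<in>I. of_int (k i) *\<^sub>R v i)) = f x"
  shows "(\<Sum>h\<in>quotient_group L v I. f (representative h)) = (\<Sum>x\<in>cell y0. f x)"
proof -
  have "f (representative (same_class `` {x})) = f x" if "x \<in> cell y0" for x
  proof -
    have "x \<in> L"
      using that by (simp add: cell_def)
    then have "x \<in> same_class `` {x}"
      by (auto simp: int_span_0)
    then have "representative (same_class `` {x}) \<in> same_class `` {x}"
      unfolding representative_def by (rule someI)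
    then have *: "representative (same_class `` {x}) \<in> L"
      "x - representative (same_class `` {x}) \<in> int_span (v ` I)"
      by auto
    then obtain k where k: "x - representative (same_class `` {x}) = (\<Sum>i\<in>I. of_int (k i) *\<^sub>R v i)"
      by (auto simp: int_span_image[OF inj_v])
    have "x = representative (same_class `` {x}) + (\<Sum>i\<in>I. of_int (k i) *\<^sub>R v i)"
      unfolding k[symmetric] by simp
    then show ?thesis
      using assms[OF *(1), of k] by simp
  qed
  then have "(\<Sum>x\<in>cell y0. f x) = (\<Sum>x\<in>cell y0. f (representative (same_class `` {x})))"
    by (intro sum.cong) auto
  also have "\<dots> = (\<Sum>h\<in>quotient_group L v I. f (representative h))"
    by (rule sum.reindex_bij_betw[OF bij_cell])
  finally show ?thesis
    by simp
qed

lemma sum_cell_translate: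
  assumes "\<And>x k. x \<in> L \<Longrightarrow> f (x + (\<Sum>i\<in>I. of_int (k i) *\<^sub>R v i)) = f x" "l \<in> L"
  shows "(\<Sum>x\<in>cell y0. f (x + l)) = (\<Sum>x\<in>cell y0. f x)"
proof -
  have "bij_betw (\<lambda>x. x + l) (cell y0) (cell (y0 + l))"
    by (rule bij_betwI[where g = "\<lambda>x. x - l"])
       (use assms(2) lattice_add[OF lattice] lattice_diff[OF lattice] in
         \<open>auto simp: cell_def algebra_simps\<close>)
  then have "(\<Sum>x\<in>cell y0. f (x + l)) = (\<Sum>x\<in>cell (y0 + l). f x)"
    by (rule sum.reindex_bij_betw)
  then show ?thesis
    using sum_quotient_group[OF assms(1)] by metis
qed

text \<open>Orthogonality of characters on \<open>L\<close> modulo the sublattice: translation by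
  some \<open>l\<close> with \<open>f l\<close> non-integral leaves the sum unchanged, yet
  multiplies it by a number different from 1.\<close>

lemma character_sum:
  assumes "linear f" "\<And>i. i \<in> I \<Longrightarrow> f (v i) \<in> \<int>"
  shows "(\<Sum>x\<in>cell y0. e2pi (- of_real (f x))) =
    (if \<forall>x\<in>L. f x \<in> \<int> then of_nat (card (cell y0)) else 0)"
proof (cases "\<forall>x\<in>L. f x \<in> \<int>")
  case True
  then have "e2pi (- of_real (f x)) = 1" if "x \<in> cell y0" for x
    using that by (intro e2pi_Ints) (auto simp: cell_def elim: Ints_cases)
  then show ?thesis
    using True by simp
next
  case False
  then obtain l where l: "l \<in> L" "f l \<notin> \<int>"
    by auto
  let ?g = "\<lambda>x. e2pi (- of_real (f x))"
  have add: "?g (x + y) = ?g x * ?g y" for x y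
    by (simp add: linear_add[OF assms(1)] e2pi_add e2pi_diff e2pi_minus divide_inverse)
  have "?g (\<Sum>i\<in>I. of_int (k i) *\<^sub>R v i) = 1" for k
  proof (rule e2pi_Ints)
    have "f (\<Sum>i\<in>I. of_int (k i) *\<^sub>R v i) \<in> \<int>"
      using assms by (auto simp: linear_sum[OF assms(1)] linear_scale[OF assms(1)])
    then show "- of_real (f (\<Sum>i\<in>I. of_int (k i) *\<^sub>R v i)) \<in> (\<int> :: complex set)"
      by (auto elim!: Ints_cases)
  qed
  then have "(\<Sum>x\<in>cell y0. ?g (x + l)) = (\<Sum>x\<in>cell y0. ?g x)"
    using sum_cell_translate[of ?g l] l(1) by (simp add: add)
  then have "(\<Sum>x\<in>cell y0. ?g x) * (?g l - 1) = 0"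
    by (simp add: add right_diff_distrib flip: sum_distrib_right)
  moreover have "?g l \<noteq> 1"
  proof
    assume "?g l = 1"
    then obtain k :: int where "- complex_of_real (f l) = of_int k"
      by (auto simp: e2pi_eq_1_iff)
    then have "f l = of_int (- k)"
      by (metis Re_complex_of_real minus_complex.sel(1) add.inverse_inverse of_int_minus of_real_of_int_eq of_real_eq_iff of_real_minus)
    then show False
      using l(2) Ints_of_int by metis
  qed
  ultimately have "(\<Sum>x\<in>cell y0. ?g x) = 0"
    by simp
  then show ?thesis
    using False by (simp only: if_False)
qed

text \<open>Integer families on \<open>I\<close> are the functionals integral on the sublattice,
  written in the basis dual to the edge vectors. Those integral on all of \<open>L\<close> are the
  ones that survive \<open>character_sum\<close>.\<close>

lemma dual_lattice_bij:
  "bij_betw (\<lambda>m. \<lambda>i\<in>I. \<lfloor>m \<bullet> v i\<rfloor>) (dual_lattice L)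
     {k \<in> PiE I (\<lambda>_. UNIV). \<forall>x\<in>L. (\<Sum>i\<in>I. of_int (k i) * u i x) \<in> \<int>}"
proof (rule bij_betw_imageI)
  have fl: "of_int \<lfloor>m \<bullet> v i\<rfloor> = m \<bullet> v i" if "m \<in> dual_lattice L" "i \<in> I" for m i
    using that v_in_L by (auto simp: dual_lattice_def elim: Ints_cases)
  have ip: "m \<bullet> y = (\<Sum>i\<in>I. u i y * (m \<bullet> v i))" if "y \<in> span L" for m y
    using linear_expand[of "\<lambda>y. m \<bullet> y", OF _ that] by (simp add: bounded_linear.linear bounded_linear_inner_right)
  show "inj_on (\<lambda>m. \<lambda>i\<in>I. \<lfloor>m \<bullet> v i\<rfloor>) (dual_lattice L)"
  proof (rule inj_onI)
    fix m m' assume m: "m \<in> dual_lattice L" "m' \<in> dual_lattice L"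
      and eq: "(\<lambda>i\<in>I. \<lfloor>m \<bullet> v i\<rfloor>) = (\<lambda>i\<in>I. \<lfloor>m' \<bullet> v i\<rfloor>)"
    have "m \<bullet> v i = m' \<bullet> v i" if "i \<in> I" for i
      using fun_cong[OF eq, of i] that fl m by (metis restrict_apply)
    then have "(m - m') \<bullet> v i = 0" if "i \<in> I" for i
      using that by (simp add: inner_diff_left)
    moreover have "m - m' \<in> span L"
      using m by (auto simp: dual_lattice_def intro: span_diff)
    ultimately have "(m - m') \<bullet> (m - m') = 0"
      by (subst ip) auto
    then show "m = m'"
      by simp
  qed
  show "(\<lambda>m. \<lambda>i\<in>I. \<lfloor>m \<bullet> v i\<rfloor>) ` dual_lattice L =
      {k \<in> PiE I (\<lambda>_. UNIV). \<forall>x\<in>L. (\<Sum>i\<in>I. of_int (k i) * u i x) \<in> \<int>}"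
  proof (intro equalityI subsetI)
    fix k assume "k \<in> (\<lambda>m. \<lambda>i\<in>I. \<lfloor>m \<bullet> v i\<rfloor>) ` dual_lattice L"
    then obtain m where m: "m \<in> dual_lattice L" "k = (\<lambda>i\<in>I. \<lfloor>m \<bullet> v i\<rfloor>)"
      by auto
    have "(\<Sum>i\<in>I. of_int (k i) * u i x) = m \<bullet> x" if "x \<in> L" for x
      unfolding ip[OF L_span[OF that], of m] using m fl by (intro sum.cong) auto
    then show "k \<in> {k \<in> PiE I (\<lambda>_. UNIV). \<forall>x\<in>L. (\<Sum>i\<in>I. of_int (k i) * u i x) \<in> \<int>}"
      using m by (auto simp: dual_lattice_def)
  next
    fix k assume k: "k \<in> {k \<in> PiE I (\<lambda>_. UNIV). \<forall>x\<in>L. (\<Sum>i\<in>I. of_int (k i) * u i x) \<in> \<int>}"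
    define f where "f x = (\<Sum>i\<in>I. of_int (k i) * u i x)" for x
    have "linear f"
      unfolding f_def
      by (rule linearI) (auto simp: linear_add[OF linear_u] linear_scale[OF linear_u]
          ring_distribs sum.distrib sum_distrib_left mult_ac)
    \<comment> \<open>The adjoint represents \<open>f\<close> by an ambient vector; its orthogonal
      projection to \<open>span L\<close> is the required element of the dual lattice.\<close>
    then have f: "f y = y \<bullet> adjoint f 1" for y
      using adjoint_works[of f y 1] by simp
    obtain m m' where m: "m \<in> span L" "\<And>y. y \<in> span L \<Longrightarrow> orthogonal m' y" "adjoint f 1 = m + m'"
      using orthogonal_subspace_decomp_exists by blast
    have fm: "f y = m \<bullet> y" if "y \<in> span L" for y
      using m(2)[OF that] by (simp add: f m(3) inner_add_right inner_commute orthogonal_def)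
    then have "m \<in> dual_lattice L"
      using m(1) k L_span by (fastforce simp: dual_lattice_def f_def)
    moreover have "m \<bullet> v j = of_int (k j)" if j: "j \<in> I" for j
    proof -
      have "m \<bullet> v j = (\<Sum>i\<in>I. of_int (k i) * u i (v j))"
        using fm[of "v j"] j v_in_L L_span by (simp add: f_def)
      also have "\<dots> = (\<Sum>i\<in>I. if i = j then of_int (k i) else 0)"
        using j by (intro sum.cong) (auto simp: u_v)
      finally show ?thesis
        using j finite_I by simp
    qed
    then have "k = (\<lambda>i\<in>I. \<lfloor>m \<bullet> v i\<rfloor>)"
      using k by (auto simp: PiE_iff extensional_def)
    ultimately show "k \<in> (\<lambda>m. \<lambda>i\<in>I. \<lfloor>m \<bullet> v i\<rfloor>) ` dual_lattice L"
      by blast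
  qed
qed

section \<open>Generating functions of shifted simplicial cones\<close>

definition cone_series where
  "cone_series y0 Y = (\<Sum>x\<in>cell y0. e2pi (Y x)) / (\<Prod>i\<in>I. 1 - e2pi (Y (v i)))"

text \<open>Each lattice point of the shifted cone is in exactly one way a cell point plus a
  combination of edge vectors with natural coefficients (the floors of its coordinates), which gives
  a product of geometric series. The closed form also makes sense where this sum diverges, and
  continuation in \<open>Y\<close> starts from there.\<close>

lemma cone_series_has_sum:
  fixes Y :: "'a \<Rightarrow> complex"
  assumes "linear Y" "\<And>i. i \<in> I \<Longrightarrow> Im (Y (v i)) > 0" "y0 \<in> span L"
  shows "((\<lambda>x. e2pi (Y x)) has_sum cone_series y0 Y) {x \<in> L. \<forall>i\<in>I. 0 \<le> u i (x - y0)}"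
proof -
  define comb where "comb k = (\<Sum>i\<in>I. of_nat (k i) *\<^sub>R v i)" for k :: "'v \<Rightarrow> nat"
  define N where "N = PiE I (\<lambda>_. UNIV :: nat set)"
  define B where "B x = (\<lambda>k. x + comb k) ` N" for x
  have ucomb: "u i (comb k) = of_nat (k i)" if "i \<in> I" for i k
    using u_comb[OF that] by (simp add: comb_def)
  have comb_int: "comb k = (\<Sum>i\<in>I. of_int (int (k i)) *\<^sub>R v i)" for k
    by (simp add: comb_def)
  have comb_span: "comb k \<in> int_span (v ` I)" for k
    unfolding comb_int int_span_image[OF inj_v] by (intro CollectI exI[of _ "\<lambda>i. int (k i)"]) simp
  have comb_L: "comb k \<in> L" for k
    unfolding comb_int by (rule comb_in_L)
  have "((\<lambda>x. e2pi (Y x)) has_sum (\<Sum>x\<in>cell y0. e2pi (Y x) * (\<Prod>i\<in>I. 1 / (1 - e2pi (Y (v i))))))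
      (\<Union>x\<in>cell y0. B x)"
  proof (rule sum_has_sum)
    fix x assume x: "x \<in> cell y0"
    have "((\<lambda>k. \<Prod>i\<in>I. e2pi (Y (v i)) ^ k i) has_sum (\<Prod>i\<in>I. 1 / (1 - e2pi (Y (v i))))) N"
      unfolding N_def
    proof (rule has_sum_prod_PiE[OF finite_I])
      fix i assume "i \<in> I"
      then have "norm (e2pi (Y (v i))) < 1"
        using assms(2) by (simp add: norm_e2pi)
      then show "((\<lambda>k. e2pi (Y (v i)) ^ k) has_sum 1 / (1 - e2pi (Y (v i)))) UNIV"
        by (intro norm_summable_imp_has_sum geometric_sums) (simp add: norm_power summable_geometric)
    qed
    then have "((\<lambda>k. e2pi (Y x) * (\<Prod>i\<in>I. e2pi (Y (v i)) ^ k i)) has_sum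
        e2pi (Y x) * (\<Prod>i\<in>I. 1 / (1 - e2pi (Y (v i))))) N"
      by (rule has_sum_cmult_right)
    moreover have "e2pi (Y x) * (\<Prod>i\<in>I. e2pi (Y (v i)) ^ k i) = e2pi (Y (x + comb k))" for k
      by (simp add: comb_def linear_add[OF assms(1)] linear_sum[OF assms(1)] linear_scale[OF assms(1)]
          e2pi_add e2pi_sum scaleR_conv_of_real flip: e2pi_of_nat_mult)
    ultimately have "((\<lambda>k. e2pi (Y (x + comb k))) has_sum
        e2pi (Y x) * (\<Prod>i\<in>I. 1 / (1 - e2pi (Y (v i))))) N"
      by simp
    moreover have "inj_on (\<lambda>k. x + comb k) N"
    proof (rule inj_onI)
      fix k k' assume k: "k \<in> N" "k' \<in> N" "x + comb k = x + comb k'"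
      then have "comb k = comb k'"
        by simp
      then have "k i = k' i" if "i \<in> I" for i
        using ucomb[OF that] by (metis of_nat_eq_iff)
      then show "k = k'"
        using k unfolding N_def by (auto intro: PiE_ext)
    qed
    ultimately show "((\<lambda>x. e2pi (Y x)) has_sum e2pi (Y x) * (\<Prod>i\<in>I. 1 / (1 - e2pi (Y (v i))))) (B x)"
      unfolding B_def by (subst has_sum_reindex) (auto simp: o_def)
  next
    fix x x' assume x: "x \<in> cell y0" "x' \<in> cell y0" "x \<noteq> x'"
    show "B x \<inter> B x' = {}"
    proof (rule ccontr)
      assume "B x \<inter> B x' \<noteq> {}"
      then obtain k k' where "x + comb k = x' + comb k'"
        by (auto simp: B_def)
      then have "x - x' = comb k' - comb k"
        by (simp add: algebra_simps)
      then have "x - x' \<in> int_span (v ` I)"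
        using int_span_diff comb_span by metis
      then show False
        using cell_unique x by blast
    qed
  qed (rule finite_cell[OF assms(3)])
  moreover have "(\<Union>x\<in>cell y0. B x) = {x \<in> L. \<forall>i\<in>I. 0 \<le> u i (x - y0)}"
  proof (intro equalityI subsetI)
    fix y assume "y \<in> (\<Union>x\<in>cell y0. B x)"
    then obtain x k where "x \<in> cell y0" "y = x + comb k"
      by (auto simp: B_def)
    then show "y \<in> {x \<in> L. \<forall>i\<in>I. 0 \<le> u i (x - y0)}"
      using lattice_add[OF lattice _ comb_L] by (auto simp: cell_def u_diff u_add ucomb)
  next
    fix y assume y: "y \<in> {x \<in> L. \<forall>i\<in>I. 0 \<le> u i (x - y0)}"
    define k where "k = (\<lambda>i\<in>I. nat \<lfloor>u i (y - y0)\<rfloor>)"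
    have "comb k = (\<Sum>i\<in>I. of_int \<lfloor>u i (y - y0)\<rfloor> *\<^sub>R v i)"
      unfolding comb_def k_def using y by (intro sum.cong) auto
    then have "y - comb k \<in> cell y0"
      using cell_reduce y by simp
    moreover have "y \<in> B (y - comb k)"
      by (auto simp: B_def N_def k_def intro!: image_eqI[of _ _ k])
    ultimately show "y \<in> (\<Union>x\<in>cell y0. B x)"
      by blast
  qed
  ultimately show ?thesis
    by (simp add: cone_series_def prod_dividef sum_divide_distrib)
qed

section \<open>Expansion of the contribution of one simplex over the dual lattice\<close>

definition genus_term where
  "genus_term \<tau> s w = 1 / of_nat (card (quotient_group L v I)) *
     (\<Sum>(h1, h2)\<in>quotient_group L v I \<times> quotient_group L v I.
        \<Prod>i\<in>I. e2pi (s (v i) * of_real (u i (representative h1))) *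
             phi_st (phi_argument v \<tau> w I h1 h2 i) \<tau> (s (v i)))"

lemma u_scale: "i \<in> I \<Longrightarrow> u i (r *\<^sub>R x) = r * u i x"
  using linear_u linear_scale by fastforce

lemma phi_argument_eq:
  assumes "i \<in> I"
  shows "phi_argument v \<tau> w I h1 h2 i =
    \<tau> * of_real (u i (representative h1)) - of_real (u i (representative h2)) - pairing_complex (u i) w"
  using assms unfolding phi_argument_def u_def[symmetric]
  by (simp add: pairing_complex_def tensor_complex_def complex_eq_iff u_diff u_add u_scale
      linear_neg[OF linear_u])

lemma pairing_inner:
  assumes "fst w \<in> span L" "snd w \<in> span L"
  shows "(\<Sum>i\<in>I. of_real (m \<bullet> v i) * pairing_complex (u i) w) = pairing_complex (\<lambda>y. m \<bullet> y) w"
proof -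
  have ip: "m \<bullet> y = (\<Sum>i\<in>I. (m \<bullet> v i) * u i y)" if "y \<in> span L" for y
    using linear_expand[of "\<lambda>y. m \<bullet> y", OF _ that]
    by (simp add: bounded_linear.linear bounded_linear_inner_right mult.commute)
  show ?thesis
    using ip[OF assms(1)] ip[OF assms(2)] by (simp add: pairing_complex_def complex_eq_iff)
qed

definition dual_term where
  "dual_term \<tau> s w m = e2pi (- pairing_complex (\<lambda>y. m \<bullet> y) w) *
     cone_series (snd w /\<^sub>R Im \<tau>) (\<lambda>x. s x + \<tau> * of_real (m \<bullet> x))"

text \<open>The linear form \<open>s\<close> stands for \<sigma> u(I), so that
  \<open>s (v i)\<close> is d_i \<sigma>. Every factor is expanded by Kronecker's series, and the
  sum over the second group element discards the exponents outside the dual lattice.\<close>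

lemma genus_term_has_sum:
  fixes s :: "'a \<Rightarrow> complex"
  assumes tau: "Im \<tau> > 0" and "linear s"
    and sigma: "\<And>i. i \<in> I \<Longrightarrow> s (v i) \<notin> period_lattice \<tau>"
    and w: "fst w \<in> span L" "snd w \<in> span L"
    and generic: "\<And>x i. x \<in> L \<Longrightarrow> i \<in> I \<Longrightarrow> u i (x - snd w /\<^sub>R Im \<tau>) \<noteq> 0"
  shows "(dual_term \<tau> s w has_sum genus_term \<tau> s w) (dual_lattice L)"
proof -
  define y0 where "y0 = snd w /\<^sub>R Im \<tau>"
  have y0: "y0 \<in> span L"
    unfolding y0_def using w by (intro span_scale)
  define C where "C = cell y0"
  define N where "N = (of_nat (card C) :: complex)"
  have N: "N \<noteq> 0"
    using finite_cell[OF y0] cell_nonempty by (simp add: N_def C_def card_eq_0_iff)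
  define P where "P i = pairing_complex (u i) w" for i
  define G where "G x x' = (\<Prod>i\<in>I. e2pi (s (v i) * of_real (u i x)) *
      phi_st (\<tau> * of_real (u i x) - of_real (u i x') - P i) \<tau> (s (v i)))" for x x'
  \<comment> \<open>Periodicity of \<open>G\<close> in both arguments, which allows summation over
    the cell at \<open>y0\<close> instead of the quotient group.\<close>
  have G1: "G (x + (\<Sum>i\<in>I. of_int (k i) *\<^sub>R v i)) x' = G x x'" for x x' k
    unfolding G_def
  proof (rule prod.cong)
    fix i assume i: "i \<in> I"
    let ?z = "\<tau> * of_real (u i x) - of_real (u i x') - P i"
    have "e2pi (s (v i) * of_real (u i x)) * (e2pi (of_int (k i) * s (v i)) *
        phi_st (?z + of_int (k i) * \<tau>) \<tau> (s (v i))) = e2pi (s (v i) * of_real (u i x)) * phi_st ?z \<tau> (s (v i))"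
      unfolding phi_st_plus_tau_int[OF tau] ..
    then show "e2pi (s (v i) * of_real (u i (x + (\<Sum>i\<in>I. of_int (k i) *\<^sub>R v i)))) *
        phi_st (\<tau> * of_real (u i (x + (\<Sum>i\<in>I. of_int (k i) *\<^sub>R v i))) - of_real (u i x') - P i) \<tau> (s (v i)) =
        e2pi (s (v i) * of_real (u i x)) * phi_st ?z \<tau> (s (v i))"
      using i by (simp add: u_add u_comb e2pi_add algebra_simps)
  qed simp
  have G2: "G x (x' + (\<Sum>i\<in>I. of_int (k i) *\<^sub>R v i)) = G x x'" for x x' k
    unfolding G_def
  proof (rule prod.cong)
    fix i assume i: "i \<in> I"
    let ?z = "\<tau> * of_real (u i x) - of_real (u i x') - P i"
    have "phi_st (?z + of_int (- k i)) \<tau> (s (v i)) = phi_st ?z \<tau> (s (v i))"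
      by (rule phi_st_plus_int[OF tau])
    then show "e2pi (s (v i) * of_real (u i x)) *
        phi_st (\<tau> * of_real (u i x) - of_real (u i (x' + (\<Sum>i\<in>I. of_int (k i) *\<^sub>R v i))) - P i) \<tau> (s (v i)) =
        e2pi (s (v i) * of_real (u i x)) * phi_st ?z \<tau> (s (v i))"
      using i by (simp add: u_add u_comb algebra_simps)
  qed simp
  have term_eq: "genus_term \<tau> s w = (\<Sum>x\<in>C. (\<Sum>x'\<in>C. G x x') / N)"
  proof -
    have "genus_term \<tau> s w = 1 / N * (\<Sum>h1\<in>quotient_group L v I. \<Sum>h2\<in>quotient_group L v I.
        G (representative h1) (representative h2))"
      unfolding genus_term_def sum.cartesian_product[symmetric] G_def N_def C_def card_cell[of y0] P_def
      by (simp add: phi_argument_eq cong: prod.cong)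
    also have "\<dots> = 1 / N * (\<Sum>h1\<in>quotient_group L v I. \<Sum>x'\<in>C. G (representative h1) x')"
      unfolding C_def by (intro arg_cong[where f = "\<lambda>z. 1 / N * z"] sum.cong refl sum_quotient_group G2)
    also have "\<dots> = 1 / N * (\<Sum>x\<in>C. \<Sum>x'\<in>C. G x x')"
      unfolding C_def
      by (intro arg_cong[where f = "\<lambda>z. 1 / N * z"] sum_quotient_group sum.cong refl G1)
    finally show ?thesis
      by (simp add: sum_divide_distrib)
  qed
  define E where "E i k = 1 / (1 - e2pi (s (v i) + of_int k * \<tau>))" for i and k :: int
  define A where "A x i k = e2pi (of_int k * (\<tau> * of_real (u i x) - P i)) * E i k" for x i and k :: int
  define K where "K = {k \<in> PiE I (\<lambda>_. UNIV :: int set). \<forall>x\<in>L. (\<Sum>i\<in>I. of_int (k i) * u i x) \<in> \<int>}"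
  have e_s: "(\<Prod>i\<in>I. e2pi (s (v i) * of_real (u i x))) = e2pi (s x)" if "x \<in> span L" for x
    unfolding linear_expand[OF \<open>linear s\<close> that] by (simp add: e2pi_sum scaleR_conv_of_real mult.commute)
  have 1: "((\<lambda>k. e2pi (s x) * (\<Prod>i\<in>I. A x i (k i))) has_sum ((\<Sum>x'\<in>C. G x x') / N)) K" if x: "x \<in> C" for x
  proof -
    have xL: "x \<in> L"
      using x by (simp add: C_def cell_in_L)
    have "((\<lambda>k. e2pi (s x) * (\<Prod>i\<in>I. A x i (k i) * e2pi (- (of_int (k i) * of_real (u i x'))))) has_sum G x x')
        (PiE I (\<lambda>_. UNIV))" for x'
    proof -
      have "((\<lambda>k. \<Prod>i\<in>I. A x i (k i) * e2pi (- (of_int (k i) * of_real (u i x')))) has_sum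
          (\<Prod>i\<in>I. phi_st (\<tau> * of_real (u i x) - of_real (u i x') - P i) \<tau> (s (v i)))) (PiE I (\<lambda>_. UNIV))"
      proof (rule has_sum_prod_PiE[OF finite_I])
        fix i assume i: "i \<in> I"
        let ?z = "\<tau> * of_real (u i x) - of_real (u i x') - P i"
        have "u i y0 = u i (snd w) / Im \<tau>"
          using i by (simp add: y0_def u_scale divide_inverse mult.commute)
        \<comment> \<open>This formula dictates \<open>y0\<close>: the strip condition becomes 0 <
          u_i(x - y0) < 1. Membership in the cell gives it except for strictness on the left, which
          is genericity.\<close>
        then have Im: "Im ?z = Im \<tau> * u i (x - y0)"
          using tau i by (simp add: P_def pairing_complex_def u_diff field_simps)
        have "0 < u i (x - y0)" "u i (x - y0) < 1"
          using x i generic[OF xL i] by (auto simp: C_def cell_def less_le y0_def)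
        then have "0 < Im ?z" "Im ?z < Im \<tau>"
          unfolding Im using tau by auto
        then have "((\<lambda>k::int. e2pi (of_int k * ?z) / (1 - e2pi (s (v i) + of_int k * \<tau>))) has_sum
            phi_st ?z \<tau> (s (v i))) UNIV"
          by (rule phi_st_kronecker[OF tau sigma[OF i]])
        moreover have "e2pi (of_int k * ?z) / (1 - e2pi (s (v i) + of_int k * \<tau>)) =
            A x i k * e2pi (- (of_int k * of_real (u i x')))" for k :: int
        proof -
          have *: "of_int k * ?z = of_int k * (\<tau> * of_real (u i x) - P i) + - (of_int k * of_real (u i x'))"
            by (simp add: algebra_simps)
          show ?thesis
            unfolding A_def E_def * e2pi_add by simp
        qed
        ultimately show "((\<lambda>k. A x i k * e2pi (- (of_int k * of_real (u i x')))) has_sum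
            phi_st ?z \<tau> (s (v i))) UNIV"
          by simp
      qed
      then show ?thesis
        unfolding G_def prod.distrib e_s[OF L_span[OF xL]] by (rule has_sum_cmult_right)
    qed
    then have "((\<lambda>k. (\<Sum>x'\<in>C. e2pi (s x) * (\<Prod>i\<in>I. A x i (k i) * e2pi (- (of_int (k i) * of_real (u i x'))))) / N)
        has_sum ((\<Sum>x'\<in>C. G x x') / N)) (PiE I (\<lambda>_. UNIV))"
      using finite_cell[OF y0] by (intro has_sum_divide_const has_sum_sum) (auto simp: C_def)
    \<comment> \<open>Only the characters e(-k_i u_i(x')) depend on \<open>x'\<close>; their sum is
      \<open>N\<close> or 0, and \<open>N\<close> cancels the order of the group.\<close>
    moreover have "(\<Sum>x'\<in>C. e2pi (s x) * (\<Prod>i\<in>I. A x i (k i) * e2pi (- (of_int (k i) * of_real (u i x'))))) / N =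
        (if k \<in> K then e2pi (s x) * (\<Prod>i\<in>I. A x i (k i)) else 0)" if k: "k \<in> PiE I (\<lambda>_. UNIV)" for k
    proof -
      define f where "f y = (\<Sum>i\<in>I. of_int (k i) * u i y)" for y
      have f: "linear f"
        unfolding f_def
        by (rule linearI) (simp_all add: linear_add[OF linear_u] linear_scale[OF linear_u]
            ring_distribs sum.distrib sum_distrib_left mult_ac)
      have fv: "f (v j) = of_int (k j)" if j: "j \<in> I" for j
      proof -
        have "f (v j) = (\<Sum>i\<in>I. if i = j then of_int (k i) else 0)"
          using j unfolding f_def by (intro sum.cong) (auto simp: u_v)
        then show ?thesis
          using j finite_I by simp
      qed
      have "(\<Sum>x'\<in>C. e2pi (s x) * (\<Prod>i\<in>I. A x i (k i) * e2pi (- (of_int (k i) * of_real (u i x'))))) =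
          e2pi (s x) * (\<Prod>i\<in>I. A x i (k i)) * (\<Sum>x'\<in>C. e2pi (- of_real (f x')))"
        by (simp add: prod.distrib f_def sum_distrib_left e2pi_sum mult_ac flip: sum_negf)
      also have "(\<Sum>x'\<in>C. e2pi (- of_real (f x'))) = (if k \<in> K then N else 0)"
        using character_sum[OF f, of y0] fv k unfolding C_def N_def K_def by (simp add: f_def)
      finally show ?thesis
        using N by simp
    qed
    ultimately have "((\<lambda>k. if k \<in> K then e2pi (s x) * (\<Prod>i\<in>I. A x i (k i)) else 0)
        has_sum ((\<Sum>x'\<in>C. G x x') / N)) (PiE I (\<lambda>_. UNIV))"
      by (simp cong: has_sum_cong)
    then show ?thesis
      by (rule has_sum_cong_neutral[THEN iffD1, rotated -1]) (auto simp: K_def)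
  qed
  have "((\<lambda>k. \<Sum>x\<in>C. e2pi (s x) * (\<Prod>i\<in>I. A x i (k i))) has_sum genus_term \<tau> s w) K"
    unfolding term_eq using finite_cell[OF y0] 1 by (intro has_sum_sum) (auto simp: C_def)
  then have "((\<lambda>m. \<Sum>x\<in>C. e2pi (s x) * (\<Prod>i\<in>I. A x i ((\<lambda>i\<in>I. \<lfloor>m \<bullet> v i\<rfloor>) i))) has_sum genus_term \<tau> s w)
      (dual_lattice L)"
    using has_sum_reindex_bij_betw[OF dual_lattice_bij,
        of "\<lambda>k. \<Sum>x\<in>C. e2pi (s x) * (\<Prod>i\<in>I. A x i (k i))" "genus_term \<tau> s w"]
    unfolding K_def by simp
  moreover have "(\<Sum>x\<in>C. e2pi (s x) * (\<Prod>i\<in>I. A x i ((\<lambda>i\<in>I. \<lfloor>m \<bullet> v i\<rfloor>) i))) = dual_term \<tau> s w m"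
    if m: "m \<in> dual_lattice L" for m
  proof -
    have fl: "of_int \<lfloor>m \<bullet> v i\<rfloor> = complex_of_real (m \<bullet> v i)" if "i \<in> I" for i
    proof -
      have "m \<bullet> v i \<in> \<int>"
        using that m v_in_L by (simp add: dual_lattice_def)
      then show ?thesis
        by (auto elim: Ints_cases)
    qed
    \<comment> \<open>With k_i = m \<bullet> v_i the exponents combine by linearity: \<Sum> (m
      \<bullet> v_i) u_i is the functional m itself.\<close>
    have "(\<Prod>i\<in>I. A x i ((\<lambda>i\<in>I. \<lfloor>m \<bullet> v i\<rfloor>) i)) =
        e2pi (- pairing_complex (\<lambda>y. m \<bullet> y) w) * e2pi (\<tau> * of_real (m \<bullet> x)) /
        (\<Prod>i\<in>I. 1 - e2pi (s (v i) + \<tau> * of_real (m \<bullet> v i)))" if x: "x \<in> C" for x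
    proof -
      have xs: "x \<in> span L"
        using x by (simp add: C_def cell_in_L L_span)
      have "(\<Prod>i\<in>I. A x i ((\<lambda>i\<in>I. \<lfloor>m \<bullet> v i\<rfloor>) i)) =
          (\<Prod>i\<in>I. e2pi (of_real (m \<bullet> v i) * (\<tau> * of_real (u i x) - P i)) /
            (1 - e2pi (s (v i) + \<tau> * of_real (m \<bullet> v i))))"
        by (rule prod.cong) (simp_all add: A_def E_def fl mult.commute)
      also have "\<dots> = e2pi (\<Sum>i\<in>I. of_real (m \<bullet> v i) * (\<tau> * of_real (u i x) - P i)) /
          (\<Prod>i\<in>I. 1 - e2pi (s (v i) + \<tau> * of_real (m \<bullet> v i)))"
        by (simp add: prod_dividef e2pi_sum)
      also have "(\<Sum>i\<in>I. of_real (m \<bullet> v i) * (\<tau> * of_real (u i x) - P i)) =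
          \<tau> * of_real (\<Sum>i\<in>I. u i x * (m \<bullet> v i)) - (\<Sum>i\<in>I. of_real (m \<bullet> v i) * P i)"
        by (simp add: right_diff_distrib sum_subtractf sum_distrib_left mult_ac)
      also have "(\<Sum>i\<in>I. u i x * (m \<bullet> v i)) = m \<bullet> x"
        using linear_expand[of "\<lambda>y. m \<bullet> y", OF _ xs]
        by (simp add: bounded_linear.linear bounded_linear_inner_right)
      also have "(\<Sum>i\<in>I. of_real (m \<bullet> v i) * P i) = pairing_complex (\<lambda>y. m \<bullet> y) w"
        unfolding P_def by (rule pairing_inner[OF w])
      finally show ?thesis
        by (simp add: e2pi_diff e2pi_minus divide_inverse mult_ac)
    qed
    then have "(\<Sum>x\<in>C. e2pi (s x) * (\<Prod>i\<in>I. A x i ((\<lambda>i\<in>I. \<lfloor>m \<bullet> v i\<rfloor>) i))) =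
        (\<Sum>x\<in>C. e2pi (- pairing_complex (\<lambda>y. m \<bullet> y) w) * (e2pi (s x + \<tau> * of_real (m \<bullet> x)) /
        (\<Prod>i\<in>I. 1 - e2pi (s (v i) + \<tau> * of_real (m \<bullet> v i)))))"
      by (intro sum.cong) (simp_all add: e2pi_add mult_ac)
    also have "\<dots> = dual_term \<tau> s w m"
      unfolding dual_term_def cone_series_def C_def y0_def
      by (simp only: sum_distrib_left sum_divide_distrib)
    finally show ?thesis .
  qed
  ultimately show ?thesis
    by (simp cong: has_sum_cong)
qed

end

section \<open>Simplicial cones and their faces\<close>

lemma convex_cone_hull_image:
  fixes v :: "'v \<Rightarrow> 'a::euclidean_space"
  assumes "finite I"
  shows "convex_cone hull (v ` I) = {\<Sum>i\<in>I. c i *\<^sub>R v i | c. \<forall>i\<in>I. 0 \<le> c i}" (is "_ = ?R")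
proof
  show "convex_cone hull (v ` I) \<subseteq> ?R"
  proof (rule hull_minimal)
    show "v ` I \<subseteq> ?R"
    proof
      fix y assume "y \<in> v ` I"
      then obtain j where j: "j \<in> I" "y = v j"
        by auto
      have "(\<Sum>i\<in>I. (if i = j then 1 else 0) *\<^sub>R v i) = (\<Sum>i\<in>I. if i = j then v i else 0)"
        by (intro sum.cong) auto
      then have "y = (\<Sum>i\<in>I. (if i = j then 1 else 0) *\<^sub>R v i)"
        using j assms by simp
      then show "y \<in> ?R"
        by (auto intro!: exI[of _ "\<lambda>i. if i = j then 1 else 0"])
    qed
    show "convex_cone ?R"
      unfolding convex_cone_iff
    proof (intro conjI ballI allI impI)
      show "0 \<in> ?R"
        by (auto intro!: exI[of _ "\<lambda>_. 0"])
    next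
      fix x y assume "x \<in> ?R" "y \<in> ?R"
      then obtain c c' where "x = (\<Sum>i\<in>I. c i *\<^sub>R v i)" "y = (\<Sum>i\<in>I. c' i *\<^sub>R v i)"
        "\<forall>i\<in>I. 0 \<le> c i" "\<forall>i\<in>I. 0 \<le> c' i"
        by auto
      then have "x + y = (\<Sum>i\<in>I. (c i + c' i) *\<^sub>R v i)" "\<forall>i\<in>I. 0 \<le> c i + c' i"
        by (simp_all add: scaleR_add_left sum.distrib)
      then show "x + y \<in> ?R"
        by (intro CollectI exI[of _ "\<lambda>i. c i + c' i"]) simp
    next
      fix x and r :: real assume "x \<in> ?R" "0 \<le> r"
      then obtain c where "x = (\<Sum>i\<in>I. c i *\<^sub>R v i)" "\<forall>i\<in>I. 0 \<le> c i"
        by auto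
      then have "r *\<^sub>R x = (\<Sum>i\<in>I. (r * c i) *\<^sub>R v i)" "\<forall>i\<in>I. 0 \<le> r * c i"
        using \<open>0 \<le> r\<close> by (simp_all add: scaleR_sum_right)
      then show "r *\<^sub>R x \<in> ?R"
        by (intro CollectI exI[of _ "\<lambda>i. r * c i"]) simp
    qed
  qed
  have "(\<Sum>i\<in>J. c i *\<^sub>R v i) \<in> convex_cone hull (v ` I)" if "J \<subseteq> I" "\<forall>i\<in>I. 0 \<le> c i" for c J
    using finite_subset[OF that(1) assms] that
  proof (induction J)
    case (insert j J)
    then show ?case
      by (simp add: convex_cone_hull_add convex_cone_hull_mul hull_inc)
  qed (simp add: convex_cone_hull_contains_0)
  then show "?R \<subseteq> convex_cone hull (v ` I)"
    by blast
qed

lemma span_convex_cone_hull: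
  fixes S :: "'a::euclidean_space set"
  shows "span (convex_cone hull S) = span S"
proof
  show "span (convex_cone hull S) \<subseteq> span S"
    by (intro span_minimal subspace_span hull_minimal span_superset convex_cone_span)
  show "span S \<subseteq> span (convex_cone hull S)"
    by (intro span_mono hull_subset)
qed

text \<open>The coordinates other than that of \<open>s\<close> are nonnegative on the cone and
  vanish together only on this ray. At an inner point of a segment they are positive combinations of
  the values at the ends, so they vanish at the ends too.\<close>

lemma ray_face_of_simplicial_cone:
  fixes S :: "'a::euclidean_space set"
  assumes S: "independent S" and s: "s \<in> S"
  shows "{t *\<^sub>R s | t. 0 \<le> t} \<in> cone_faces (convex_cone hull S)"
proof -
  have fin: "finite S"
    using S by (rule independent_imp_finite)
  have hull: "convex_cone hull S = {\<Sum>b\<in>S. c b *\<^sub>R b | c. \<forall>b\<in>S. 0 \<le> c b}"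
    using convex_cone_hull_image[OF fin, of id] by simp
  define f where "f b = dual_basis id S b" for b
  have f: "linear (f b)" "f b b' = (if b' = b then 1 else 0)" if "b \<in> S" "b' \<in> S" for b b'
    using dual_basis(1)[of id S b] dual_basis(2)[of id S b b'] S that by (auto simp: f_def)
  have fsum: "f b (\<Sum>b'\<in>S. c b' *\<^sub>R b') = c b" if b: "b \<in> S" for b and c
  proof -
    have "f b (\<Sum>b'\<in>S. c b' *\<^sub>R b') = (\<Sum>b'\<in>S. c b' * f b b')"
      by (simp add: linear_sum[OF f(1)[OF b b]] linear_scale[OF f(1)[OF b b]])
    also have "\<dots> = (\<Sum>b'\<in>S. if b' = b then c b' else 0)"
      using f(2)[OF b] by (intro sum.cong) auto
    finally show ?thesis
      using b fin by simp
  qed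
  have mem: "x \<in> {t *\<^sub>R s | t. 0 \<le> t}"
    if x: "x \<in> convex_cone hull S" and x0: "\<And>b. b \<in> S \<Longrightarrow> b \<noteq> s \<Longrightarrow> f b x = 0" for x
  proof -
    obtain c where c: "x = (\<Sum>b\<in>S. c b *\<^sub>R b)" "\<forall>b\<in>S. 0 \<le> c b"
      using x unfolding hull by blast
    have "x = (\<Sum>b\<in>S. if b = s then c b *\<^sub>R b else 0)"
      unfolding c(1) using x0 fsum[of _ c] c(1) by (intro sum.cong) auto
    then have "x = c s *\<^sub>R s"
      using s fin by simp
    then show ?thesis
      using c(2) s by blast
  qed
  have nonneg: "0 \<le> f b x" if "x \<in> convex_cone hull S" "b \<in> S" for b x
    using that fsum unfolding hull by auto
  have "{t *\<^sub>R s | t. 0 \<le> t} face_of convex_cone hull S"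
    unfolding face_of_def
  proof (intro conjI ballI impI)
    show "{t *\<^sub>R s | t. 0 \<le> t} \<subseteq> convex_cone hull S"
      using s by (auto simp: convex_cone_hull_mul hull_inc)
    have "{t *\<^sub>R s | t. 0 \<le> t} = convex_cone hull {s}"
      using convex_cone_hull_image[of "{s}" id] by auto
    then show "convex {t *\<^sub>R s | t. 0 \<le> t}"
      using convex_convex_cone_hull by metis
    fix a b x assume ab: "a \<in> convex_cone hull S" "b \<in> convex_cone hull S"
      and x: "x \<in> {t *\<^sub>R s | t. 0 \<le> t}" "x \<in> open_segment a b"
    obtain r where r: "0 < r" "r < 1" "x = (1 - r) *\<^sub>R a + r *\<^sub>R b"
      using x(2) by (auto simp: in_segment)
    have "f c a = 0 \<and> f c b = 0" if c: "c \<in> S" "c \<noteq> s" for c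
    proof -
      have "f c x = 0"
        using x(1) f[OF c(1) s] c(2) by (auto simp: linear_scale)
      then have "(1 - r) * f c a + r * f c b = 0"
        using f(1)[OF c(1) s] by (simp add: r(3) linear_add linear_scale)
      moreover have "0 \<le> (1 - r) * f c a" "0 \<le> r * f c b"
        using nonneg[OF ab(1) c(1)] nonneg[OF ab(2) c(1)] r by auto
      ultimately have "(1 - r) * f c a = 0" "r * f c b = 0"
        by linarith+
      then show ?thesis
        using r by auto
    qed
    then show "a \<in> {t *\<^sub>R s | t. 0 \<le> t}" "b \<in> {t *\<^sub>R s | t. 0 \<le> t}"
      using mem ab by blast+
  qed
  moreover have "0 *\<^sub>R s \<in> {t *\<^sub>R s | t. 0 \<le> t}"
    by blast
  ultimately show ?thesis
    by (auto simp: cone_faces_def)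
qed

context lattice_frame
begin

lemma cone_hull_eq: "convex_cone hull (v ` I) = {y \<in> span L. \<forall>i\<in>I. 0 \<le> u i y}"
proof (intro equalityI subsetI)
  fix y assume "y \<in> convex_cone hull (v ` I)"
  then obtain c where c: "y = (\<Sum>i\<in>I. c i *\<^sub>R v i)" "\<forall>i\<in>I. 0 \<le> c i"
    unfolding convex_cone_hull_image[OF finite_I] by auto
  have "y \<in> span L"
    unfolding c(1) using v_in_L by (intro span_sum span_scale L_span)
  then show "y \<in> {y \<in> span L. \<forall>i\<in>I. 0 \<le> u i y}"
    using c by (simp add: u_comb)
next
  fix y assume "y \<in> {y \<in> span L. \<forall>i\<in>I. 0 \<le> u i y}"
  then have "y = (\<Sum>i\<in>I. u i y *\<^sub>R v i)" "\<forall>i\<in>I. 0 \<le> u i y"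
    using expand by auto
  then show "y \<in> convex_cone hull (v ` I)"
    unfolding convex_cone_hull_image[OF finite_I] by (intro CollectI exI[of _ "\<lambda>i. u i y"] conjI)
qed

text \<open>A segment from any point \<open>a\<close> of the cone to \<open>p\<close> can be
  prolonged a little beyond \<open>p\<close> inside the cone; then \<open>p\<close> lies strictly
  between \<open>a\<close> and another point, and the face contains \<open>a\<close>.\<close>

lemma face_containing_interior:
  assumes F: "F face_of convex_cone hull (v ` I)" and p: "p \<in> F" "\<And>i. i \<in> I \<Longrightarrow> 0 < u i p"
  shows "F = convex_cone hull (v ` I)"
proof
  show "F \<subseteq> convex_cone hull (v ` I)"
    using F by (rule face_of_imp_subset)
  then have pC: "p \<in> convex_cone hull (v ` I)"
    using p(1) by blast
  show "convex_cone hull (v ` I) \<subseteq> F"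
  proof
    fix a assume a: "a \<in> convex_cone hull (v ` I)"
    show "a \<in> F"
    proof (cases "a = p")
      case False
      \<comment> \<open>Small enough that e u_i(a) \<le> u_i(p) for all \<open>i\<close> at once,
        which keeps all coordinates of \<open>b\<close> nonnegative.\<close>
      define e where "e = 1 / (1 + (\<Sum>i\<in>I. u i a / u i p))"
      have ua: "0 \<le> u i a" if "i \<in> I" for i
        using a that unfolding cone_hull_eq by simp
      have nn: "0 \<le> (\<Sum>i\<in>I. u i a / u i p)"
        using ua p(2) by (intro sum_nonneg) (simp add: less_imp_le)
      then have e: "0 < e"
        by (simp add: e_def)
      define b where "b = p + e *\<^sub>R (p - a)"
      have "0 \<le> u i b" if i: "i \<in> I" for i
      proof -
        have "u i a / u i p \<le> (\<Sum>i\<in>I. u i a / u i p)"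
          using ua p(2) finite_I i by (intro member_le_sum) (auto simp: less_imp_le)
        then have "u i a \<le> u i p * (1 + (\<Sum>i\<in>I. u i a / u i p))"
          using p(2)[OF i] by (simp add: field_simps)
        then have "e * u i a \<le> u i p"
          using nn by (simp add: e_def field_simps)
        moreover have "0 \<le> e * u i p"
          using e p(2)[OF i] by simp
        ultimately show ?thesis
          using linear_u[OF i] by (simp add: b_def linear_add linear_scale linear_diff right_diff_distrib)
      qed
      moreover have "b \<in> span L"
        using a pC unfolding b_def cone_hull_eq by (intro span_add span_scale span_diff) auto
      ultimately have bC: "b \<in> convex_cone hull (v ` I)"
        by (simp add: cone_hull_eq)
      have "p = (1 - 1 / (1 + e)) *\<^sub>R a + (1 / (1 + e)) *\<^sub>R b"
      proof -
        have "(1 + e) *\<^sub>R ((1 - 1 / (1 + e)) *\<^sub>R a + (1 / (1 + e)) *\<^sub>R b) = e *\<^sub>R a + b"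
          using e by (simp add: scaleR_add_right field_simps)
        also have "\<dots> = (1 + e) *\<^sub>R p"
          by (simp add: b_def algebra_simps)
        finally show ?thesis
          using e by (metis add_pos_pos less_irrefl scaleR_cancel_left zero_less_one)
      qed
      moreover have "a \<noteq> b"
      proof
        assume "a = b"
        then have "(1 + e) *\<^sub>R (p - a) = 0"
          by (simp add: b_def algebra_simps)
        then show False
          using e False by simp
      qed
      ultimately have "p \<in> open_segment a b"
        unfolding in_segment using e by (intro conjI exI[of _ "1 / (1 + e)"]) auto
      then show ?thesis
        using F a bC p(1) unfolding face_of_def by blast
    qed (use p in simp)
  qed
qed

end

section \<open>Triangulations\<close>

locale fan_triangulation =
  fixes n :: nat and L :: "'a::euclidean_space set"
    and \<Delta> :: "('s, 'a) multi_fan" and v :: "'s \<Rightarrow> 'a"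
    and \<Delta>' :: "('v set, 'a) multi_fan" and \<rho> :: "'v set \<Rightarrow> 's" and \<kappa> :: "'s \<Rightarrow> 'v set"
  assumes lattice: "is_lattice n L"
    and multi_fan: "is_multi_fan L \<Delta>"
    and edge_vectors: "is_edge_vectors L \<Delta> v"
    and triangulation: "is_triangulation n L \<Delta> \<Delta>' \<rho> \<kappa>"
begin

abbreviation vv where "vv \<equiv> transport \<Delta> \<kappa> v"
text \<open>Undoes \<open>\<kappa>\<close> on the level of vertices: \<open>\<kappa>\<close> takes
  singletons as values.\<close>

definition edge where "edge x = the_inv_into (stratum \<Delta> 1) \<kappa> {x}"

lemma simplicial: "is_simplicial_multi_fan n L \<Delta>'"
  using triangulation by (simp add: is_triangulation_def)

lemma multi_fan': "is_multi_fan L \<Delta>'"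
  using simplicial by (simp add: is_simplicial_multi_fan_def)

lemma finite_elts': "finite (elts \<Delta>')" and finite_elts: "finite (elts \<Delta>)"
  using multi_fan multi_fan' by (simp_all add: is_multi_fan_def)

lemma finite_stratum: "finite (stratum \<Delta> k)" and finite_stratum': "finite (stratum \<Delta>' k)"
  using finite_elts finite_elts' by (simp_all add: stratum_def)

lemma stratum_elts: "K \<in> stratum \<Delta> k \<Longrightarrow> K \<in> elts \<Delta>"
  and stratum_elts': "K' \<in> stratum \<Delta>' k \<Longrightarrow> K' \<in> elts \<Delta>'"
  by (simp_all add: stratum_def)

lemma simplicial_props:
  "\<forall>J\<in>elts \<Delta>'. finite J \<and> (\<forall>K. K \<subseteq> J \<longrightarrow> K \<in> elts \<Delta>')"
  "\<forall>J\<in>elts \<Delta>'. \<forall>K\<in>elts \<Delta>'. leq \<Delta>' K J \<longleftrightarrow> K \<subseteq> J"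
  "\<forall>J\<in>elts \<Delta>'. simplicial_cone (cone_of \<Delta>' J) \<and> dim (cone_of \<Delta>' J) = card J"
  "\<forall>J\<in>elts \<Delta>'. \<exists>I'\<in>stratum \<Delta>' n. J \<subseteq> I'"
  using simplicial unfolding is_simplicial_multi_fan_def by - (elim conjE, assumption)+

lemma sub_elts': "J \<in> elts \<Delta>' \<Longrightarrow> K \<subseteq> J \<Longrightarrow> K \<in> elts \<Delta>'"
  using simplicial_props(1) by blast

lemma leq_iff': "J \<in> elts \<Delta>' \<Longrightarrow> K \<in> elts \<Delta>' \<Longrightarrow> leq \<Delta>' K J \<longleftrightarrow> K \<subseteq> J"
  using simplicial_props(2) by blast

lemma simplicial_cone': "J \<in> elts \<Delta>' \<Longrightarrow> simplicial_cone (cone_of \<Delta>' J)"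
  and dim_cone': "J \<in> elts \<Delta>' \<Longrightarrow> dim (cone_of \<Delta>' J) = card J"
  using simplicial_props(3) by auto

lemma finite_simplex: "J \<in> elts \<Delta>' \<Longrightarrow> finite J"
  using simplicial_props(1) by auto

lemma in_top_simplex: "J \<in> elts \<Delta>' \<Longrightarrow> \<exists>I'\<in>stratum \<Delta>' n. J \<subseteq> I'"
  using simplicial_props(4) by auto

lemma multi_fan_faces:
  assumes "is_multi_fan L \<Gamma>" "J \<in> elts \<Gamma>"
  shows "bij_betw (cone_of \<Gamma>) {K \<in> elts \<Gamma>. leq \<Gamma> K J} (cone_faces (cone_of \<Gamma> J))"
proof -
  have "\<forall>J\<in>elts \<Gamma>.
        bij_betw (cone_of \<Gamma>) {K \<in> elts \<Gamma>. leq \<Gamma> K J} (cone_faces (cone_of \<Gamma> J)) \<and>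
        (\<forall>K\<in>{K \<in> elts \<Gamma>. leq \<Gamma> K J}. \<forall>K'\<in>{K \<in> elts \<Gamma>. leq \<Gamma> K J}.
           leq \<Gamma> K K' \<longleftrightarrow> cone_of \<Gamma> K \<subseteq> cone_of \<Gamma> K')"
    using assms(1) unfolding is_multi_fan_def by (elim conjE)
  then show ?thesis
    using assms(2) by simp
qed

lemmas bij_faces' = multi_fan_faces[OF multi_fan']
  and bij_faces = multi_fan_faces[OF multi_fan]

lemma leq_face: "J \<in> elts \<Delta> \<Longrightarrow> K \<in> elts \<Delta> \<Longrightarrow> leq \<Delta> K J \<Longrightarrow> cone_of \<Delta> K \<in> cone_faces (cone_of \<Delta> J)"
  using bij_betw_imp_surj_on[OF bij_faces] by blast

lemma leq_refl: "J \<in> elts \<Delta> \<Longrightarrow> leq \<Delta> J J"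
  using multi_fan by (simp add: is_multi_fan_def reflp_on_def)

lemma rational_cone: "J \<in> elts \<Delta> \<Longrightarrow> strongly_convex_rational_cone L (cone_of \<Delta> J)"
  using multi_fan by (simp add: is_multi_fan_def)

lemma triangulation_props:
  "\<rho> \<in> elts \<Delta>' \<rightarrow> elts \<Delta>"
  "\<forall>J\<in>elts \<Delta>'. \<forall>K\<in>elts \<Delta>'. leq \<Delta>' J K \<longrightarrow> leq \<Delta> (\<rho> J) (\<rho> K)"
  "bij_betw \<kappa> (stratum \<Delta> 1) (stratum \<Delta>' 1)"
  "\<forall>i\<in>stratum \<Delta> 1. cone_of \<Delta> i = cone_of \<Delta>' (\<kappa> i) \<and> \<rho> (\<kappa> i) = i"
  "\<forall>J'\<in>elts \<Delta>'. cone_of \<Delta>' J' \<subseteq> cone_of \<Delta> (\<rho> J') \<and>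
     (\<forall>K\<in>elts \<Delta>. cone_of \<Delta>' J' \<subseteq> cone_of \<Delta> K \<and> leq \<Delta> K (\<rho> J') \<longrightarrow> K = \<rho> J')"
  "\<forall>J\<in>elts \<Delta>. inj_on (cone_of \<Delta>') {J' \<in> elts \<Delta>'. leq \<Delta> (\<rho> J') J} \<and>
     is_subdivision L (cone_of \<Delta>' ` {J' \<in> elts \<Delta>'. leq \<Delta> (\<rho> J') J}) (cone_of \<Delta> J)"
  "\<forall>I'\<in>stratum \<Delta>' n. wplus \<Delta>' I' = wplus \<Delta> (\<rho> I') \<and> wminus \<Delta>' I' = wminus \<Delta> (\<rho> I')"
  using triangulation unfolding is_triangulation_def by - (elim conjE, assumption)+

lemma rho_elts: "J' \<in> elts \<Delta>' \<Longrightarrow> \<rho> J' \<in> elts \<Delta>"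
  using triangulation_props(1) by blast

lemma rho_mono: "\<lbrakk>J' \<in> elts \<Delta>'; K' \<in> elts \<Delta>'; J' \<subseteq> K'\<rbrakk> \<Longrightarrow> leq \<Delta> (\<rho> J') (\<rho> K')"
  using triangulation_props(2) leq_iff' by blast

lemmas bij_kappa = triangulation_props(3)

lemma kappa_cone: "i \<in> stratum \<Delta> 1 \<Longrightarrow> cone_of \<Delta>' (\<kappa> i) = cone_of \<Delta> i"
  and rho_kappa: "i \<in> stratum \<Delta> 1 \<Longrightarrow> \<rho> (\<kappa> i) = i"
  using triangulation_props(4) by auto

lemma cone_subset_rho: "J' \<in> elts \<Delta>' \<Longrightarrow> cone_of \<Delta>' J' \<subseteq> cone_of \<Delta> (\<rho> J')"
  using triangulation_props(5) by blast

lemma subdivision: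
  assumes "J \<in> elts \<Delta>"
  shows "inj_on (cone_of \<Delta>') {J' \<in> elts \<Delta>'. leq \<Delta> (\<rho> J') J}"
    and "is_subdivision L (cone_of \<Delta>' ` {J' \<in> elts \<Delta>'. leq \<Delta> (\<rho> J') J}) (cone_of \<Delta> J)"
  using bspec[OF triangulation_props(6) assms] by - (elim conjE, assumption)+

lemma weight_rho: "I' \<in> stratum \<Delta>' n \<Longrightarrow> weight \<Delta>' I' = weight \<Delta> (\<rho> I')"
  using triangulation_props(7) by (simp add: weight_def)

lemma vertex:
  assumes "J \<in> elts \<Delta>'" "x \<in> J"
  shows "edge x \<in> stratum \<Delta> 1" "\<kappa> (edge x) = {x}" "leq \<Delta> (edge x) (\<rho> J)"
    "v (edge x) \<in> L" "v (edge x) \<in> cone_of \<Delta>' {x}" "v (edge x) \<noteq> 0"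
proof -
  have x: "{x} \<in> elts \<Delta>'" "{x} \<in> stratum \<Delta>' 1"
    using sub_elts'[OF assms(1), of "{x}"] assms(2) dim_cone'[of "{x}"] by (auto simp: stratum_def)
  show 1: "edge x \<in> stratum \<Delta> 1" "\<kappa> (edge x) = {x}"
    using x(2) bij_kappa the_inv_into_into[of \<kappa> "stratum \<Delta> 1" "{x}"] f_the_inv_into_f[of \<kappa> "stratum \<Delta> 1" "{x}"]
    by (auto simp: bij_betw_def edge_def)
  show "leq \<Delta> (edge x) (\<rho> J)"
    using rho_mono[OF x(1) assms(1)] assms(2) rho_kappa[OF 1(1)] 1(2) by simp
  show "v (edge x) \<in> L" "v (edge x) \<in> cone_of \<Delta>' {x}" "v (edge x) \<noteq> 0"
    using edge_vectors 1 kappa_cone[OF 1(1)] by (auto simp: is_edge_vectors_def)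
qed

lemma vv_edge: "vv x = v (edge x)"
  by (simp add: transport_def edge_def)

text \<open>The definition gives some independent generators \<open>S\<close> of the cone, unrelated
  to the vertices. Each generator spans a one-dimensional face, hence the cone of a vertex, whose
  edge vector is a positive multiple of the generator; counting makes this matching
  bijective.\<close>

lemma top_simplex:
  assumes I': "I' \<in> stratum \<Delta>' n"
  shows "lattice_frame n L I' vv" and "convex_cone hull (vv ` I') = cone_of \<Delta>' I'"
proof -
  have el: "I' \<in> elts \<Delta>'" and dimI: "dim (cone_of \<Delta>' I') = n" and cardI: "card I' = n"
    using I' dim_cone'[of I'] by (auto simp: stratum_def)
  have finI: "finite I'"
    using finite_simplex[OF el] .
  obtain S where S: "independent S" "cone_of \<Delta>' I' = convex_cone hull S"
    using simplicial_cone'[OF el] by (auto simp: simplicial_cone_def)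
  have finS: "finite S"
    using S(1) by (rule independent_imp_finite)
  have cardS: "card S = n"
    using dimI S span_convex_cone_hull[of S] dim_eq_card_independent by (metis dim_span)
  have "\<exists>x\<in>I'. cone_of \<Delta>' {x} = {t *\<^sub>R s | t. 0 \<le> t}" if s: "s \<in> S" for s
  proof -
    have "{t *\<^sub>R s | t. 0 \<le> t} \<in> cone_faces (cone_of \<Delta>' I')"
      unfolding S(2) by (rule ray_face_of_simplicial_cone[OF S(1) s])
    then obtain K where K: "K \<in> elts \<Delta>'" "leq \<Delta>' K I'" "cone_of \<Delta>' K = {t *\<^sub>R s | t. 0 \<le> t}"
      unfolding bij_betw_imp_surj_on[OF bij_faces'[OF el], symmetric] by auto
    have "s \<noteq> 0"
      using S(1) s dependent_zero by blast
    moreover have "span {t *\<^sub>R s | t. 0 \<le> t} = span {s}"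
    proof -
      have "{t *\<^sub>R s | t. 0 \<le> t} = convex_cone hull {s}"
        using convex_cone_hull_image[of "{s}" id] by auto
      then show ?thesis
        using span_convex_cone_hull by metis
    qed
    ultimately have "dim (span {t *\<^sub>R s | t. 0 \<le> t}) = 1"
      by (simp only: dim_span) (simp add: dim_singleton)
    then have "card K = 1"
      using dim_cone'[OF K(1)] K(3) by simp
    then obtain x where x: "K = {x}"
      by (auto simp: card_1_singleton_iff)
    then show ?thesis
      using K leq_iff'[OF el K(1)] by auto
  qed
  then have "\<forall>s\<in>S. \<exists>x. x \<in> I' \<and> cone_of \<Delta>' {x} = {t *\<^sub>R s | t. 0 \<le> t}"
    by blast
  from bchoice[OF this] obtain f
    where f_all: "\<forall>s\<in>S. f s \<in> I' \<and> cone_of \<Delta>' {f s} = {t *\<^sub>R s | t. 0 \<le> t}"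
    by (elim exE)
  have f: "f s \<in> I'" "cone_of \<Delta>' {f s} = {t *\<^sub>R s | t. 0 \<le> t}" if "s \<in> S" for s
    using bspec[OF f_all that] by - (elim conjE, assumption)+
  have "\<exists>t>0. vv (f s) = t *\<^sub>R s" if s: "s \<in> S" for s
  proof -
    obtain t where "0 \<le> t" "vv (f s) = t *\<^sub>R s"
      using vertex(5)[OF el f(1)[OF s]] f(2)[OF s] vv_edge by auto
    moreover have "t \<noteq> 0"
      using vertex(6)[OF el f(1)[OF s]] calculation vv_edge by auto
    ultimately show ?thesis
      by (metis less_le)
  qed
  then have "\<forall>s\<in>S. \<exists>t. 0 < t \<and> vv (f s) = t *\<^sub>R s"
    by simp
  from bchoice[OF this] obtain t where t_all: "\<forall>s\<in>S. 0 < t s \<and> vv (f s) = t s *\<^sub>R s"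
    by (elim exE)
  have t: "0 < t s" "vv (f s) = t s *\<^sub>R s" if "s \<in> S" for s
    using bspec[OF t_all that] by - (elim conjE, assumption)+
  have s_eq: "s = (1 / t s) *\<^sub>R vv (f s)" if "s \<in> S" for s
    using t[OF that] by simp
  have "inj_on f S"
  \<comment> \<open>Two generators with the same vertex would both be proportional to its edge
    vector.\<close>
  proof (rule inj_onI, rule ccontr)
    fix s s' assume s: "s \<in> S" "s' \<in> S" "f s = f s'" "s \<noteq> s'"
    then have "s = (1 / t s) *\<^sub>R t s' *\<^sub>R s'"
      using s_eq[OF s(1)] t(2)[OF s(2)] by simp
    then have "s \<in> span {s'}"
      by (metis span_base span_scale singletonI)
    moreover have "span {s'} \<subseteq> span (S - {s})"
      using s by (intro span_mono) auto
    ultimately show False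
      using S(1) s(1) unfolding dependent_def by blast
  qed
  then have fS: "f ` S = I'"
    using f(1) finI cardS cardI by (intro card_subset_eq) (auto simp: card_image)
  have span_eq: "span (vv ` I') = span S"
  proof
    show "span (vv ` I') \<subseteq> span S"
      using t(2) by (intro span_minimal subspace_span) (auto simp: fS[symmetric] span_scale span_base)
    show "span S \<subseteq> span (vv ` I')"
    proof (intro span_minimal subspace_span subsetI)
      fix s assume s: "s \<in> S"
      show "s \<in> span (vv ` I')"
        by (subst s_eq[OF s]) (use f(1)[OF s] in \<open>simp add: span_scale span_base\<close>)
    qed
  qed
  have dimv: "dim (vv ` I') = n"
    using span_eq S(1) cardS dim_eq_card_independent by (metis dim_span)
  \<comment> \<open>At most \<open>n\<close> vectors spanning a space of dimension \<open>n\<close>: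
    they must be distinct and independent.\<close>
  have "card (vv ` I') = n"
    using dimv dim_le_card[of "vv ` I'" "vv ` I'"] card_image_le[OF finI, of vv] finI cardI
    by (simp add: span_superset)
  then have inj: "inj_on vv I'" and ind: "independent (vv ` I')"
    using finI cardI dimv span_superset[of "vv ` I'"] card_le_dim_spanning[of "vv ` I'" "vv ` I'"]
    by (auto intro!: eq_card_imp_inj_on)
  have inL: "vv x \<in> L" if "x \<in> I'" for x
    using vertex(4)[OF el that] by (simp add: vv_edge)
  have "span (vv ` I') = span L"
    using inL dimv lattice_dim[OF lattice]
    by (intro subspace_dim_equal subspace_span span_mono) (auto simp: dim_span)
  then show "lattice_frame n L I' vv"
    using lattice finI inj ind inL by unfold_locales auto
  show "convex_cone hull (vv ` I') = cone_of \<Delta>' I'"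
    unfolding S(2)
  proof
    show "convex_cone hull (vv ` I') \<subseteq> convex_cone hull S"
    proof (rule hull_minimal)
      show "vv ` I' \<subseteq> convex_cone hull S"
        using t by (auto simp: fS[symmetric] convex_cone_hull_mul hull_inc less_imp_le)
    qed (rule convex_cone_convex_cone_hull)
    show "convex_cone hull S \<subseteq> convex_cone hull (vv ` I')"
    proof (rule hull_minimal)
      show "S \<subseteq> convex_cone hull (vv ` I')"
      proof
        fix s assume s: "s \<in> S"
        show "s \<in> convex_cone hull (vv ` I')"
          by (subst s_eq[OF s]) (use f(1)[OF s] t(1)[OF s] in \<open>simp add: convex_cone_hull_mul hull_inc\<close>)
      qed
    qed (rule convex_cone_convex_cone_hull)
  qed
qed

text \<open>The dimension of C(\<rho>(I')) is squeezed between that of C'(I'), which is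
  \<open>n\<close>, and the rank of \<open>L\<close>.\<close>

lemma rho_top:
  assumes I': "I' \<in> stratum \<Delta>' n"
  shows "\<rho> I' \<in> stratum \<Delta> n"
proof -
  have el: "I' \<in> elts \<Delta>'"
    using I' by (rule stratum_elts')
  obtain S where "S \<subseteq> L" "cone_of \<Delta> (\<rho> I') = convex_cone hull S"
    using rational_cone[OF rho_elts[OF el]] by (auto simp: strongly_convex_rational_cone_def)
  then have "dim (cone_of \<Delta> (\<rho> I')) \<le> n"
    using span_convex_cone_hull[of S] dim_subset[of S L] lattice_dim[OF lattice] by (metis dim_span)
  moreover have "dim (cone_of \<Delta>' I') \<le> dim (cone_of \<Delta> (\<rho> I'))"
    using cone_subset_rho[OF el] by (rule dim_subset)
  ultimately show ?thesis
    using I' rho_elts[OF el] by (simp add: stratum_def)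
qed

section \<open>Decomposition of a shifted cone along a triangulation\<close>

definition tops where "tops I = {I' \<in> stratum \<Delta>' n. \<rho> I' = I}"

definition generic where
  "generic y0 \<longleftrightarrow> (\<forall>I'\<in>stratum \<Delta>' n. \<forall>i\<in>I'. \<forall>x\<in>L. dual_basis vv I' i (x - y0) \<noteq> 0)"

text \<open>A proper face has smaller affine dimension, which for cones is \<open>dim\<close>
  because they contain 0. Below \<open>I\<close> the cone determines the element.\<close>

lemma top_unique:
  assumes "I \<in> stratum \<Delta> n" "K \<in> stratum \<Delta> n" "leq \<Delta> K I"
  shows "K = I"
proof -
  have el: "I \<in> elts \<Delta>" "K \<in> elts \<Delta>"
    using assms stratum_elts by auto
  have face: "cone_of \<Delta> K face_of cone_of \<Delta> I"
    using leq_face[OF el assms(3)] by (simp add: cone_faces_def)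
  have "convex (cone_of \<Delta> J) \<and> 0 \<in> cone_of \<Delta> J" if "J \<in> elts \<Delta>" for J
    using rational_cone[OF that] convex_convex_cone_hull convex_cone_hull_contains_0
    by (auto simp: strongly_convex_rational_cone_def)
  then have "cone_of \<Delta> K = cone_of \<Delta> I"
    using face_of_aff_dim_lt[OF _ face] aff_dim_zero[of "cone_of \<Delta> K"] aff_dim_zero[of "cone_of \<Delta> I"]
      assms(1,2) el by (auto simp: stratum_def hull_inc)
  then show ?thesis
    using inj_onD[OF bij_betw_imp_inj_on[OF bij_faces[OF el(1)]], of K I] assms(3) el leq_refl[OF el(1)]
    by simp
qed

text \<open>Genericity puts \<open>x - y0\<close> in the interior of every top-dimensional cone of
  the triangulation that contains it. Lower-dimensional cones then contribute no points, and the
  intersection of two top-dimensional cones, being a face of both, can contain such a point only if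
  the cones coincide.\<close>

lemma cone_decomposition:
  assumes I: "I \<in> stratum \<Delta> n" and y0: "y0 \<in> span L" "generic y0"
  shows "{x \<in> L. x - y0 \<in> cone_of \<Delta> I} =
      (\<Union>I'\<in>tops I. {x \<in> L. \<forall>i\<in>I'. 0 \<le> dual_basis vv I' i (x - y0)})"
    and "\<lbrakk>I1 \<in> tops I; I2 \<in> tops I; I1 \<noteq> I2\<rbrakk> \<Longrightarrow>
      {x \<in> L. \<forall>i\<in>I1. 0 \<le> dual_basis vv I1 i (x - y0)} \<inter>
      {x \<in> L. \<forall>i\<in>I2. 0 \<le> dual_basis vv I2 i (x - y0)} = {}"
proof -
  have elI: "I \<in> elts \<Delta>"
    using I by (rule stratum_elts)
  let ?T = "{J' \<in> elts \<Delta>'. leq \<Delta> (\<rho> J') I}"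
  have cone: "cone_of \<Delta>' I' = {y \<in> span L. \<forall>i\<in>I'. 0 \<le> dual_basis vv I' i y}"
    if "I' \<in> stratum \<Delta>' n" for I'
    using lattice_frame.cone_hull_eq[OF top_simplex(1)[OF that]] top_simplex(2)[OF that]
      lattice_frame.u_def[OF top_simplex(1)[OF that]] by simp
  have xy: "x - y0 \<in> span L" if "x \<in> L" for x
    using span_diff[OF span_base[OF that] y0(1)] .
  have tops_T: "I' \<in> ?T" "I' \<in> stratum \<Delta>' n" "I' \<in> elts \<Delta>'" if "I' \<in> tops I" for I'
    using that leq_refl[OF elI] stratum_elts' by (auto simp: tops_def)
  have interior: "F = cone_of \<Delta>' I'"
    if "I' \<in> stratum \<Delta>' n" "x \<in> L" "x - y0 \<in> F" "F \<in> cone_faces (cone_of \<Delta>' I')" for F I' x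
  proof -
    interpret fr: lattice_frame n L I' vv
      by (rule top_simplex(1)[OF that(1)])
    have F: "F face_of convex_cone hull (vv ` I')"
      using that(4) by (simp add: cone_faces_def top_simplex(2)[OF that(1)])
    have "0 < fr.u i (x - y0)" if i: "i \<in> I'" for i
    proof -
      have "x - y0 \<in> convex_cone hull (vv ` I')"
        using \<open>x - y0 \<in> F\<close> face_of_imp_subset[OF F] by blast
      then have "0 \<le> fr.u i (x - y0)"
        using i by (simp add: fr.cone_hull_eq)
      moreover have "fr.u i (x - y0) \<noteq> 0"
        using y0(2) that i \<open>I' \<in> stratum \<Delta>' n\<close> \<open>x \<in> L\<close> by (simp add: generic_def fr.u_def)
      ultimately show ?thesis
        by simp
    qed
    then show ?thesis
      using fr.face_containing_interior[OF F that(3)] top_simplex(2)[OF that(1)] by simp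
  qed
  show "{x \<in> L. x - y0 \<in> cone_of \<Delta> I} =
      (\<Union>I'\<in>tops I. {x \<in> L. \<forall>i\<in>I'. 0 \<le> dual_basis vv I' i (x - y0)})"
  proof (intro equalityI subsetI)
    fix x assume x: "x \<in> {x \<in> L. x - y0 \<in> cone_of \<Delta> I}"
    have "cone_of \<Delta> I = \<Union> (cone_of \<Delta>' ` ?T)"
      using subdivision(2)[OF elI] by (simp add: is_subdivision_def)
    then obtain J' where J': "J' \<in> elts \<Delta>'" "leq \<Delta> (\<rho> J') I" "x - y0 \<in> cone_of \<Delta>' J'"
      using x by auto
    obtain I' where I': "I' \<in> stratum \<Delta>' n" "J' \<subseteq> I'"
      using in_top_simplex[OF J'(1)] by blast
    have elI': "I' \<in> elts \<Delta>'"
      using I'(1) by (rule stratum_elts')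
    have leqs: "leq \<Delta>' J' I'" "leq \<Delta>' I' I'"
      using leq_iff' J'(1) elI' I'(2) by auto
    \<comment> \<open>The cone that contains the point is a face of a top-dimensional one, so it is
      all of it. This also shows that the top simplex found lies over \<open>I\<close>.\<close>
    have "cone_of \<Delta>' J' \<in> cone_faces (cone_of \<Delta>' I')"
      using bij_faces'[OF elI'] J'(1) leqs unfolding bij_betw_def by blast
    then have "cone_of \<Delta>' J' = cone_of \<Delta>' I'"
      using interior[OF I'(1) _ J'(3)] x by blast
    then have "J' = I'"
      using inj_onD[OF bij_betw_imp_inj_on[OF bij_faces'[OF elI']], of J' I'] J'(1) elI' leqs by simp
    then have "\<rho> I' = I"
      using top_unique[OF I rho_top[OF I'(1)]] J'(2) by simp
    then show "x \<in> (\<Union>I'\<in>tops I. {x \<in> L. \<forall>i\<in>I'. 0 \<le> dual_basis vv I' i (x - y0)})"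
      using x J'(3) I'(1) cone[OF I'(1)] \<open>J' = I'\<close> by (auto simp: tops_def)
  next
    fix x assume "x \<in> (\<Union>I'\<in>tops I. {x \<in> L. \<forall>i\<in>I'. 0 \<le> dual_basis vv I' i (x - y0)})"
    then obtain I' where I': "I' \<in> tops I" "x \<in> L" "\<forall>i\<in>I'. 0 \<le> dual_basis vv I' i (x - y0)"
      by auto
    then have "x - y0 \<in> cone_of \<Delta>' I'"
      using cone[OF tops_T(2)] xy by simp
    then show "x \<in> {x \<in> L. x - y0 \<in> cone_of \<Delta> I}"
      using cone_subset_rho[OF tops_T(3)[OF I'(1)]] I'(1,2) by (auto simp: tops_def)
  qed
  assume I12: "I1 \<in> tops I" "I2 \<in> tops I" "I1 \<noteq> I2"
  show "{x \<in> L. \<forall>i\<in>I1. 0 \<le> dual_basis vv I1 i (x - y0)} \<inter>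
      {x \<in> L. \<forall>i\<in>I2. 0 \<le> dual_basis vv I2 i (x - y0)} = {}"
  proof (rule ccontr)
    assume "\<not> ?thesis"
    then obtain x where x: "x \<in> L" "\<forall>i\<in>I1. 0 \<le> dual_basis vv I1 i (x - y0)"
      "\<forall>i\<in>I2. 0 \<le> dual_basis vv I2 i (x - y0)"
      by auto
    then have "x - y0 \<in> cone_of \<Delta>' I1 \<inter> cone_of \<Delta>' I2"
      using cone[OF tops_T(2)] I12 xy by simp
    moreover have "cone_of \<Delta>' I1 \<inter> cone_of \<Delta>' I2 \<in> cone_faces (cone_of \<Delta>' I1)"
      "cone_of \<Delta>' I1 \<inter> cone_of \<Delta>' I2 \<in> cone_faces (cone_of \<Delta>' I2)"
      using subdivision(2)[OF elI] tops_T(1)[OF I12(1)] tops_T(1)[OF I12(2)]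
      unfolding is_subdivision_def by blast+
    ultimately have "cone_of \<Delta>' I1 = cone_of \<Delta>' I2"
      using interior[OF tops_T(2)[OF I12(1)] x(1)] interior[OF tops_T(2)[OF I12(2)] x(1)] by metis
    then show False
      using inj_onD[OF subdivision(1)[OF elI]] tops_T(1) I12 by blast
  qed
qed

section \<open>Generating function of a whole cone and its continuation\<close>

definition rays where "rays I = {i \<in> stratum \<Delta> 1. leq \<Delta> i I}"

lemma finite_rays: "finite (rays I)"
  using finite_stratum by (simp add: rays_def)

lemma finite_tops: "finite (tops I)"
  using finite_stratum' by (simp add: tops_def)

lemma top_edges:
  assumes "I' \<in> tops I"
  shows "edge ` I' \<subseteq> rays I" "inj_on edge I'"
proof -
  have el: "I' \<in> elts \<Delta>'" "\<rho> I' = I"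
    using assms stratum_elts' by (auto simp: tops_def)
  show "edge ` I' \<subseteq> rays I"
    using vertex[OF el(1)] el(2) by (auto simp: rays_def)
  show "inj_on edge I'"
    using vertex(2)[OF el(1)] by (metis inj_onI singleton_inject)
qed

abbreviation cone_ser where "cone_ser I' \<equiv> lattice_frame.cone_series L I' vv"

lemma cone_series_sum:
  fixes Y :: "'a \<Rightarrow> complex"
  assumes I: "I \<in> stratum \<Delta> n" and y0: "y0 \<in> span L" "generic y0"
    and "linear Y" "\<And>i. i \<in> rays I \<Longrightarrow> Im (Y (v i)) > 0"
  shows "((\<lambda>x. e2pi (Y x)) has_sum (\<Sum>I'\<in>tops I. cone_ser I' y0 Y)) {x \<in> L. x - y0 \<in> cone_of \<Delta> I}"
  unfolding cone_decomposition(1)[OF I y0]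
proof (rule sum_has_sum[OF finite_tops _ cone_decomposition(2)[OF I y0]])
  fix I' assume I': "I' \<in> tops I"
  interpret fr: lattice_frame n L I' vv
    using I' top_simplex(1) by (simp add: tops_def)
  have "Im (Y (vv i)) > 0" if "i \<in> I'" for i
    using assms(5) top_edges(1)[OF I'] that by (auto simp: vv_edge)
  then show "((\<lambda>x. e2pi (Y x)) has_sum cone_ser I' y0 Y) {x \<in> L. \<forall>i\<in>I'. 0 \<le> dual_basis vv I' i (x - y0)}"
    using fr.cone_series_has_sum[OF assms(4) _ y0(1)] by (simp add: fr.u_def)
qed

text \<open>The single series have denominators over different sets of edges, all among the rays of
  \<open>I\<close>. Multiplied by the product over all rays, their sum becomes entire in the
  deformation parameter \<open>l\<close>.\<close>

lemma cone_series_continuation: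
  fixes Y :: "'a \<Rightarrow> complex" and \<psi> :: "'a \<Rightarrow> real"
  shows "\<exists>N. N holomorphic_on UNIV \<and>
    (\<forall>l. (\<forall>i\<in>rays I. e2pi (Y (v i) + l * of_real (\<psi> (v i))) \<noteq> 1) \<longrightarrow>
      (\<Sum>I'\<in>tops I. cone_ser I' y0 (\<lambda>x. Y x + l * of_real (\<psi> x))) *
      (\<Prod>i\<in>rays I. 1 - e2pi (Y (v i) + l * of_real (\<psi> (v i)))) = N l)"
proof -
  let ?f = "\<lambda>l i. 1 - e2pi (Y (v i) + l * of_real (\<psi> (v i)))"
  let ?c = "\<lambda>I'. lattice_frame.cell L I' vv y0"
  define N where "N l = (\<Sum>I'\<in>tops I. (\<Sum>x\<in>?c I'. e2pi (Y x + l * of_real (\<psi> x))) *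
      (\<Prod>i\<in>rays I - edge ` I'. ?f l i))" for l
  have "N holomorphic_on UNIV"
    unfolding N_def by (intro holomorphic_intros)
  moreover have "(\<Sum>I'\<in>tops I. cone_ser I' y0 (\<lambda>x. Y x + l * of_real (\<psi> x))) * (\<Prod>i\<in>rays I. ?f l i) = N l"
    if nz: "\<forall>i\<in>rays I. e2pi (Y (v i) + l * of_real (\<psi> (v i))) \<noteq> 1" for l
  proof -
    have "cone_ser I' y0 (\<lambda>x. Y x + l * of_real (\<psi> x)) * (\<Prod>i\<in>rays I. ?f l i) =
        (\<Sum>x\<in>?c I'. e2pi (Y x + l * of_real (\<psi> x))) * (\<Prod>i\<in>rays I - edge ` I'. ?f l i)"
      if I': "I' \<in> tops I" for I'
    proof -
      interpret fr: lattice_frame n L I' vv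
        using I' top_simplex(1) by (simp add: tops_def)
      have "(\<Prod>i\<in>rays I. ?f l i) = (\<Prod>i\<in>rays I - edge ` I'. ?f l i) * (\<Prod>i\<in>edge ` I'. ?f l i)"
        using top_edges(1)[OF I'] by (rule prod.subset_diff[OF _ finite_rays])
      moreover have "(\<Prod>i\<in>edge ` I'. ?f l i) = (\<Prod>x\<in>I'. 1 - e2pi (Y (vv x) + l * of_real (\<psi> (vv x))))"
        using top_edges(2)[OF I'] by (simp add: prod.reindex vv_edge)
      moreover have "(\<Prod>i\<in>edge ` I'. ?f l i) \<noteq> 0"
      proof -
        have "finite (edge ` I')"
          using top_edges(1)[OF I'] finite_rays finite_subset by blast
        then show ?thesis
          using nz top_edges(1)[OF I'] by (auto simp: prod_zero_iff)
      qed
      ultimately show ?thesis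
        by (simp add: fr.cone_series_def)
    qed
    then show ?thesis
      unfolding N_def sum_distrib_right by (rule sum.cong[OF refl])
  qed
  ultimately show ?thesis
    by (intro exI[of _ N]) simp
qed

text \<open>A hyperplane separates 0 from the convex hull of the edge vectors. If 0 were in the
  hull, some non-zero multiple of an edge vector and its negative would both lie in the cone,
  against strong convexity.\<close>

lemma strictly_positive_functional:
  assumes I: "I \<in> elts \<Delta>"
  obtains \<psi> :: "'a \<Rightarrow> real" where "linear \<psi>" "\<And>i. i \<in> rays I \<Longrightarrow> 0 < \<psi> (v i)"
proof -
  let ?C = "cone_of \<Delta> I"
  obtain S where S: "?C = convex_cone hull S"
    using rational_cone[OF I] by (auto simp: strongly_convex_rational_cone_def)
  have pointed: "?C \<inter> uminus ` ?C = {0}"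
    using rational_cone[OF I] by (simp add: strongly_convex_rational_cone_def)
  have v: "v i \<in> ?C" "v i \<noteq> 0" if "i \<in> rays I" for i
  proof -
    have i: "i \<in> stratum \<Delta> 1" "leq \<Delta> i I"
      using that by (auto simp: rays_def)
    then have "cone_of \<Delta> i \<subseteq> ?C"
      using leq_face[OF I stratum_elts[OF i(1)] i(2)] by (auto simp: cone_faces_def dest: face_of_imp_subset)
    then show "v i \<in> ?C" "v i \<noteq> 0"
      using edge_vectors i(1) by (auto simp: is_edge_vectors_def)
  qed
  have add: "x + y \<in> ?C" if "x \<in> ?C" "y \<in> ?C" for x y
    using that unfolding S by (rule convex_cone_hull_add)
  have scale: "r *\<^sub>R x \<in> ?C" if "x \<in> ?C" "0 \<le> r" for x r
    using that unfolding S by (rule convex_cone_hull_mul)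
  have zero: "0 \<in> ?C"
    unfolding S by (rule convex_cone_hull_contains_0)
  have "0 \<notin> convex hull (v ` rays I)"
  proof
    assume "0 \<in> convex hull (v ` rays I)"
    then obtain c where c: "\<forall>y\<in>v ` rays I. 0 \<le> c y" "sum c (v ` rays I) = 1" "(\<Sum>y\<in>v ` rays I. c y *\<^sub>R y) = 0"
      using finite_rays by (auto simp: convex_hull_finite)
    obtain y where y: "y \<in> v ` rays I" "c y \<noteq> 0"
      using c(2) by (metis sum.neutral zero_neq_one)
    have "(\<Sum>z\<in>A. c z *\<^sub>R z) \<in> ?C" if "A \<subseteq> v ` rays I" for A
      using finite_subset[OF that finite_imageI[OF finite_rays]] that
    proof (induction A)
      case (insert a A)
      then show ?case
        using add scale v(1) c(1) by auto
    qed (use zero in simp)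
    then have "(\<Sum>z\<in>v ` rays I - {y}. c z *\<^sub>R z) \<in> ?C"
      by blast
    moreover have "(\<Sum>z\<in>v ` rays I - {y}. c z *\<^sub>R z) = - (c y *\<^sub>R y)"
      using c(3) y(1) finite_rays by (simp add: sum_diff1)
    moreover have "c y *\<^sub>R y \<in> ?C"
      using y c(1) v(1) scale by auto
    ultimately have "c y *\<^sub>R y \<in> ?C \<inter> uminus ` ?C"
      by (auto simp: image_iff intro!: bexI[of _ "- (c y *\<^sub>R y)"])
    then show False
      using pointed y v(2) by auto
  qed
  then obtain a b where "0 < b" "\<forall>x\<in>convex hull (v ` rays I). a \<bullet> x > b"
    using separating_hyperplane_closed_0[of "convex hull (v ` rays I)"] finite_rays
    by (metis compact_imp_closed convex_convex_hull finite_imageI finite_imp_compact_convex_hull)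
  then have "0 < a \<bullet> v i" if "i \<in> rays I" for i
    using that hull_inc[of "v i" "v ` rays I" convex] by fastforce
  moreover have "linear (\<lambda>x. a \<bullet> x)"
    by (simp add: bounded_linear.linear bounded_linear_inner_right)
  ultimately show ?thesis
    using that by blast
qed

end

text \<open>Where the lattice point sums converge, both sides compute the same one. The deformation
  along \<psi> reaches this region from any \<open>Y\<close>, and the identity theorem leads back to
  \<open>l = 0\<close>.\<close>

lemma cone_series_sum_independent:
  fixes Y :: "'a::euclidean_space \<Rightarrow> complex"
  assumes T1: "fan_triangulation n L \<Delta> v \<Delta>1 \<rho>1 \<kappa>1" and T2: "fan_triangulation n L \<Delta> v \<Delta>2 \<rho>2 \<kappa>2"
    and I: "I \<in> stratum \<Delta> n" and y0: "y0 \<in> span L"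
    and generic: "fan_triangulation.generic n L \<Delta> v \<Delta>1 \<kappa>1 y0" "fan_triangulation.generic n L \<Delta> v \<Delta>2 \<kappa>2 y0"
    and Y: "linear Y" "\<And>i. i \<in> stratum \<Delta> 1 \<Longrightarrow> leq \<Delta> i I \<Longrightarrow> e2pi (Y (v i)) \<noteq> 1"
  shows "(\<Sum>I'\<in>fan_triangulation.tops n \<Delta>1 \<rho>1 I. lattice_frame.cone_series L I' (transport \<Delta> \<kappa>1 v) y0 Y) =
    (\<Sum>I'\<in>fan_triangulation.tops n \<Delta>2 \<rho>2 I. lattice_frame.cone_series L I' (transport \<Delta> \<kappa>2 v) y0 Y)"
proof -
  interpret A: fan_triangulation n L \<Delta> v \<Delta>1 \<rho>1 \<kappa>1 by (rule T1)
  interpret B: fan_triangulation n L \<Delta> v \<Delta>2 \<rho>2 \<kappa>2 by (rule T2)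
  let ?R = "A.rays I"
  obtain \<psi> :: "'a \<Rightarrow> real" where \<psi>: "linear \<psi>" "\<And>i. i \<in> ?R \<Longrightarrow> 0 < \<psi> (v i)"
    using A.strictly_positive_functional[OF A.stratum_elts[OF I]] by blast
  let ?Y = "\<lambda>l x. Y x + l * of_real (\<psi> x)"
  have lin: "linear (?Y l)" for l
    by (rule linearI) (simp_all add: linear_add[OF Y(1)] linear_add[OF \<psi>(1)] linear_scale[OF Y(1)]
        linear_scale[OF \<psi>(1)] ring_distribs scaleR_conv_of_real mult_ac)
  obtain N1 where N1: "N1 holomorphic_on UNIV"
    "\<forall>l. (\<forall>i\<in>?R. e2pi (?Y l (v i)) \<noteq> 1) \<longrightarrow>
      (\<Sum>I'\<in>A.tops I. A.cone_ser I' y0 (?Y l)) * (\<Prod>i\<in>?R. 1 - e2pi (?Y l (v i))) = N1 l"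
    using A.cone_series_continuation[of I Y \<psi> y0] by (elim exE conjE)
  obtain N2 where N2: "N2 holomorphic_on UNIV"
    "\<forall>l. (\<forall>i\<in>?R. e2pi (?Y l (v i)) \<noteq> 1) \<longrightarrow>
      (\<Sum>I'\<in>B.tops I. B.cone_ser I' y0 (?Y l)) * (\<Prod>i\<in>?R. 1 - e2pi (?Y l (v i))) = N2 l"
    using B.cone_series_continuation[of I Y \<psi> y0] by (elim exE conjE)
  \<comment> \<open>Beyond \<open>b\<close> the growth of \<open>Im l * \<psi>\<close> outweighs any
    negative imaginary part of \<open>Y\<close> on the rays.\<close>
  define b where "b = (\<Sum>i\<in>?R. \<bar>Im (Y (v i))\<bar> / \<psi> (v i))"
  have eq: "N1 l = N2 l" if l: "Im l > b" for l
  proof -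
    have pos: "Im (?Y l (v i)) > 0" if i: "i \<in> ?R" for i
    proof -
      have "\<bar>Im (Y (v i))\<bar> / \<psi> (v i) \<le> b"
        unfolding b_def using i \<psi>(2) A.finite_rays by (intro member_le_sum) (auto simp: less_imp_le)
      then have "\<bar>Im (Y (v i))\<bar> / \<psi> (v i) < Im l"
        using l by simp
      then have "\<bar>Im (Y (v i))\<bar> < Im l * \<psi> (v i)"
        using \<psi>(2)[OF i] by (simp add: divide_less_eq)
      then show ?thesis
        by simp
    qed
    have nz: "e2pi (?Y l (v i)) \<noteq> 1" if "i \<in> ?R" for i
    proof
      assume "e2pi (?Y l (v i)) = 1"
      then have "norm (e2pi (?Y l (v i))) = 1"
        by simp
      then show False
        using pos[OF that] unfolding norm_e2pi by simp
    qed
    have "(\<Sum>I'\<in>A.tops I. A.cone_ser I' y0 (?Y l)) = (\<Sum>I'\<in>B.tops I. B.cone_ser I' y0 (?Y l))"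
      using A.cone_series_sum[OF I y0 generic(1) lin pos] B.cone_series_sum[OF I y0 generic(2) lin pos]
      by (rule has_sum_unique)
    then show ?thesis
      using N1(2)[rule_format, of l, OF nz] N2(2)[rule_format, of l, OF nz] by simp
  qed
  have "N1 0 - N2 0 = 0"
  proof (rule analytic_continuation[where f = "\<lambda>l. N1 l - N2 l" and w = 0 and S = UNIV and U = "{l. Im l > b}" and \<xi> = "Complex 0 (b + 1)"])
    show "(\<lambda>l. N1 l - N2 l) holomorphic_on UNIV"
      using N1(1) N2(1) by (rule holomorphic_on_diff)
    show "Complex 0 (b + 1) islimpt {l. Im l > b}"
      using open_halfspace_Im_gt[of b] by (intro interior_limit_point) (simp add: interior_open)
    show "N1 l - N2 l = 0" if "l \<in> {l. Im l > b}" for l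
      using eq that by simp
  qed (simp_all add: connected_UNIV)
  then have "N1 0 = N2 0"
    by simp
  have nz0: "e2pi (?Y 0 (v i)) \<noteq> 1" if "i \<in> ?R" for i
    using Y(2) that by (simp add: A.rays_def)
  \<comment> \<open>The common denominator at \<open>l = 0\<close>. It is non-zero by the hypothesis
    on \<open>Y\<close>, so it can be cancelled.\<close>
  define P where "P = (\<Prod>i\<in>?R. 1 - e2pi (Y (v i)))"
  have "P \<noteq> 0"
    using nz0 A.finite_rays by (auto simp: P_def prod_zero_iff)
  moreover have "(\<Sum>I'\<in>A.tops I. A.cone_ser I' y0 Y) * P = N1 0"
    using N1(2)[rule_format, of 0, OF nz0] by (simp add: P_def)
  moreover have "(\<Sum>I'\<in>B.tops I. B.cone_ser I' y0 Y) * P = N2 0"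
    using N2(2)[rule_format, of 0, OF nz0] by (simp add: P_def)
  ultimately show ?thesis
    using \<open>N1 0 = N2 0\<close> mult_right_cancel by metis
qed

section \<open>Generic directions\<close>

lemma finite_functionals_nonzero:
  fixes U :: "('a::euclidean_space \<Rightarrow> real) set"
  assumes "finite U" "subspace V" "\<And>f. f \<in> U \<Longrightarrow> linear f" "\<And>f. f \<in> U \<Longrightarrow> \<exists>x\<in>V. f x \<noteq> 0"
  obtains \<eta> where "\<eta> \<in> V" "\<And>f. f \<in> U \<Longrightarrow> f \<eta> \<noteq> 0"
proof -
  have "\<exists>\<eta>\<in>V. \<forall>f\<in>U. f \<eta> \<noteq> 0"
    using assms(1,3,4)
  proof (induction U)
    case empty
    then show ?case
      using subspace_0[OF assms(2)] by auto
  next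
    case (insert f U)
    then obtain \<eta> where \<eta>: "\<eta> \<in> V" "\<forall>g\<in>U. g \<eta> \<noteq> 0"
      by auto
    obtain \<xi> where \<xi>: "\<xi> \<in> V" "f \<xi> \<noteq> 0"
      using insert.prems(2) by auto
    have lin: "g (\<eta> + e *\<^sub>R \<xi>) = g \<eta> + e * g \<xi>" if "g \<in> insert f U" for g e
      using insert.prems(1)[OF that] by (simp add: linear_add linear_scale)
    \<comment> \<open>Along the line \<eta> + e \<xi> each functional excludes at most one
      \<open>e\<close>. When g \<xi> = 0 the quotient is 0 by convention and excludes only the
      harmless value 0.\<close>
    have "finite (\<Union>g\<in>insert f U. {- g \<eta> / g \<xi>})"
      using insert.hyps(1) by simp
    then obtain e where e: "e \<notin> (\<Union>g\<in>insert f U. {- g \<eta> / g \<xi>})"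
      using ex_new_if_finite infinite_UNIV_char_0 by blast
    have "g (\<eta> + e *\<^sub>R \<xi>) \<noteq> 0" if g: "g \<in> insert f U" for g
    proof
      assume "g (\<eta> + e *\<^sub>R \<xi>) = 0"
      then have *: "g \<eta> + e * g \<xi> = 0"
        using lin[OF g] by simp
      show False
      proof (cases "g \<xi> = 0")
        case True
        then show False
          using * \<eta>(2) \<xi>(2) g by auto
      next
        case False
        then have "e = - g \<eta> / g \<xi>"
          using * by (simp add: field_simps)
        then show False
          using e g by auto
      qed
    qed
    moreover have "\<eta> + e *\<^sub>R \<xi> \<in> V"
      using \<eta>(1) \<xi>(1) assms(2) by (intro subspace_add subspace_scale)
    ultimately show ?case
      by blast
  qed
  then show ?thesis
    using that by blast
qed

lemma lattice_countable:
  assumes "is_lattice n L"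
  shows "countable L"
proof -
  obtain B where B: "finite B" "L = int_span B"
    using assms by (auto elim: is_latticeE)
  have "L \<subseteq> (\<lambda>k. \<Sum>b\<in>B. of_int (k b) *\<^sub>R b) ` PiE B (\<lambda>_. UNIV :: int set)"
  proof
    fix x assume "x \<in> L"
    then obtain c :: "'a \<Rightarrow> int" where "x = (\<Sum>b\<in>B. of_int (c b) *\<^sub>R b)"
      using B(2) by (auto simp: int_span_def)
    then have "x = (\<Sum>b\<in>B. of_int (restrict c B b) *\<^sub>R b)"
      by simp
    then show "x \<in> (\<lambda>k. \<Sum>b\<in>B. of_int (k b) *\<^sub>R b) ` PiE B (\<lambda>_. UNIV :: int set)"
      by (rule image_eqI[where x = "restrict c B"]) auto
  qed
  moreover have "countable (PiE B (\<lambda>_. UNIV :: int set))"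
    using B(1) by (intro countable_PiE) auto
  ultimately show ?thesis
    by (rule countable_subset[OF _ countable_image])
qed

lemma of_real_of_rat: "complex_of_real (of_rat r) = of_rat r"
  by (cases r) (simp add: of_rat_rat)

section \<open>Decomposition of the genus\<close>

context fan_triangulation
begin

text \<open>The simplices are grouped by their image under \<open>\<rho>\<close>, on which both the
  weight and the linear form interpolating the \<open>d i\<close> depend.\<close>

lemma genus_eq_sum:
  assumes U: "\<And>I i. I \<in> stratum \<Delta> n \<Longrightarrow> i \<in> rays I \<Longrightarrow> U I (v i) = of_rat (d i)"
  shows "orbifold_elliptic_genus n L \<Delta>' vv (transport \<Delta> \<kappa> d) \<tau> \<sigma> w =
    (\<Sum>I\<in>stratum \<Delta> n. of_int (weight \<Delta> I) *
      (\<Sum>I'\<in>tops I. lattice_frame.genus_term L I' vv \<tau> (\<lambda>x. of_real (U I x) * \<sigma>) w))"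
proof -
  define g where "g I' = of_int (weight \<Delta>' I') / of_nat (card (quotient_group L vv I')) *
        (\<Sum>(h1, h2)\<in>quotient_group L vv I' \<times> quotient_group L vv I'.
           \<Prod>x\<in>I'. e2pi (of_rat (transport \<Delta> \<kappa> d x) * of_real (dual_basis vv I' x (representative h1)) * \<sigma>) *
                 phi_st (phi_argument vv \<tau> w I' h1 h2 x) \<tau> (of_rat (transport \<Delta> \<kappa> d x) * \<sigma>))" for I'
  have "orbifold_elliptic_genus n L \<Delta>' vv (transport \<Delta> \<kappa> d) \<tau> \<sigma> w = sum g (stratum \<Delta>' n)"
    by (simp add: orbifold_elliptic_genus_def g_def)
  also have "\<dots> = (\<Sum>I\<in>stratum \<Delta> n. sum g (tops I))"
    unfolding tops_def using rho_top
    by (intro sum.group[symmetric] finite_stratum finite_stratum') auto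
  also have "\<dots> = (\<Sum>I\<in>stratum \<Delta> n. of_int (weight \<Delta> I) *
      (\<Sum>I'\<in>tops I. lattice_frame.genus_term L I' vv \<tau> (\<lambda>x. of_real (U I x) * \<sigma>) w))"
  proof (intro sum.cong refl)
    fix I assume I: "I \<in> stratum \<Delta> n"
    have "g I' = of_int (weight \<Delta> I) * lattice_frame.genus_term L I' vv \<tau> (\<lambda>x. of_real (U I x) * \<sigma>) w"
      if I': "I' \<in> tops I" for I'
    proof -
      have top: "I' \<in> stratum \<Delta>' n" "\<rho> I' = I"
        using I' by (simp_all add: tops_def)
      interpret fr: lattice_frame n L I' vv
        using top_simplex(1)[OF top(1)] .
      have val: "of_rat (transport \<Delta> \<kappa> d x) * \<sigma> = of_real (U I (vv x)) * \<sigma>" if "x \<in> I'" for x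
      proof -
        have "U I (v (edge x)) = of_rat (d (edge x))"
          using U[OF I] top_edges(1)[OF I'] that by blast
        moreover have "transport \<Delta> \<kappa> d x = d (edge x)"
          by (simp add: transport_def edge_def)
        ultimately show ?thesis
          by (simp add: vv_edge of_real_of_rat)
      qed
      have "(\<Prod>x\<in>I'. e2pi (of_rat (transport \<Delta> \<kappa> d x) * of_real (dual_basis vv I' x (representative h1)) * \<sigma>) *
                 phi_st (phi_argument vv \<tau> w I' h1 h2 x) \<tau> (of_rat (transport \<Delta> \<kappa> d x) * \<sigma>)) =
          (\<Prod>x\<in>I'. e2pi (of_real (U I (vv x)) * \<sigma> * of_real (fr.u x (representative h1))) *
                 phi_st (phi_argument vv \<tau> w I' h1 h2 x) \<tau> (of_real (U I (vv x)) * \<sigma>))" for h1 h2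
      proof (rule prod.cong[OF refl])
        fix x assume x: "x \<in> I'"
        have "of_rat (transport \<Delta> \<kappa> d x) * of_real (dual_basis vv I' x (representative h1)) * \<sigma> =
            (of_rat (transport \<Delta> \<kappa> d x) * \<sigma>) * of_real (fr.u x (representative h1))"
          by (simp add: fr.u_def)
        then show "e2pi (of_rat (transport \<Delta> \<kappa> d x) * of_real (dual_basis vv I' x (representative h1)) * \<sigma>) *
                 phi_st (phi_argument vv \<tau> w I' h1 h2 x) \<tau> (of_rat (transport \<Delta> \<kappa> d x) * \<sigma>) =
            e2pi (of_real (U I (vv x)) * \<sigma> * of_real (fr.u x (representative h1))) *
                 phi_st (phi_argument vv \<tau> w I' h1 h2 x) \<tau> (of_real (U I (vv x)) * \<sigma>)"
          by (simp only: val[OF x])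
      qed
      then show ?thesis
        by (simp add: g_def fr.genus_term_def weight_rho[OF top(1)] top(2))
    qed
    then show "sum g (tops I) = of_int (weight \<Delta> I) *
        (\<Sum>I'\<in>tops I. lattice_frame.genus_term L I' vv \<tau> (\<lambda>x. of_real (U I x) * \<sigma>) w)"
      by (simp add: sum_distrib_left)
  qed
  finally show ?thesis .
qed

text \<open>The displacement of \<open>w\<close> is purely imaginary because genericity concerns
  \<open>snd w\<close> alone. At \<open>e = 0\<close> the domain condition keeps every argument off
  the poles of \<open>phi_st\<close>.\<close>

lemma isCont_genus:
  assumes tau: "Im \<tau> > 0" and w: "w \<in> genus_domain n L \<Delta>' vv \<tau>"
    and sigma: "\<forall>i\<in>stratum \<Delta> 1. of_rat (d i) * \<sigma> \<notin> period_lattice \<tau>"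
  shows "isCont (\<lambda>e. orbifold_elliptic_genus n L \<Delta>' vv (transport \<Delta> \<kappa> d) \<tau> \<sigma> (fst w, snd w + e *\<^sub>R \<eta>)) 0"
  unfolding orbifold_elliptic_genus_def case_prod_unfold
proof (intro continuous_intros)
  fix I' h x
  assume I': "I' \<in> stratum \<Delta>' n" and h: "h \<in> quotient_group L vv I' \<times> quotient_group L vv I'" and x: "x \<in> I'"
  interpret fr: lattice_frame n L I' vv
    using top_simplex(1)[OF I'] .
  let ?arg = "\<lambda>e. phi_argument vv \<tau> (fst w, snd w + e *\<^sub>R \<eta>) I' (fst h) (snd h) x"
  have "?arg = (\<lambda>e. phi_argument vv \<tau> w I' (fst h) (snd h) x - \<i> * of_real (e * fr.u x \<eta>))"
    using x by (intro ext) (simp add: fr.phi_argument_eq pairing_complex_def fr.u_add fr.u_scale complex_eq_iff)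
  then have "isCont ?arg 0"
    by (simp only:) (intro continuous_intros)
  moreover have "?arg 0 \<notin> period_lattice \<tau>"
    using w I' h x by (auto simp: genus_domain_def)
  moreover have "of_rat (transport \<Delta> \<kappa> d x) * \<sigma> \<notin> period_lattice \<tau>"
    using sigma vertex(1)[OF stratum_elts'[OF I'] x] by (simp add: transport_def edge_def)
  ultimately show "isCont (\<lambda>e. phi_st (?arg e) \<tau> (of_rat (transport \<Delta> \<kappa> d x) * \<sigma>)) 0"
    by (intro isCont_o2[OF _ isCont_phi_st[OF tau]])
qed

definition functionals where
  "functionals = (\<Union>I'\<in>stratum \<Delta>' n. dual_basis vv I' ` I')"

lemma functionals:
  "finite functionals" "f \<in> functionals \<Longrightarrow> linear f" "f \<in> functionals \<Longrightarrow> \<exists>x\<in>span L. f x \<noteq> 0"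
proof -
  show "finite functionals"
    unfolding functionals_def using finite_stratum' stratum_elts' finite_simplex by blast
  assume "f \<in> functionals"
  then obtain I' i where I': "I' \<in> stratum \<Delta>' n" "i \<in> I'" "f = dual_basis vv I' i"
    by (auto simp: functionals_def)
  interpret fr: lattice_frame n L I' vv
    using top_simplex(1)[OF I'(1)] .
  show "linear f"
    using fr.linear_u[OF I'(2)] I'(3) by (simp add: fr.u_def)
  have "f (vv i) = 1"
    using fr.u_v[OF I'(2) I'(2)] I'(3) by (simp add: fr.u_def)
  then show "\<exists>x\<in>span L. f x \<noteq> 0"
    using fr.L_span[OF fr.v_in_L[OF I'(2)]] by force
qed

text \<open>A wall functional that does not vanish at \<eta> and a lattice point together determine
  the one displacement at which the point meets the wall, and there are countably many such
  pairs.\<close>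

lemma countable_nongeneric:
  assumes \<eta>: "\<And>f. f \<in> functionals \<Longrightarrow> f \<eta> \<noteq> 0" and T: "T > 0"
  shows "countable {e. \<not> generic ((y + e *\<^sub>R \<eta>) /\<^sub>R T)}"
proof -
  have "{e. \<not> generic ((y + e *\<^sub>R \<eta>) /\<^sub>R T)} \<subseteq> (\<Union>f\<in>functionals. (\<lambda>x. (T * f x - f y) / f \<eta>) ` L)"
  proof
    fix e assume "e \<in> {e. \<not> generic ((y + e *\<^sub>R \<eta>) /\<^sub>R T)}"
    then obtain I' i x where *: "I' \<in> stratum \<Delta>' n" "i \<in> I'" "x \<in> L"
      "dual_basis vv I' i (x - (y + e *\<^sub>R \<eta>) /\<^sub>R T) = 0"
      by (auto simp: generic_def)
    define f where "f = dual_basis vv I' i"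
    have f: "f \<in> functionals"
      using * by (auto simp: functionals_def f_def)
    have "f x - (f y + e * f \<eta>) / T = 0"
      using *(4) functionals(2)[OF f] unfolding f_def[symmetric]
      by (simp add: linear_diff linear_add linear_scale divide_inverse mult.commute)
    then have "e * f \<eta> = T * f x - f y"
      using T by (simp add: field_simps)
    then have "e = (T * f x - f y) / f \<eta>"
      using \<eta>[OF f] by (simp add: field_simps)
    then show "e \<in> (\<Union>f\<in>functionals. (\<lambda>x. (T * f x - f y) / f \<eta>) ` L)"
      using f *(3) by blast
  qed
  moreover have "countable (\<Union>f\<in>functionals. (\<lambda>x. (T * f x - f y) / f \<eta>) ` L)"
    by (rule countable_UN[OF countable_finite[OF functionals(1)] countable_image[OF lattice_countable[OF lattice]]])
  ultimately show ?thesis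
    by (rule countable_subset)
qed

end

section \<open>Independence of the triangulation\<close>

lemma genus_independent_generic:
  fixes L :: "'a::euclidean_space set"
  assumes T1: "fan_triangulation n L \<Delta> v \<Delta>1 \<rho>1 \<kappa>1" and T2: "fan_triangulation n L \<Delta> v \<Delta>2 \<rho>2 \<kappa>2"
    and Q_Cartier: "is_Q_Cartier n L \<Delta> v d"
    and tau: "Im \<tau> > 0"
    and sigma: "\<forall>i\<in>stratum \<Delta> 1. of_rat (d i) * \<sigma> \<notin> period_lattice \<tau>"
    and w: "fst w \<in> span L" "snd w \<in> span L"
    and generic: "fan_triangulation.generic n L \<Delta> v \<Delta>1 \<kappa>1 (snd w /\<^sub>R Im \<tau>)"
      "fan_triangulation.generic n L \<Delta> v \<Delta>2 \<kappa>2 (snd w /\<^sub>R Im \<tau>)"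
  shows "orbifold_elliptic_genus n L \<Delta>1 (transport \<Delta> \<kappa>1 v) (transport \<Delta> \<kappa>1 d) \<tau> \<sigma> w =
    orbifold_elliptic_genus n L \<Delta>2 (transport \<Delta> \<kappa>2 v) (transport \<Delta> \<kappa>2 d) \<tau> \<sigma> w"
proof -
  interpret A: fan_triangulation n L \<Delta> v \<Delta>1 \<rho>1 \<kappa>1 by (rule T1)
  interpret B: fan_triangulation n L \<Delta> v \<Delta>2 \<rho>2 \<kappa>2 by (rule T2)
  have "\<forall>I\<in>stratum \<Delta> n. \<exists>u :: 'a \<Rightarrow> real. linear u \<and> (\<forall>i\<in>A.rays I. u (v i) = of_rat (d i))"
  proof
    fix I assume "I \<in> stratum \<Delta> n"
    then obtain u where "u \<in> rational_dual L" "\<forall>i\<in>stratum \<Delta> 1. leq \<Delta> i I \<longrightarrow> u (v i) = of_rat (d i)"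
      using Q_Cartier unfolding is_Q_Cartier_def by blast
    then show "\<exists>u :: 'a \<Rightarrow> real. linear u \<and> (\<forall>i\<in>A.rays I. u (v i) = of_rat (d i))"
      unfolding rational_dual_def A.rays_def by blast
  qed
  from bchoice[OF this] obtain U
    where U_all: "\<forall>I\<in>stratum \<Delta> n. linear (U I :: 'a \<Rightarrow> real) \<and> (\<forall>i\<in>A.rays I. U I (v i) = of_rat (d i))"
    by (elim exE)
  have U: "linear (U I)" "\<And>i. i \<in> A.rays I \<Longrightarrow> U I (v i) = of_rat (d i)" if "I \<in> stratum \<Delta> n" for I
    using bspec[OF U_all that] by auto
  define s where "s I x = of_real (U I x) * \<sigma>" for I x
  have sv: "s I (v i) = of_rat (d i) * \<sigma>" if "I \<in> stratum \<Delta> n" "i \<in> A.rays I" for I i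
    using U(2)[OF that] by (simp add: s_def of_real_of_rat)
  have s_nz: "s I (v i) \<notin> period_lattice \<tau>" if "I \<in> stratum \<Delta> n" "i \<in> A.rays I" for I i
    unfolding sv[OF that] using sigma that(2) by (simp add: A.rays_def)
  have lin_s: "linear (s I)" if "I \<in> stratum \<Delta> n" for I
    unfolding s_def by (rule linearI) (simp_all add: linear_add[OF U(1)[OF that]] linear_scale[OF U(1)[OF that]]
        ring_distribs scaleR_conv_of_real mult_ac)
  define y0 where "y0 = snd w /\<^sub>R Im \<tau>"
  have y0: "y0 \<in> span L"
    unfolding y0_def using w(2) by (rule span_scale)
  have *: "(\<Sum>I'\<in>A.tops I. lattice_frame.genus_term L I' A.vv \<tau> (s I) w) =
      (\<Sum>I'\<in>B.tops I. lattice_frame.genus_term L I' B.vv \<tau> (s I) w)" if I: "I \<in> stratum \<Delta> n" for I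
  proof -
    have 1: "((\<lambda>m. \<Sum>I'\<in>A.tops I. lattice_frame.dual_term L I' A.vv \<tau> (s I) w m) has_sum
        (\<Sum>I'\<in>A.tops I. lattice_frame.genus_term L I' A.vv \<tau> (s I) w)) (dual_lattice L)"
    proof (rule has_sum_sum[OF A.finite_tops])
      fix I' assume I': "I' \<in> A.tops I"
      interpret fr: lattice_frame n L I' A.vv
        using A.top_simplex(1) I' by (simp add: A.tops_def)
      show "(fr.dual_term \<tau> (s I) w has_sum fr.genus_term \<tau> (s I) w) (dual_lattice L)"
      proof (rule fr.genus_term_has_sum[OF tau lin_s[OF I] _ w])
        show "s I (A.vv i) \<notin> period_lattice \<tau>" if "i \<in> I'" for i
          using s_nz[OF I] A.top_edges(1)[OF I'] that by (auto simp: A.vv_edge)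
        show "fr.u i (x - snd w /\<^sub>R Im \<tau>) \<noteq> 0" if "x \<in> L" "i \<in> I'" for x i
          using generic(1) I' that by (simp add: A.generic_def A.tops_def fr.u_def)
      qed
    qed
    have 2: "((\<lambda>m. \<Sum>I'\<in>B.tops I. lattice_frame.dual_term L I' B.vv \<tau> (s I) w m) has_sum
        (\<Sum>I'\<in>B.tops I. lattice_frame.genus_term L I' B.vv \<tau> (s I) w)) (dual_lattice L)"
    proof (rule has_sum_sum[OF B.finite_tops])
      fix I' assume I': "I' \<in> B.tops I"
      interpret fr: lattice_frame n L I' B.vv
        using B.top_simplex(1) I' by (simp add: B.tops_def)
      show "(fr.dual_term \<tau> (s I) w has_sum fr.genus_term \<tau> (s I) w) (dual_lattice L)"
      proof (rule fr.genus_term_has_sum[OF tau lin_s[OF I] _ w])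
        show "s I (B.vv i) \<notin> period_lattice \<tau>" if "i \<in> I'" for i
          using s_nz[OF I] B.top_edges(1)[OF I'] that by (auto simp: B.vv_edge)
        show "fr.u i (x - snd w /\<^sub>R Im \<tau>) \<noteq> 0" if "x \<in> L" "i \<in> I'" for x i
          using generic(2) I' that by (simp add: B.generic_def B.tops_def fr.u_def)
      qed
    qed
    \<comment> \<open>Comparison coefficient by coefficient: the scalar factor of
      \<open>dual_term\<close> does not involve the triangulation, and the rest is the cone series
      at a linear \<open>Y\<close>.\<close>
    have "(\<Sum>I'\<in>A.tops I. lattice_frame.dual_term L I' A.vv \<tau> (s I) w m) =
        (\<Sum>I'\<in>B.tops I. lattice_frame.dual_term L I' B.vv \<tau> (s I) w m)" if m: "m \<in> dual_lattice L" for m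
    proof -
      define Y where "Y x = s I x + \<tau> * of_real (m \<bullet> x)" for x
      have Y: "linear Y"
        unfolding Y_def by (rule linearI) (simp_all add: linear_add[OF lin_s[OF I]] linear_scale[OF lin_s[OF I]]
            ring_distribs scaleR_conv_of_real inner_add_right mult_ac)
      \<comment> \<open>As \<open>m\<close> is integral on \<open>L\<close>, a vanishing denominator
        would put d_i \<sigma> into the period lattice.\<close>
      have nz: "e2pi (Y (v i)) \<noteq> 1" if i: "i \<in> stratum \<Delta> 1" "leq \<Delta> i I" for i
      proof
        assume "e2pi (Y (v i)) = 1"
        then obtain k :: int where k: "Y (v i) = of_int k"
          by (auto simp: e2pi_eq_1_iff)
        have "v i \<in> L"
          using A.edge_vectors i(1) by (simp add: is_edge_vectors_def)
        then obtain j :: int where "m \<bullet> v i = of_int j"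
          using m by (auto simp: dual_lattice_def elim: Ints_cases)
        then have "s I (v i) = of_int k + of_int (- j) * \<tau>"
          using k by (simp add: Y_def algebra_simps)
        then have "s I (v i) \<in> period_lattice \<tau>"
          unfolding period_lattice_def by blast
        then show False
          using s_nz[OF I] i by (simp add: A.rays_def)
      qed
      have dtA: "lattice_frame.dual_term L I' A.vv \<tau> (s I) w m =
          e2pi (- pairing_complex (\<lambda>y. m \<bullet> y) w) * A.cone_ser I' y0 Y" if "I' \<in> A.tops I" for I'
        using lattice_frame.dual_term_def[OF A.top_simplex(1)] that
        unfolding Y_def y0_def by (simp add: A.tops_def)
      have dtB: "lattice_frame.dual_term L I' B.vv \<tau> (s I) w m =
          e2pi (- pairing_complex (\<lambda>y. m \<bullet> y) w) * B.cone_ser I' y0 Y" if "I' \<in> B.tops I" for I'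
        using lattice_frame.dual_term_def[OF B.top_simplex(1)] that
        unfolding Y_def y0_def by (simp add: B.tops_def)
      show ?thesis
        using cone_series_sum_independent[OF T1 T2 I y0 generic[folded y0_def] Y nz] dtA dtB
        by (simp flip: sum_distrib_left)
    qed
    then show ?thesis
      using has_sum_unique[OF 1] 2 by (simp cong: has_sum_cong)
  qed
  have "orbifold_elliptic_genus n L \<Delta>1 A.vv (transport \<Delta> \<kappa>1 d) \<tau> \<sigma> w = (\<Sum>I\<in>stratum \<Delta> n.
      of_int (weight \<Delta> I) * (\<Sum>I'\<in>A.tops I. lattice_frame.genus_term L I' A.vv \<tau> (s I) w))"
    unfolding s_def by (rule A.genus_eq_sum) (rule U(2))
  also have "\<dots> = (\<Sum>I\<in>stratum \<Delta> n.
      of_int (weight \<Delta> I) * (\<Sum>I'\<in>B.tops I. lattice_frame.genus_term L I' B.vv \<tau> (s I) w))"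
    by (simp add: * cong: sum.cong)
  also have "\<dots> = orbifold_elliptic_genus n L \<Delta>2 B.vv (transport \<Delta> \<kappa>2 d) \<tau> \<sigma> w"
    unfolding s_def by (rule B.genus_eq_sum[symmetric]) (rule U(2))
  finally show ?thesis .
qed

theorem theorem9p1:
  fixes L :: "'a::euclidean_space set"
    and n :: nat
    and \<Delta> :: "('s, 'a) multi_fan"
    and v :: "'s \<Rightarrow> 'a"
    and d :: "'s \<Rightarrow> rat"
    and \<Delta>1 :: "('v1 set, 'a) multi_fan"
    and \<Delta>2 :: "('v2 set, 'a) multi_fan"
    and \<rho>1 :: "'v1 set \<Rightarrow> 's" and \<kappa>1 :: "'s \<Rightarrow> 'v1 set"
    and \<rho>2 :: "'v2 set \<Rightarrow> 's" and \<kappa>2 :: "'s \<Rightarrow> 'v2 set"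
    and \<tau> \<sigma> :: complex
    and w :: "'a \<times> 'a"
  assumes lattice: "is_lattice n L"
    and multi_fan: "is_multi_fan L \<Delta>"
    and top: "\<forall>J\<in>elts \<Delta>. \<exists>I\<in>stratum \<Delta> n. leq \<Delta> J I"
    and edge_vectors: "is_edge_vectors L \<Delta> v"
    and Q_Cartier: "is_Q_Cartier n L \<Delta> v d"
    and triangulation1: "is_triangulation n L \<Delta> \<Delta>1 \<rho>1 \<kappa>1"
    and triangulation2: "is_triangulation n L \<Delta> \<Delta>2 \<rho>2 \<kappa>2"
    and tau: "Im \<tau> > 0"
    and sigma: "\<forall>i\<in>stratum \<Delta> 1. of_rat (d i) * \<sigma> \<notin> period_lattice \<tau>"
    and w1: "w \<in> genus_domain n L \<Delta>1 (transport \<Delta> \<kappa>1 v) \<tau>"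
    and w2: "w \<in> genus_domain n L \<Delta>2 (transport \<Delta> \<kappa>2 v) \<tau>"
  shows "orbifold_elliptic_genus n L \<Delta>1 (transport \<Delta> \<kappa>1 v) (transport \<Delta> \<kappa>1 d) \<tau> \<sigma> w
       = orbifold_elliptic_genus n L \<Delta>2 (transport \<Delta> \<kappa>2 v) (transport \<Delta> \<kappa>2 d) \<tau> \<sigma> w"
proof -
  have T1: "fan_triangulation n L \<Delta> v \<Delta>1 \<rho>1 \<kappa>1" and T2: "fan_triangulation n L \<Delta> v \<Delta>2 \<rho>2 \<kappa>2"
    using lattice multi_fan edge_vectors triangulation1 triangulation2 by (simp_all add: fan_triangulation_def)
  interpret A: fan_triangulation n L \<Delta> v \<Delta>1 \<rho>1 \<kappa>1 by (rule T1)
  interpret B: fan_triangulation n L \<Delta> v \<Delta>2 \<rho>2 \<kappa>2 by (rule T2)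
  have w: "fst w \<in> span L" "snd w \<in> span L"
    using w1 by (auto simp: genus_domain_def complexification_def)
  \<comment> \<open>A direction transversal to the walls of both triangulations, so that moving
    along it leaves each wall at once.\<close>
  obtain \<eta> where \<eta>: "\<eta> \<in> span L" "\<And>f. f \<in> A.functionals \<union> B.functionals \<Longrightarrow> f \<eta> \<noteq> 0"
  proof (rule finite_functionals_nonzero[of "A.functionals \<union> B.functionals" "span L"])
    show "finite (A.functionals \<union> B.functionals)"
      using A.functionals(1) B.functionals(1) by simp
  qed (use A.functionals B.functionals in auto)
  define G1 where "G1 e = orbifold_elliptic_genus n L \<Delta>1 (transport \<Delta> \<kappa>1 v) (transport \<Delta> \<kappa>1 d) \<tau> \<sigma>
      (fst w, snd w + e *\<^sub>R \<eta>)" for e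
  define G2 where "G2 e = orbifold_elliptic_genus n L \<Delta>2 (transport \<Delta> \<kappa>2 v) (transport \<Delta> \<kappa>2 d) \<tau> \<sigma>
      (fst w, snd w + e *\<^sub>R \<eta>)" for e
  define bad where "bad = {e. \<not> A.generic ((snd w + e *\<^sub>R \<eta>) /\<^sub>R Im \<tau>)} \<union>
      {e. \<not> B.generic ((snd w + e *\<^sub>R \<eta>) /\<^sub>R Im \<tau>)}"
  have "countable bad"
    unfolding bad_def using \<eta>(2) tau by (intro countable_Un A.countable_nongeneric B.countable_nongeneric) auto
  have good: "G1 e = G2 e" if "e \<notin> bad" for e
    unfolding G1_def G2_def
  proof (rule genus_independent_generic[OF T1 T2 Q_Cartier tau sigma])
    show "snd (fst w, snd w + e *\<^sub>R \<eta>) \<in> span L"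
      using w(2) \<eta>(1) by (simp add: span_add span_scale)
  qed (use that w in \<open>auto simp: bad_def\<close>)
  have "isCont (\<lambda>e. G1 e - G2 e) 0"
    unfolding G1_def G2_def
    by (intro continuous_intros A.isCont_genus[OF tau w1 sigma] B.isCont_genus[OF tau w2 sigma])
  have "G1 0 = G2 0"
  proof (rule ccontr)
    assume "G1 0 \<noteq> G2 0"
    then obtain r where r: "r > 0" "\<And>e. dist 0 e < r \<Longrightarrow> G1 e - G2 e \<noteq> 0"
      using continuous_at_avoid[OF \<open>isCont (\<lambda>e. G1 e - G2 e) 0\<close>, of 0] by auto
    \<comment> \<open>A difference at 0 persists on an interval by continuity, but an interval is
      too large for the countable set of nongeneric displacements.\<close>
    have "{0<..<r} \<subseteq> bad"
      using r(2) good by (force simp: dist_norm)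
    then show False
      using countable_subset[OF _ \<open>countable bad\<close>] uncountable_open_interval[of 0 r] r(1) by blast
  qed
  then show ?thesis
    by (simp add: G1_def G2_def)
qed

end
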